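(* Consider the network setting of the context for every depth $L$, and assume: (i) for each $L$, the quantities $q_\ell,\alpha_\ell,\gamma_\ell,\sigma_{\ell+1}$ ($\ell=0,1,\dots,L-1$) do not depend on $\ell$ (write them $q^{(L)},\alpha^{(L)},\gamma^{(L)},\sigma^{(L)}$; they may depend on $L$), and each converges to a finite limit as $L\to\infty$, with $q=\lim_{L\to\infty}q^{(L)}$; (ii) the limits $$\varepsilon_1=\lim_{L\to\infty}L(1-\alpha^{(L)}),\qquad \varepsilon_2=-\lim_{L\to\infty}L\log\big((\sigma^{(L)})^2\gamma^{(L)}\big)$$ exist and satisfy $|\varepsilon_1|,|\varepsilon_2|<1$. Then for all sufficiently large $L$, $\|\mu_L\|_\infty$ is an atom of $\mu_L$ with weight $1-(L-1)(1-\alpha^{(L)})$, and $$\lim_{L\to\infty}L^{-1}\|\mu_L\|_\infty=q\,\frac{1-\exp(-\varepsilon_2)}{\varepsilon_2},$$ where $(1-e^{-x})/x$ is interpreted as $1$ at $x=0$. In particular this limit equals $q(1-\varepsilon_2/2)+O(\varepsilon_2^2)$ as $\varepsilon_2\to0$.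
   Context: Network setting (for depth $L$ and width $M$): weights $W_1,\dots,W_L\in\mathbb R^{M\times M}$ with $W_\ell/\sigma_\ell$ ($\sigma_\ell>0$) independent and Haar distributed on $M\times M$ orthogonal matrices; pointwise activations $\varphi^1,\dots,\varphi^{L-1}$, continuous and differentiable except at finitely many points; for input $x\in\mathbb R^M$, $x^0=x$, $h^\ell=W_\ell x^{\ell-1}$, $x^\ell=\varphi^\ell(h^\ell)$, $f_\theta(x)=h^L$, $\theta=(W_1,\dots,W_L)$. $D_\ell=\partial x^\ell/\partial h^\ell$. $\hat q_\ell=\|x^\ell\|^2/M$, with $\hat q_0\to q_0>0$ and $q_\ell=\lim_{M\to\infty}\hat q_\ell$. $H_\ell=\frac1M\frac{\partial h^\ell}{\partial(W_1,\dots,W_\ell)}\frac{\partial h^\ell}{\partial(W_1,\dots,W_\ell)}^\top$ (dual conditional Fisher information matrix; $H_L=\frac1M\frac{\partial f_\theta(x)}{\partial\theta}\frac{\partial f_\theta(x)}{\partial\theta}^\top$). Assume $(D_\ell)_{\ell=1}^{L-1}$ is asymptotically free from $(W_\ell,W_\ell^\top)_{\ell=1}^L$ as $M\to\infty$ almost surely, and that the limit spectral distribution of $D_\ell^2$ is $\nu_\ell=(1-\alpha_\ell)\delta_0+\alpha_\ell\delta_{\gamma_\ell}$ with $0<\alpha_\ell<1$, $\gamma_\ell>0$. $\mu_\ell$ is the limit spectral distribution of $H_\ell$ as $M\to\infty$; under these assumptions $\mu_1=\delta_{q_0}$ and $\mu_{\ell+1}=(q_\ell+\sigma_{\ell+1}^2\,\cdot\,)_*(\nu_\ell\boxtimes\mu_\ell)$,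 where $\boxtimes$ is free multiplicative convolution and $(b+a\,\cdot\,)_*\mu$ is the pushforward under $t\mapsto b+at$. For a compactly supported probability measure $\nu$ on $\mathbb R_+$, $\|\nu\|_\infty$ is the maximum of its support; $t$ is an atom of $\nu$ if $\nu(\{t\})>0$, and $\nu(\{t\})$ is its weight. *)

theory Defs
  imports "HOL-Probability.Probability" "HOL-Library.Landau_Symbols"
begin

definition noncrossing :: "nat set set \<Rightarrow> bool" where
  "noncrossing P \<longleftrightarrow>
     (\<forall>B1\<in>P. \<forall>B2\<in>P. \<forall>a b c d. B1 \<noteq> B2 \<and> a < b \<and> b < c \<and> c < d \<and>
        a \<in> B1 \<and> c \<in> B1 \<and> b \<in> B2 \<and> d \<in> B2 \<longrightarrow> False)"

definition NC :: "nat \<Rightarrow> nat set set set" where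
  "NC n = {P. partition_on {0..<n} P \<and> noncrossing P}"

definition moment :: "real measure \<Rightarrow> nat \<Rightarrow> real" where
  "moment \<rho> n = integral\<^sup>L \<rho> (\<lambda>t. t ^ n)"

definition is_free_cumulants :: "(nat \<Rightarrow> real) \<Rightarrow> (nat \<Rightarrow> real) \<Rightarrow> bool" where
  "is_free_cumulants m \<kappa> \<longleftrightarrow> \<kappa> 0 = 0 \<and>
     (\<forall>n\<ge>1. m n = (\<Sum>P\<in>NC n. \<Prod>B\<in>P. \<kappa> (card B)))"

definition free_cumulant :: "real measure \<Rightarrow> nat \<Rightarrow> real" where
  "free_cumulant \<rho> = (THE \<kappa>. is_free_cumulants (moment \<rho>) \<kappa>)"

definition cpm_Rplus :: "real measure \<Rightarrow> bool" where
  "cpm_Rplus \<rho> \<longleftrightarrow> prob_space \<rho> \<and> sets \<rho> = sets borel \<and>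
     (\<exists>R. measure \<rho> {0..R} = 1)"

text \<open>Noncrossing partitions of 0..<2n none of whose blocks mixes even and odd
  positions (even positions carry a, odd positions carry b in a b a b ... a b).\<close>
definition NC_alt :: "nat \<Rightarrow> nat set set set" where
  "NC_alt n = {P \<in> NC (2 * n). \<forall>B\<in>P. B \<subseteq> {i. even i} \<or> B \<subseteq> {i. odd i}}"

text \<open>Free multiplicative convolution: the compactly supported probability measure
  on R_+ whose n-th moment is phi((ab)^n) for free a ~ nu, b ~ mu, computed by the
  vanishing of mixed free cumulants.\<close>
definition free_mult_conv :: "real measure \<Rightarrow> real measure \<Rightarrow> real measure" (infixl "\<boxtimes>" 70) where
  "\<nu> \<boxtimes> \<mu> = (THE \<rho>. cpm_Rplus \<rho> \<and>
     (\<forall>n\<ge>1. moment \<rho> n =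
        (\<Sum>P\<in>NC_alt n. \<Prod>B\<in>P.
           (if B \<subseteq> {i. even i} then free_cumulant \<nu> (card B) else free_cumulant \<mu> (card B)))))"

definition msupport :: "real measure \<Rightarrow> real set" where
  "msupport \<rho> = {t. \<forall>e>0. measure \<rho> (ball t e) > 0}"

definition supp_max :: "real measure \<Rightarrow> real" where
  "supp_max \<rho> = Sup (msupport \<rho>)"

definition is_atom :: "real measure \<Rightarrow> real \<Rightarrow> bool" where
  "is_atom \<rho> t \<longleftrightarrow> measure \<rho> {t} > 0"

definition two_point :: "real \<Rightarrow> real \<Rightarrow> real measure" where
  "two_point \<alpha> \<gamma> = distr (measure_pmf (bernoulli_pmf \<alpha>)) borel (\<lambda>b. if b then \<gamma> else 0)"

text \<open>Limit spectral distribution mu_l of H_l for layer-independent parameters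
  q, sigma, alpha, gamma:  mu_1 = delta_q, mu_(l+1) = (q + sigma^2 .)_* (nu boxtimes mu_l).
  The index 0 value is an unused dummy.\<close>
fun lsd :: "real \<Rightarrow> real \<Rightarrow> real \<Rightarrow> real \<Rightarrow> nat \<Rightarrow> real measure" where
  "lsd q \<sigma> \<alpha> \<gamma> 0 = return borel q"
| "lsd q \<sigma> \<alpha> \<gamma> (Suc 0) = return borel q"
| "lsd q \<sigma> \<alpha> \<gamma> (Suc (Suc l)) =
     distr (two_point \<alpha> \<gamma> \<boxtimes> lsd q \<sigma> \<alpha> \<gamma> (Suc l)) borel (\<lambda>t. q + \<sigma>\<^sup>2 * t)"

definition expfrac :: "real \<Rightarrow> real" where
  "expfrac x = (if x = 0 then 1 else (1 - exp (- x)) / x)"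

end

theory Submission
  imports Defs "HOL-Computational_Algebra.Computational_Algebra"
    "HOL-Complex_Analysis.Complex_Analysis" "HOL-Real_Asymp.Real_Asymp"
begin

text \<open>
  The free compression of a measure \<open>\<mu>\<close> on \<open>[0, m]\<close> by a projection of trace \<open>1 - \<kappa>\<close> is realised by
  polynomials: if \<open>p\<close> has degree \<open>d\<close> and root distribution close to \<open>\<mu>\<close>, then the roots of its
  \<open>\<lfloor>\<kappa> d\<rfloor>\<close>-th derivative stay in \<open>[0, m]\<close> by Gauss-Lucas, and log-concavity of the Taylor
  coefficients at \<open>z > m\<close> shows that, together with \<open>\<lfloor>\<kappa> d\<rfloor>\<close> zeros, their Cauchy transform converges to
  \<open>\<kappa> / z + \<kappa> / r\<close>, where \<open>r G\<^sub>\<mu> (z + r) = \<kappa>\<close>. Helly's theorem yields a limit measure. Rewritten for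
  moment generating functions this relation is the identity that the alternating noncrossing sums
  satisfy, so that the limit is \<open>\<nu> \<boxtimes> \<mu>\<close> (up to the scale \<open>\<gamma>\<close>). Because the relation holds on all of
  \<open>z > m\<close>, letting \<open>z\<close> decrease to \<open>m\<close> shows that an atom of weight \<open>\<beta> > \<kappa>\<close> at \<open>m\<close> becomes one of
  weight \<open>\<beta> - \<kappa>\<close>. Hence the top of the support of \<open>\<mu>\<^sub>L\<close> is an atom at \<open>q (1 + s + \<dots> + s\<^bsup>L-1\<^esup>)\<close>,
  \<open>s = \<sigma>\<^sup>2 \<gamma>\<close>.
\<close>

unbundle no vec_syntax

subsection \<open>Sums over noncrossing partitions\<close>

text \<open>\<open>\<boxtimes>\<close> selects a measure by its moments, so a probability measure on
  the half-line with exactly these moments has to be exhibited, and positivity is invisible in the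
  noncrossing sums. Moreover, moments describe the Cauchy transform G near infinity, while an atom
  at the top m of the support is the limit of (z - m) G(z) as z decreases to m. Root distributions
  answer both needs: they are measures, and their support never leaves [0, m]. The price is that the
  class of measures must be closed under one layer, which is why \<open>root_approximable\<close> is
  carried along, starting from the polynomials (x - q)^d. The relation r G(z + r) = \<kappa> is a
  saddle point equation. Let c j be the Taylor coefficients at z of a polynomial p of degree d. The
  logarithmic derivative at z of the k-th derivative of p is (k + 1) / r with r = c k / c (k + 1).
  For this r the weights c j r^j concentrate near j = k, while their mean is r p'(z + r) / p(z + r),
  about d r G(z + r). The k added zeros stand for the kernel of the projection; they give the term
  \<kappa> / z.\<close>

definition NCP :: "nat set \<Rightarrow> nat set set set" where
  "NCP A = {P. partition_on A P \<and> noncrossing P}"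

text \<open>The block of the first point is kept apart from the others because its weight changes
  along the recursion: it has to remember the points already removed from it.\<close>

definition pointed_NCP :: "nat \<Rightarrow> nat \<Rightarrow> (nat set \<times> nat set set) set" where
  "pointed_NCP i j = {(B, Q). i \<in> B \<and> B \<notin> Q \<and> insert B Q \<in> NCP {i..<j}}"

definition nc_sum :: "(nat set \<Rightarrow> real) \<Rightarrow> nat \<Rightarrow> nat \<Rightarrow> real" where
  "nc_sum f i j = (\<Sum>P\<in>NCP {i..<j}. \<Prod>B\<in>P. f B)"

definition pointed_nc_sum :: "(nat set \<Rightarrow> real) \<Rightarrow> (nat set \<Rightarrow> real) \<Rightarrow> nat \<Rightarrow> nat \<Rightarrow> real" where
  "pointed_nc_sum g f i j = (\<Sum>(B, Q)\<in>pointed_NCP i j. g B * (\<Prod>C\<in>Q. f C))"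

lemma subset_intervals_empty:
  fixes i k j :: nat
  assumes "C \<subseteq> {Suc i..<k}" "C \<subseteq> {k..<j}"
  shows "C = {}"
proof -
  have "C \<subseteq> {Suc i..<k} \<inter> {k..<j}" using assms by blast
  also have "\<dots> = {}" by auto
  finally show ?thesis by simp
qed

lemma finite_NCP: "finite A \<Longrightarrow> finite (NCP A)"
  unfolding NCP_def by (rule finite_subset[OF _ finitely_many_partition_on[of A]]) auto

lemma NCP_subsetD: "P \<in> NCP A \<Longrightarrow> B \<in> P \<Longrightarrow> B \<subseteq> A"
  by (auto simp: NCP_def partition_on_def)

lemma finite_NCP_elem: "P \<in> NCP A \<Longrightarrow> finite A \<Longrightarrow> finite P"
  by (auto simp: NCP_def intro: finite_elements)

lemma noncrossingD:
  "noncrossing P \<Longrightarrow> B \<in> P \<Longrightarrow> C \<in> P \<Longrightarrow> B \<noteq> C \<Longrightarrow> a < b \<Longrightarrow> b < c \<Longrightarrow> c < d \<Longrightarrow>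
    a \<in> B \<Longrightarrow> c \<in> B \<Longrightarrow> b \<in> C \<Longrightarrow> d \<in> C \<Longrightarrow> False"
  unfolding noncrossing_def by blast

lemma noncrossing_subset: "noncrossing P \<Longrightarrow> Q \<subseteq> P \<Longrightarrow> noncrossing Q"
  unfolding noncrossing_def by blast

lemma pointed_NCP_subset: "pointed_NCP i j \<subseteq> Pow {i..<j} \<times> Pow (Pow {i..<j})"
  unfolding pointed_NCP_def using NCP_subsetD by blast

lemma finite_pointed_NCP: "finite (pointed_NCP i j)"
  by (rule finite_subset[OF pointed_NCP_subset]) auto

lemma NCP_empty: "NCP {} = {{}}"
  by (auto simp: NCP_def partition_on_empty noncrossing_def)

lemma nc_sum_empty [simp]: "j \<le> i \<Longrightarrow> nc_sum f i j = 1"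
  by (simp add: nc_sum_def NCP_empty)

lemma nc_sum_eq_pointed:
  assumes "i < j"
  shows "nc_sum f i j = pointed_nc_sum f f i j"
proof -
  have bij: "bij_betw (\<lambda>(B, Q). insert B Q) (pointed_NCP i j) (NCP {i..<j})"
    unfolding bij_betw_def
  proof
    show "inj_on (\<lambda>(B, Q). insert B Q) (pointed_NCP i j)"
    proof (rule inj_onI, clarify)
      fix B Q B' Q'
      assume 1: "(B, Q) \<in> pointed_NCP i j" "(B', Q') \<in> pointed_NCP i j" "insert B Q = insert B' Q'"
      have "disjoint (insert B Q)"
        using 1 by (auto simp: pointed_NCP_def NCP_def partition_on_def)
      moreover have "B \<in> insert B Q" "B' \<in> insert B Q" "i \<in> B" "i \<in> B'"
        using 1 by (auto simp: pointed_NCP_def)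
      ultimately have "B = B'" unfolding disjoint_def by blast
      with 1 show "B = B' \<and> Q = Q'" by (auto simp: pointed_NCP_def)
    qed
    show "(\<lambda>(B, Q). insert B Q) ` pointed_NCP i j = NCP {i..<j}"
    proof safe
      fix P assume P: "P \<in> NCP {i..<j}"
      have "i \<in> \<Union>P" using P assms by (auto simp: NCP_def partition_on_def)
      then obtain B where "B \<in> P" "i \<in> B" by auto
      with P have "(B, P - {B}) \<in> pointed_NCP i j" "P = insert B (P - {B})"
        by (auto simp: pointed_NCP_def insert_absorb)
      then show "P \<in> (\<lambda>(B, Q). insert B Q) ` pointed_NCP i j"
        by (intro image_eqI[where x = "(B, P - {B})"]) simp_all
    qed (auto simp: pointed_NCP_def)
  qed
  show ?thesis
    unfolding nc_sum_def pointed_nc_sum_def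
  proof (subst sum.reindex_bij_betw[OF bij, symmetric], rule sum.cong[OF refl], clarify)
    fix B Q assume BQ: "(B, Q) \<in> pointed_NCP i j"
    then have "finite (insert B Q)" "B \<notin> Q"
      by (auto simp: pointed_NCP_def dest: finite_NCP_elem)
    then show "prod f (insert B Q) = f B * prod f Q" by simp
  qed
qed

lemma pointed_NCP_singleton:
  assumes "i < j"
  shows "({i}, Q) \<in> pointed_NCP i j \<longleftrightarrow> Q \<in> NCP {Suc i..<j}"
proof
  assume Q: "({i}, Q) \<in> pointed_NCP i j"
  then have "partition_on {i..<j} (insert {i} Q)" "noncrossing (insert {i} Q)" "{i} \<notin> Q"
    by (auto simp: pointed_NCP_def NCP_def)
  moreover from this have "disjnt {i} (\<Union>Q)"
    by (auto simp: partition_on_def pairwise_insert)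
  moreover have "{i..<j} - {i} = {Suc i..<j}" by auto
  ultimately show "Q \<in> NCP {Suc i..<j}"
    using partition_on_insert[of "{i}" Q "{i..<j}"] noncrossing_subset[of "insert {i} Q" Q]
    by (auto simp: NCP_def)
next
  assume Q: "Q \<in> NCP {Suc i..<j}"
  then have sub: "\<And>B. B \<in> Q \<Longrightarrow> B \<subseteq> {Suc i..<j}" by (rule NCP_subsetD)
  then have ni: "\<And>B. B \<in> Q \<Longrightarrow> i \<notin> B" by fastforce
  have "disjnt {i} (\<Union>Q)" using ni by (auto simp: disjnt_def)
  moreover have "{i..<j} - {i} = {Suc i..<j}" by auto
  ultimately have "partition_on {i..<j} (insert {i} Q)"
    using partition_on_insert[of "{i}" Q "{i..<j}"] Q assms by (auto simp: NCP_def)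
  moreover have "noncrossing (insert {i} Q)"
    using Q sub ni unfolding NCP_def noncrossing_def
    by (smt (verit) Suc_le_eq atLeastLessThan_iff insertE mem_Collect_eq order.strict_trans not_less_iff_gr_or_eq singletonD subsetD)
  ultimately show "({i}, Q) \<in> pointed_NCP i j"
    using ni by (auto simp: pointed_NCP_def NCP_def)
qed

text \<open>\<open>R\<close> lies in the gap between the consecutive elements \<open>i\<close> and
  \<open>k\<close> of the enlarged block, so its blocks cross nothing outside the gap. A crossing of
  the enlarged block with a block of \<open>Q\<close> that has \<open>i\<close> as its leftmost
  point remains a crossing when \<open>i\<close> is replaced by \<open>k\<close>, and this is
  excluded in \<open>insert B Q\<close>.\<close>

lemma pointed_NCP_glue:
  assumes ik: "i < k" and kj: "k < j" and R: "R \<in> NCP {Suc i..<k}" and BQ: "(B, Q) \<in> pointed_NCP k j"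
  shows "(insert i B, R \<union> Q) \<in> pointed_NCP i j"
proof -
  have Rs: "\<And>C. C \<in> R \<Longrightarrow> C \<subseteq> {Suc i..<k}" using R by (rule NCP_subsetD)
  have Qs: "\<And>C. C \<in> insert B Q \<Longrightarrow> C \<subseteq> {k..<j}" using BQ by (auto simp: pointed_NCP_def dest: NCP_subsetD)
  have pR: "partition_on {Suc i..<k} R" and nR: "noncrossing R" using R by (auto simp: NCP_def)
  have pQ: "partition_on {k..<j} (insert B Q)" and nQ: "noncrossing (insert B Q)" "k \<in> B" "B \<notin> Q"
    using BQ by (auto simp: pointed_NCP_def NCP_def)
  have UR: "\<Union>R = {Suc i..<k}" using pR by (auto simp: partition_on_def)
  have UQ: "B \<union> \<Union>Q = {k..<j}" using pQ by (auto simp: partition_on_def)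
  have BQd: "disjnt B (\<Union>Q)" "disjoint Q" using pQ nQ by (auto simp: partition_on_def pairwise_insert)
  have ni: "insert i B \<notin> R \<union> Q" using Rs Qs ik by fastforce
  have part: "partition_on {i..<j} (insert (insert i B) (R \<union> Q))"
  proof -
    have "partition_on ({Suc i..<k} \<union> \<Union>Q) (R \<union> Q)"
    proof (unfold partition_on_def, intro conjI)
      show "\<Union>(R \<union> Q) = {Suc i..<k} \<union> \<Union>Q" using UR by auto
      show "disjoint (R \<union> Q)"
      proof -
        have "disjnt C D" if "C \<in> R" "D \<in> Q" for C D
          using Rs[OF that(1)] Qs[of D] that by (fastforce simp: disjnt_def)
        then show ?thesis using BQd(2) pR unfolding partition_on_def pairwise_def
          by (metis Un_iff disjnt_sym)
      qed
      show "{} \<notin> R \<union> Q" using pR pQ by (auto simp: partition_on_def)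
    qed
    moreover have "{Suc i..<k} \<union> \<Union>Q = {i..<j} - insert i B"
    proof -
      have "{i..<j} = insert i ({Suc i..<k} \<union> (B \<union> \<Union>Q))" unfolding UQ using ik kj by auto
      moreover have "i \<notin> B \<union> \<Union>Q" unfolding UQ using ik by auto
      moreover have "B \<inter> {Suc i..<k} = {}" using Qs[of B] by auto
      ultimately show ?thesis using BQd(1) unfolding disjnt_def by auto
    qed
    moreover have "disjnt (insert i B) (\<Union>(R \<union> Q))"
      using calculation by (auto simp: partition_on_def disjnt_def)
    moreover have "insert i B \<subseteq> {i..<j}" using Qs[of B] ik kj by fastforce
    ultimately show ?thesis by (subst partition_on_insert) auto
  qed
  have "noncrossing (insert (insert i B) (R \<union> Q))"
    unfolding noncrossing_def
  proof (intro ballI allI impI, elim conjE)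
    fix B1 B2 a b c d
    assume B1: "B1 \<in> insert (insert i B) (R \<union> Q)" and B2: "B2 \<in> insert (insert i B) (R \<union> Q)"
      and ne: "B1 \<noteq> B2" and ord: "a < b" "b < c" "c < d"
      and mem: "a \<in> B1" "c \<in> B1" "b \<in> B2" "d \<in> B2"
    have iR: "i < x \<and> x < k" if "x \<in> C" "C \<in> R" for x C using Rs that by fastforce
    have iQ: "k \<le> x" if "x \<in> C" "C \<in> insert B Q" for x C using Qs that by fastforce
    have nBQ: "x \<notin> B" if "x \<in> C" "C \<in> Q" for x C using BQd(1) that by (auto simp: disjnt_def)
    consider "B1 \<in> R" | "B1 \<in> Q" | "B1 = insert i B" using B1 by auto
    then show False
    proof cases
      case 1
      have "a > i" "c < k" using iR 1 mem by auto
      then have "i < b" "b < k" using ord by auto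
      then have "B2 \<notin> Q" "B2 \<noteq> insert i B" using iQ mem by fastforce+
      then have "B2 \<in> R" using B2 by auto
      then show False using noncrossingD[OF nR 1 _ ne ord] mem by blast
    next
      case 2
      have "k \<le> a" using iQ 2 mem by auto
      then have "k < b" "k < d" using ord by auto
      have "B2 \<notin> R" using iR mem \<open>k < b\<close> by fastforce
      then show False
      proof (cases "B2 \<in> Q")
        case True
        then show False using noncrossingD[OF nQ(1) _ _ ne ord] mem 2 by blast
      next
        case False
        then have "B2 = insert i B" using B2 \<open>B2 \<notin> R\<close> by auto
        then have "b \<in> B" "d \<in> B" using mem \<open>k < b\<close> \<open>k < d\<close> ik by auto
        moreover have "B1 \<noteq> B" using 2 nQ by auto
        ultimately show False using noncrossingD[OF nQ(1) _ _ _ ord] mem 2 by blast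
      qed
    next
      case 3
      then have B2': "B2 \<in> R \<union> Q" using B2 ne by auto
      then have "i < b" using mem iR iQ[of b B2] ik by fastforce
      then have c: "c \<in> B" using ord mem 3 by auto
      then have "k < d" using iQ ord by fastforce
      then have Q2: "B2 \<in> Q" using B2' iR[of d B2] mem by auto
      show False
      proof (cases "a \<in> B")
        case True
        moreover have "B \<noteq> B2" using Q2 nQ by auto
        ultimately show False using noncrossingD[OF nQ(1) _ _ _ ord] mem Q2 c by blast
      next
        case False
        have "k \<le> b" "b \<noteq> k" using iQ[of b B2] mem Q2 nBQ[of b B2] nQ by auto
        then have "k < b" by simp
        moreover have "B \<noteq> B2" using Q2 nQ by auto
        ultimately show False using noncrossingD[OF nQ(1) _ _ _ _ ord(2,3), of B B2 k] mem Q2 c nQ by blast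
      qed
    qed
  qed
  with part ni show ?thesis by (auto simp: pointed_NCP_def NCP_def)
qed

text \<open>Since \<open>i\<close> and \<open>k\<close> are consecutive in \<open>B\<close>, every
  other block avoids both. If it had points on either side of \<open>k\<close>, it would cross
  \<open>B\<close>; hence it lies entirely in the gap or entirely to the right of
  \<open>k\<close>.\<close>

lemma pointed_NCP_split:
  assumes BP: "(B, P) \<in> pointed_NCP i j" and B: "B \<noteq> {i}"
  defines "k \<equiv> Min (B - {i})"
  defines "R \<equiv> {C \<in> P. C \<subseteq> {Suc i..<k}}" and "Q \<equiv> {C \<in> P. C \<subseteq> {k..<j}}"
  shows "i < k" "k < j" "k \<in> B" "P = R \<union> Q" "R \<in> NCP {Suc i..<k}" "(B - {i}, Q) \<in> pointed_NCP k j"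
proof -
  have iB: "i \<in> B" and BnP: "B \<notin> P" and pP: "partition_on {i..<j} (insert B P)"
    and nP: "noncrossing (insert B P)" using BP by (auto simp: pointed_NCP_def NCP_def)
  have Ps: "\<And>C. C \<in> insert B P \<Longrightarrow> C \<subseteq> {i..<j}" using pP by (auto simp: partition_on_def)
  have fin: "finite (B - {i})" using Ps[of B] by (meson finite_Diff finite_atLeastLessThan finite_subset insertI1)
  have ne: "B - {i} \<noteq> {}" using B iB by auto
  have kB: "k \<in> B - {i}" unfolding k_def by (rule Min_in[OF fin ne])
  have kmin: "k \<le> x" if "x \<in> B" "x \<noteq> i" for x unfolding k_def using Min_le[OF fin] that by auto
  show ik: "i < k" and kj: "k < j" and "k \<in> B" using kB Ps[of B] by fastforce+
  have dis: "disjnt B (\<Union>P)" "disjoint P" using pP BnP by (auto simp: partition_on_def pairwise_insert)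
  have nB: "x \<notin> B" if "x \<in> C" "C \<in> P" for x C using dis that by (auto simp: disjnt_def)
  have UP: "B \<union> \<Union>P = {i..<j}" using pP by (auto simp: partition_on_def)
  show PRQ: "P = R \<union> Q"
  proof -
    have "C \<in> R \<union> Q" if C: "C \<in> P" for C
    proof (rule ccontr)
      assume "C \<notin> R \<union> Q"
      then obtain x y where xy: "x \<in> C" "x \<notin> {k..<j}" "y \<in> C" "y \<notin> {Suc i..<k}"
        using C unfolding R_def Q_def by blast
      have "x \<noteq> i" "y \<noteq> i" "y \<noteq> k" using nB xy C iB kB by auto
      moreover have "x \<in> {i..<j}" "y \<in> {i..<j}" using Ps[of C] C xy by blast+
      ultimately have "i < x" "x < k" "k < y" using xy by auto
      then show False using noncrossingD[OF nP, of B C i x k y] C BnP iB kB xy by auto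
    qed
    then show ?thesis unfolding R_def Q_def by auto
  qed
  have emp: "{} \<notin> P" using pP by (auto simp: partition_on_def)
  have URQ: "\<Union>P = \<Union>R \<union> \<Union>Q" using PRQ by auto
  have UR: "\<Union>R = {Suc i..<k}"
  proof
    show "{Suc i..<k} \<subseteq> \<Union>R"
    proof
      fix x assume x: "x \<in> {Suc i..<k}"
      then have "x \<in> {i..<j}" "x \<notin> B" using kj kmin[of x] by auto
      then have "x \<in> \<Union>P" using UP by auto
      then have "x \<in> \<Union>R \<union> \<Union>Q" using URQ by simp
      moreover have "x \<notin> \<Union>Q" using x unfolding Q_def by auto
      ultimately show "x \<in> \<Union>R" by simp
    qed
  qed (auto simp: R_def)
  then have "partition_on {Suc i..<k} R"
    using dis emp unfolding partition_on_def R_def by (auto intro: pairwise_subset)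
  moreover have "noncrossing R" using nP by (rule noncrossing_subset) (auto simp: R_def)
  ultimately show "R \<in> NCP {Suc i..<k}" by (simp add: NCP_def)
  have BQ: "B - {i} \<notin> Q"
  proof
    assume "B - {i} \<in> Q"
    then have "B - {i} \<in> P" by (simp add: Q_def)
    then show False using nB[of k "B - {i}"] kB by auto
  qed
  have UQ: "B - {i} \<union> \<Union>Q = {k..<j}"
  proof
    show "{k..<j} \<subseteq> B - {i} \<union> \<Union>Q"
    proof
      fix x assume x: "x \<in> {k..<j}"
      then have "x \<in> B \<union> \<Union>P" using UP ik by auto
      then have "x \<in> B \<union> (\<Union>R \<union> \<Union>Q)" using URQ by simp
      moreover have "x \<notin> \<Union>R" using x unfolding R_def by auto
      ultimately show "x \<in> B - {i} \<union> \<Union>Q" using x ik by auto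
    qed
    have "B - {i} \<subseteq> {k..<j}"
    proof
      fix x assume "x \<in> B - {i}"
      then show "x \<in> {k..<j}" using kmin[of x] Ps[of B] by auto
    qed
    then show "B - {i} \<union> \<Union>Q \<subseteq> {k..<j}" by (auto simp: Q_def)
  qed
  have "disjoint (insert (B - {i}) Q)"
    unfolding pairwise_insert
  proof (intro conjI)
    show "disjoint Q" using dis(2) unfolding Q_def by (auto intro: pairwise_subset)
    show "\<forall>y. y \<in> Q \<and> y \<noteq> B - {i} \<longrightarrow> disjnt (B - {i}) y \<and> disjnt y (B - {i})"
      using dis(1) unfolding Q_def disjnt_def by auto
  qed
  then have part: "partition_on {k..<j} (insert (B - {i}) Q)"
    unfolding partition_on_def using UQ emp kB unfolding Q_def by auto
  have "noncrossing (insert (B - {i}) Q)"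
    unfolding noncrossing_def
  proof (intro ballI allI impI, elim conjE)
    fix B1 B2 a b c d
    assume *: "B1 \<in> insert (B - {i}) Q" "B2 \<in> insert (B - {i}) Q" "B1 \<noteq> B2" "a < b" "b < c" "c < d"
       "a \<in> B1" "c \<in> B1" "b \<in> B2" "d \<in> B2"
    \<comment> \<open>\<open>h\<close> puts \<open>i\<close> back into the shortened block, so that
      a crossing after the removal of \<open>i\<close> lifts to one in the original
      partition.\<close>
    define h where "h X = (if X = B - {i} then B else X)" for X
    have "h B1 \<in> insert B P" "h B2 \<in> insert B P" "B1 \<subseteq> h B1" "B2 \<subseteq> h B2" 
      using * unfolding h_def Q_def by auto
    moreover have "h B1 \<noteq> h B2"
      using * BnP unfolding h_def Q_def by auto
    ultimately show False using noncrossingD[OF nP, of "h B1" "h B2" a b c d] *(4-10) by (meson subsetD)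
  qed
  then show "(B - {i}, Q) \<in> pointed_NCP k j"
    using part BQ kB by (auto simp: pointed_NCP_def NCP_def)
qed

text \<open>Expand along the second smallest element \<open>k\<close> of the block containing \<open>i\<close>, if there is one:
  the points strictly between \<open>i\<close> and \<open>k\<close> are partitioned among themselves.\<close>
lemma pointed_nc_sum_rec:
  assumes "i < j"
  shows "pointed_nc_sum g f i j = g {i} * nc_sum f (Suc i) j +
     (\<Sum>k\<in>{i<..<j}. nc_sum f (Suc i) k * pointed_nc_sum (\<lambda>B. g (insert i B)) f k j)"
proof -
  let ?F = "\<lambda>(B, Q). g B * (\<Prod>C\<in>Q. f C)"
  let ?A = "{p \<in> pointed_NCP i j. fst p = {i}}"
  let ?B = "{p \<in> pointed_NCP i j. fst p \<noteq> {i}}"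
  have "pointed_nc_sum g f i j = sum ?F ?A + sum ?F ?B"
  proof -
    have "pointed_NCP i j = ?A \<union> ?B" by auto
    then show ?thesis unfolding pointed_nc_sum_def
      using sum.union_disjoint[of ?A ?B ?F] finite_pointed_NCP[of i j] by auto
  qed
  also have "sum ?F ?A = (\<Sum>Q\<in>NCP {Suc i..<j}. g {i} * (\<Prod>C\<in>Q. f C))"
  proof (rule sum.reindex_bij_witness[where i = "\<lambda>Q. ({i}, Q)" and j = snd])
    fix a assume "a \<in> ?A"
    then have a: "a = ({i}, snd a)" "a \<in> pointed_NCP i j" by (auto simp: prod_eq_iff)
    then show "({i}, snd a) = a" by simp
    show "snd a \<in> NCP {Suc i..<j}" using a by (metis pointed_NCP_singleton[OF assms])
    show "g {i} * prod f (snd a) = (case a of (B, Q) \<Rightarrow> g B * prod f Q)" by (subst (2) a(1)) simp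
  qed (use pointed_NCP_singleton[OF assms] in simp_all)
  also have "\<dots> = g {i} * nc_sum f (Suc i) j"
    by (simp add: nc_sum_def sum_distrib_left)
  also have "sum ?F ?B = (\<Sum>(k, R, B, Q)\<in>(SIGMA k:{i<..<j}. NCP {Suc i..<k} \<times> pointed_NCP k j).
      (\<Prod>C\<in>R. f C) * (g (insert i B) * (\<Prod>C\<in>Q. f C)))"
  proof (rule sum.reindex_bij_witness[where
        i = "\<lambda>(k, R, B, Q). (insert i B, R \<union> Q)" and
        j = "\<lambda>(B, P). let k = Min (B - {i}) in
           (k, {C \<in> P. C \<subseteq> {Suc i..<k}}, B - {i}, {C \<in> P. C \<subseteq> {k..<j}})"], goal_cases)
    case (1 a)
    then show ?case using pointed_NCP_split(4)[of "fst a" "snd a" i j]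
      by (auto simp: Let_def split_beta pointed_NCP_def prod_eq_iff)
  next
    case (2 a)
    then show ?case using pointed_NCP_split(1,2,5,6)[of "fst a" "snd a" i j]
      by (auto simp: Let_def split_beta)
  next
    case (3 b)
    obtain k R B Q where b: "b = (k, R, B, Q)" by (cases b)
    with 3 have *: "i < k" "k < j" "R \<in> NCP {Suc i..<k}" "(B, Q) \<in> pointed_NCP k j" by auto
    have Rs: "\<And>C. C \<in> R \<Longrightarrow> C \<subseteq> {Suc i..<k} \<and> C \<noteq> {}" using *(3) by (auto simp: NCP_def partition_on_def)
    have Qs: "\<And>C. C \<in> insert B Q \<Longrightarrow> C \<subseteq> {k..<j} \<and> C \<noteq> {}" using *(4) 
      unfolding pointed_NCP_def NCP_def partition_on_def by blast
    have kB: "k \<in> B" using * by (auto simp: pointed_NCP_def)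
    have Bs: "B \<subseteq> {k..<j}" using Qs by blast
    have "i \<notin> B" using Bs *(1) by auto
    then have B: "insert i B - {i} = B" by auto
    have "finite B" using Bs finite_subset by blast
    then have k: "Min B = k" using kB Bs by (intro Min_eqI) auto
    have R': "C \<subseteq> {Suc i..<k} \<and> \<not> C \<subseteq> {k..<j}" if "C \<in> R" for C
      using Rs[OF that] subset_intervals_empty[of C i k j] by metis
    have Q': "C \<subseteq> {k..<j} \<and> \<not> C \<subseteq> {Suc i..<k}" if "C \<in> Q" for C
      using Qs[of C] that subset_intervals_empty[of C i k j] by (metis insertCI)
    have "{C \<in> R \<union> Q. C \<subseteq> {Suc i..<k}} = R" "{C \<in> R \<union> Q. C \<subseteq> {k..<j}} = Q"
      using R' Q' by auto
    then show ?case by (simp add: b B k)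
  next
    case (4 b)
    obtain k R B Q where b: "b = (k, R, B, Q)" by (cases b)
    with 4 have *: "i < k" "k < j" "R \<in> NCP {Suc i..<k}" "(B, Q) \<in> pointed_NCP k j" by auto
    have "k \<in> B" using * by (auto simp: pointed_NCP_def)
    then show ?case using pointed_NCP_glue[OF *] *(1) by (auto simp: b)
  next
    case (5 a)
    obtain B P where a: "a = (B, P)" by (cases a)
    with 5 have BP: "(B, P) \<in> pointed_NCP i j" "B \<noteq> {i}" by auto
    note s = pointed_NCP_split[OF this]
    define k where "k = Min (B - {i})"
    define R where "R = {C \<in> P. C \<subseteq> {Suc i..<k}}"
    define Q where "Q = {C \<in> P. C \<subseteq> {k..<j}}"
    have P: "P = R \<union> Q" using s(4) unfolding R_def Q_def k_def .
    have "insert B P \<in> NCP {i..<j}" using BP by (auto simp: pointed_NCP_def)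
    then have "finite P" "{} \<notin> P"
      using finite_NCP_elem[of "insert B P" "{i..<j}"] by (simp, simp add: NCP_def partition_on_def)
    moreover have "R \<inter> Q = {}"
    proof (rule equals0I)
      fix C assume "C \<in> R \<inter> Q"
      then have C: "C \<in> P" "C \<subseteq> {Suc i..<k}" "C \<subseteq> {k..<j}" unfolding R_def Q_def by simp_all
      show False using subset_intervals_empty[OF C(2,3)] C(1) \<open>{} \<notin> P\<close> by simp
    qed
    ultimately have "prod f P = prod f R * prod f Q"
      unfolding P by (subst prod.union_disjoint) (auto)
    moreover have "insert i (B - {i}) = B" using BP by (auto simp: pointed_NCP_def)
    ultimately show ?case by (simp add: a Let_def R_def Q_def k_def)
  qed
  also have "\<dots> = (\<Sum>k\<in>{i<..<j}. nc_sum f (Suc i) k * pointed_nc_sum (\<lambda>B. g (insert i B)) f k j)"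
    by (subst sum.Sigma[symmetric])
       (auto simp: finite_NCP finite_pointed_NCP nc_sum_def pointed_nc_sum_def sum_product
          sum.cartesian_product split_beta)
  finally show ?thesis .
qed

lemma pointed_nc_sum_cong:
  assumes "\<And>B. i \<in> B \<Longrightarrow> B \<subseteq> {i..<j} \<Longrightarrow> g B = g' B"
  shows "pointed_nc_sum g f i j = pointed_nc_sum g' f i j"
  unfolding pointed_nc_sum_def
proof (rule sum.cong[OF refl], clarify)
  fix B Q assume "(B, Q) \<in> pointed_NCP i j"
  then have "i \<in> B" "B \<subseteq> {i..<j}" using pointed_NCP_subset[of i j] by (auto simp: pointed_NCP_def)
  then show "g B * prod f Q = g' B * prod f Q" using assms by simp
qed

text \<open>The vanishing of mixed free cumulants, written as a weight. On a nonempty block at most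
  one of the weights for \<open>True\<close> and \<open>False\<close> is nonzero, so their sum is
  the cumulant of the common colour, or 0 for a mixed block. The colour restriction thereby
  disappears from the index set of the sums.\<close>

definition colored_weight :: "(nat \<Rightarrow> bool) \<Rightarrow> (bool \<Rightarrow> nat \<Rightarrow> real) \<Rightarrow> bool \<Rightarrow> nat \<Rightarrow> nat set \<Rightarrow> real" where
  "colored_weight c \<kappa> b r B = (if \<forall>x\<in>B. c x = b then \<kappa> b (card B + r) else 0)"

definition colored_sum :: "(nat \<Rightarrow> bool) \<Rightarrow> (bool \<Rightarrow> nat \<Rightarrow> real) \<Rightarrow> nat \<Rightarrow> nat \<Rightarrow> real" where
  "colored_sum c \<kappa> = nc_sum (\<lambda>B. colored_weight c \<kappa> True 0 B + colored_weight c \<kappa> False 0 B)"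

text \<open>The parameter \<open>r\<close> counts the points of the first block that have already been removed.\<close>
definition pointed_colored_sum ::
    "(nat \<Rightarrow> bool) \<Rightarrow> (bool \<Rightarrow> nat \<Rightarrow> real) \<Rightarrow> bool \<Rightarrow> nat \<Rightarrow> nat \<Rightarrow> nat \<Rightarrow> real" where
  "pointed_colored_sum c \<kappa> b r =
     pointed_nc_sum (colored_weight c \<kappa> b r) (\<lambda>B. colored_weight c \<kappa> True 0 B + colored_weight c \<kappa> False 0 B)"

lemma colored_sum_empty [simp]: "j \<le> i \<Longrightarrow> colored_sum c \<kappa> i j = 1"
  by (simp add: colored_sum_def)

lemma colored_sum_eq_pointed:
  assumes "i < j"
  shows "colored_sum c \<kappa> i j = pointed_colored_sum c \<kappa> (c i) 0 i j"
  unfolding colored_sum_def pointed_colored_sum_def nc_sum_eq_pointed[OF assms]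
  by (rule pointed_nc_sum_cong) (cases "c i"; auto simp: colored_weight_def)

lemma pointed_colored_sum_eq_0:
  assumes "c i \<noteq> b"
  shows "pointed_colored_sum c \<kappa> b r i j = 0"
proof -
  have "pointed_colored_sum c \<kappa> b r i j = pointed_nc_sum (\<lambda>_. 0)
     (\<lambda>B. colored_weight c \<kappa> True 0 B + colored_weight c \<kappa> False 0 B) i j"
    unfolding pointed_colored_sum_def
    by (rule pointed_nc_sum_cong) (use assms in \<open>auto simp: colored_weight_def\<close>)
  then show ?thesis by (simp add: pointed_nc_sum_def)
qed

lemma pointed_colored_sum_rec:
  assumes "i < j" "c i = b"
  shows "pointed_colored_sum c \<kappa> b r i j = \<kappa> b (Suc r) * colored_sum c \<kappa> (Suc i) j +
     (\<Sum>k\<in>{i<..<j}. colored_sum c \<kappa> (Suc i) k * pointed_colored_sum c \<kappa> b (Suc r) k j)"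
proof -
  have "pointed_nc_sum (\<lambda>B. colored_weight c \<kappa> b r (insert i B)) f k j =
        pointed_nc_sum (colored_weight c \<kappa> b (Suc r)) f k j" if "i < k" for k f
  proof (rule pointed_nc_sum_cong)
    fix B assume B: "k \<in> B" "B \<subseteq> {k..<j}"
    then have "finite B" "i \<notin> B" using that finite_subset by auto
    then show "colored_weight c \<kappa> b r (insert i B) = colored_weight c \<kappa> b (Suc r) B"
      using assms by (simp add: colored_weight_def)
  qed
  moreover have "colored_weight c \<kappa> b r {i} = \<kappa> b (Suc r)"
    using assms by (simp add: colored_weight_def)
  ultimately show ?thesis
    unfolding pointed_colored_sum_def colored_sum_def by (subst pointed_nc_sum_rec[OF assms(1)]) simp
qed

text \<open>Only the colour word read along the interval matters. Induction through the recursion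
  shows this without transporting partitions along a translation; the two claims are proved together
  because each recursion calls the other sum.\<close>

lemma colored_sum_shift:
  assumes "\<And>x. x < n \<Longrightarrow> c (i + x) = c' (i' + x)"
  shows "colored_sum c \<kappa> i (i + n) = colored_sum c' \<kappa> i' (i' + n) \<and>
     (\<forall>b r. n > 0 \<longrightarrow> pointed_colored_sum c \<kappa> b r i (i + n) = pointed_colored_sum c' \<kappa> b r i' (i' + n))"
  using assms
proof (induction n arbitrary: i i' rule: less_induct)
  case (less n)
  show ?case
  proof (cases "n = 0")
    case False
    then obtain N where n: "n = Suc N" by (cases n) auto
    have c: "c i = c' i'" using less.prems[of 0] n by simp
    have *: "pointed_colored_sum c \<kappa> b r i (i + n) = pointed_colored_sum c' \<kappa> b r i' (i' + n)" for b r
    proof (cases "c i = b")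
      case False
      then show ?thesis using c by (simp add: pointed_colored_sum_eq_0)
    next
      case True
      have sum_shift: "(\<Sum>k\<in>{i<..<i + n}. h k) = (\<Sum>l<N. h (Suc i + l))" for i and h :: "nat \<Rightarrow> real"
        by (rule sum.reindex_bij_witness[where i = "\<lambda>l. Suc i + l" and j = "\<lambda>k. k - Suc i"]) (auto simp: n)
      have 1: "colored_sum c \<kappa> (Suc i) (Suc i + l) = colored_sum c' \<kappa> (Suc i') (Suc i' + l)" if "l \<le> N" for l
        using less.IH[of l "Suc i" "Suc i'"] less.prems[of "Suc _"] that n by auto
      have 2: "pointed_colored_sum c \<kappa> b (Suc r) (Suc i + l) (i + n) =
               pointed_colored_sum c' \<kappa> b (Suc r) (Suc i' + l) (i' + n)" if "l < N" for l
      proof -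
        have "\<And>x. x < N - l \<Longrightarrow> c (Suc i + l + x) = c' (Suc i' + l + x)"
          using less.prems[of "Suc l + _"] that n by (simp add: add.assoc)
        from less.IH[of "N - l" "Suc i + l" "Suc i' + l", OF _ this] that n show ?thesis by simp
      qed
      have 3: "pointed_colored_sum c \<kappa> b r i (i + n) = \<kappa> b (Suc r) * colored_sum c \<kappa> (Suc i) (Suc i + N) +
        (\<Sum>l<N. colored_sum c \<kappa> (Suc i) (Suc i + l) * pointed_colored_sum c \<kappa> b (Suc r) (Suc i + l) (i + n))"
        if "c i = b" for c i
      proof -
        have "i + n = Suc i + N" by (simp add: n)
        then show ?thesis
          using pointed_colored_sum_rec[of i "i + n" c b \<kappa> r] that
          unfolding sum_shift[of _ i] by simp
      qed
      have "c' i' = b" using True c by simp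
      then show ?thesis
        unfolding 3[of c i, OF True] 3[of c' i', OF \<open>c' i' = b\<close>] 1[OF order_refl]
        by (intro arg_cong2[where f = "(+)"] refl sum.cong) (simp_all only: 1 2 lessThan_iff less_imp_le)
    qed
    then show ?thesis using n c
      by (simp add: colored_sum_eq_pointed del: add_Suc_right)
  qed simp
qed

section \<open>Solving the recursions by formal power series\<close>

lemma fps_nth_power_mult_eq_0:
  fixes H U :: "'a::field fps"
  assumes "H $ 0 = 0" "n < N"
  shows "(H ^ N * U) $ n = 0"
proof -
  have "(\<Sum>i = 0..n. (H ^ N) $ i * U $ (n - i)) = 0"
    using assms by (intro sum.neutral) (auto simp: startsby_zero_power_prefix)
  then show ?thesis by (simp add: fps_mult_nth)
qed

text \<open>Unrolling N times leaves the remainder \<open>H ^ N * U N\<close>, which has order at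
  least N, so the n-th coefficient is settled for N = n + 1. This eliminates the counter
  \<open>r\<close> of the pointed sums: the successive cumulants become the coefficients of a series
  evaluated at \<open>H\<close>.\<close>

lemma fps_solve_recursion:
  fixes U :: "nat \<Rightarrow> 'a::field fps"
  assumes rec: "\<And>r. U r = fps_const (a r) * E + H * U (Suc r)" and H: "H $ 0 = 0"
  shows "U 0 = E * (Abs_fps a oo H)"
proof (rule fps_ext)
  fix n
  have U: "U 0 = E * (\<Sum>r<N. fps_const (a r) * H ^ r) + H ^ N * U N" for N
  proof (induction N)
    case (Suc N)
    then show ?case by (simp add: rec[of N] algebra_simps)
  qed simp
  have "(Abs_fps a oo H) $ m = (\<Sum>r<Suc n. fps_const (a r) * H ^ r) $ m" if "m \<le> n" for m
  proof -
    have "(\<Sum>r<Suc n. fps_const (a r) * H ^ r) $ m = (\<Sum>r<Suc n. a r * (H ^ r) $ m)"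
      by (simp add: fps_sum_nth)
    also have "\<dots> = (\<Sum>r=0..m. a r * (H ^ r) $ m)"
      using that H by (intro sum.mono_neutral_right) (auto simp: startsby_zero_power_prefix)
    finally show ?thesis by (simp add: fps_compose_nth)
  qed
  then have "(E * (Abs_fps a oo H)) $ n = (E * (\<Sum>r<Suc n. fps_const (a r) * H ^ r)) $ n"
    unfolding fps_mult_nth by (intro sum.cong) auto
  also have "\<dots> = U 0 $ n"
    by (subst U[of "Suc n"]) (simp only: fps_add_nth fps_nth_power_mult_eq_0[OF H lessI] add_0_right)
  finally show "U 0 $ n = (E * (Abs_fps a oo H)) $ n" by simp
qed

lemma fps_compose_shift:
  fixes \<kappa> :: "nat \<Rightarrow> 'a::field"
  assumes "\<kappa> 0 = 0" "H $ 0 = 0"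
  shows "H * (Abs_fps (\<lambda>r. \<kappa> (Suc r)) oo H) = Abs_fps \<kappa> oo H"
proof -
  have "Abs_fps \<kappa> = fps_X * Abs_fps (\<lambda>r. \<kappa> (Suc r))"
    using assms by (intro fps_ext) (simp add: gr0_conv_Suc)
  then show ?thesis using assms by (simp add: fps_compose_mult_distrib)
qed

lemma NC_eq_NCP: "NC n = NCP {0..<n}"
  by (simp add: NC_def NCP_def)

text \<open>Speicher's functional equation M(z) = 1 + C(z M(z)). Every point of the first block
  contributes a factor z, and the points following it, up to the next point of the block or the end,
  are partitioned freely and contribute a factor M(z).\<close>

lemma free_cumulants_fps:
  assumes m: "is_free_cumulants m \<kappa>" "m 0 = 1"
  shows "Abs_fps m = 1 + (Abs_fps \<kappa> oo (fps_X * Abs_fps m))"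
proof -
  define c where "c = (\<lambda>_::nat. True)"
  define k where "k = (\<lambda>b::bool. \<kappa>)"
  have w: "colored_sum c k 0 n = m n" for n
  proof (cases "n = 0")
    case False
    have "colored_sum c k 0 n = (\<Sum>P\<in>NC n. \<Prod>B\<in>P. \<kappa> (card B))"
      unfolding colored_sum_def nc_sum_def NC_eq_NCP
    proof (intro sum.cong prod.cong refl)
      fix P B assume "P \<in> NCP {0..<n}" "B \<in> P"
      then have "B \<noteq> {}" by (auto simp: NCP_def partition_on_def)
      then show "colored_weight c k True 0 B + colored_weight c k False 0 B = \<kappa> (card B)"
        by (auto simp: colored_weight_def c_def k_def)
    qed
    then show ?thesis using m False by (simp add: is_free_cumulants_def)
  qed (simp add: m)
  define U where "U r = Abs_fps (\<lambda>n. if n = 0 then 0 else pointed_colored_sum c k True r 0 n)" for r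
  have rec: "U r = fps_const (\<kappa> (Suc r)) * (fps_X * Abs_fps m) + fps_X * Abs_fps m * U (Suc r)" for r
  proof (rule fps_ext)
    fix n
    show "U r $ n = (fps_const (\<kappa> (Suc r)) * (fps_X * Abs_fps m) + fps_X * Abs_fps m * U (Suc r)) $ n"
    proof (cases n)
      case (Suc N)
      have s: "colored_sum c k (Suc 0) (Suc l) = m l" for l
        using colored_sum_shift[of l c "Suc 0" c 0 k] by (simp add: c_def w[unfolded c_def])
      have t: "pointed_colored_sum c k True r' (Suc l) (Suc N) = U r' $ (N - l)" if "l < N" for l r'
        using colored_sum_shift[of "N - l" c "Suc l" c 0 k] that by (simp add: U_def c_def)
      have "U r $ n = \<kappa> (Suc r) * m N + (\<Sum>j\<in>{0<..<Suc N}. colored_sum c k (Suc 0) j * pointed_colored_sum c k True (Suc r) j (Suc N))"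
        unfolding U_def Suc by (simp add: pointed_colored_sum_rec c_def k_def s[unfolded c_def k_def])
      also have "(\<Sum>j\<in>{0<..<Suc N}. colored_sum c k (Suc 0) j * pointed_colored_sum c k True (Suc r) j (Suc N)) =
         (\<Sum>l<N. m l * U (Suc r) $ (N - l))"
        by (rule sum.reindex_bij_witness[where i = Suc and j = "\<lambda>l. l - 1"]) (auto simp: s t gr0_conv_Suc)
      also have "\<dots> = (\<Sum>l=0..N. m l * U (Suc r) $ (N - l))"
        by (rule sum.mono_neutral_left) (auto simp: U_def)
      finally show ?thesis
        by (simp only: Suc fps_add_nth fps_mult_left_const_nth mult.assoc fps_X_mult_nth)
           (simp add: fps_mult_nth)
    qed (simp add: U_def)
  qed
  have k0: "\<kappa> 0 = 0" using m by (simp add: is_free_cumulants_def)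
  have "U 0 = Abs_fps \<kappa> oo (fps_X * Abs_fps m)"
    by (subst fps_solve_recursion[where U = U, OF rec]) (simp_all add: fps_compose_shift[where \<kappa> = \<kappa>, OF k0])
  moreover have "Abs_fps m = 1 + U 0"
  proof (rule fps_ext)
    fix n show "Abs_fps m $ n = (1 + U 0) $ n"
      using colored_sum_eq_pointed[of 0 n c k] w[of n] m by (cases n) (auto simp: U_def c_def)
  qed
  ultimately show ?thesis by simp
qed

definition alternating_sum :: "(nat \<Rightarrow> real) \<Rightarrow> (nat \<Rightarrow> real) \<Rightarrow> nat \<Rightarrow> real" where
  "alternating_sum \<kappa> \<kappa>' n =
     (\<Sum>P\<in>NC_alt n. \<Prod>B\<in>P. if B \<subseteq> {i. even i} then \<kappa> (card B) else \<kappa>' (card B))"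

text \<open>Let \<open>E b\<close> and \<open>F b\<close> be the generating functions of the alternating words of even and odd
  length whose first letter is \<open>b\<close>, let \<open>C b\<close> be the cumulant series of the letter \<open>b\<close>, and put
  \<open>u b = z F (\<not> b)\<close>. Splitting off the first block gives \<open>E b = 1 + C b (u b)\<close> and
  \<open>u b F b = (E b - 1) E (\<not> b)\<close>; since \<open>u b F b = z F True F False\<close> is symmetric in \<open>b\<close>, it
  follows that \<open>E True = E False\<close>.\<close>
lemma alternating_sum_fps:
  assumes k0: "\<kappa> 0 = 0" "\<kappa>' 0 = 0"
  defines "M \<equiv> Abs_fps (alternating_sum \<kappa> \<kappa>')"
  obtains u v where "u $ 0 = 0" "v $ 0 = 0" "u $ 1 = \<kappa>' 1" "v $ 1 = \<kappa> 1"
    "M = 1 + (Abs_fps \<kappa> oo u)" "M = 1 + (Abs_fps \<kappa>' oo v)" "u * v = fps_X * M * (M - 1)"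
proof -
  define k where "k b = (if b then \<kappa> else \<kappa>')" for b
  define c where "c b x = (even x = b)" for b :: bool and x :: nat
  define E where "E b = Abs_fps (\<lambda>n. colored_sum (c b) k 0 (2 * n))" for b
  define F where "F b = Abs_fps (\<lambda>n. colored_sum (c b) k 0 (2 * n + 1))" for b
  define U where "U b r = Abs_fps (\<lambda>n. if n = 0 then 0 else pointed_colored_sum (c b) k b r 0 (2 * n))" for b r
  define V where "V b r = Abs_fps (\<lambda>n. pointed_colored_sum (c b) k b r 0 (2 * n + 1))" for b r
  have s: "colored_sum (c b) k (Suc 0) (Suc l) = colored_sum (c (\<not> b)) k 0 l" for b l
    using colored_sum_shift[of l "c b" "Suc 0" "c (\<not> b)" 0 k] by (auto simp: c_def)
  have t: "pointed_colored_sum (c b) k b r (2 * l) (2 * l + n) = pointed_colored_sum (c b) k b r 0 n" if "n > 0" for b l r n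
    using colored_sum_shift[of n "c b" "2 * l" "c b" 0 k] that by (auto simp: c_def)
  have rec: "pointed_colored_sum (c b) k b r 0 (Suc N) = k b (Suc r) * colored_sum (c (\<not> b)) k 0 N +
     (\<Sum>l<N div 2. F (\<not> b) $ l * pointed_colored_sum (c b) k b (Suc r) 0 (N - 1 - 2 * l))" for b r N
  proof -
    have "pointed_colored_sum (c b) k b r 0 (Suc N) = k b (Suc r) * colored_sum (c (\<not> b)) k 0 N +
       (\<Sum>j\<in>{0<..<Suc N}. colored_sum (c b) k (Suc 0) j * pointed_colored_sum (c b) k b (Suc r) j (Suc N))"
      by (subst pointed_colored_sum_rec) (simp_all add: s, simp add: c_def)
    \<comment> \<open>The next point of the first block carries the same colour, hence stands at an
      even position 2 (l + 1). The 2 l + 1 letters in between form an alternating word that begins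
      with the other letter, whence the coefficient \<open>F (\<not> b) $ l\<close>.\<close>
    also have "(\<Sum>j\<in>{0<..<Suc N}. colored_sum (c b) k (Suc 0) j * pointed_colored_sum (c b) k b (Suc r) j (Suc N)) =
       (\<Sum>j\<in>{j\<in>{0<..<Suc N}. even j}. colored_sum (c b) k (Suc 0) j * pointed_colored_sum (c b) k b (Suc r) j (Suc N))"
      by (rule sum.mono_neutral_right) (auto simp: c_def intro!: pointed_colored_sum_eq_0)
    also have "\<dots> = (\<Sum>l<N div 2. F (\<not> b) $ l * pointed_colored_sum (c b) k b (Suc r) 0 (N - 1 - 2 * l))"
    proof (rule sum.reindex_bij_witness[where i = "\<lambda>l. 2 * Suc l" and j = "\<lambda>j. j div 2 - 1"])
      fix j assume j: "j \<in> {j\<in>{0<..<Suc N}. even j}"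
      then obtain l where l: "j = 2 * Suc l"
        by (metis (no_types, lifting) dvdE greaterThanLessThan_iff mem_Collect_eq mult_0_right not0_implies_Suc not_gr_zero)
      then have lN: "2 * l + 2 \<le> N" using j by auto
      then have N: "Suc N = 2 * Suc l + (N - 1 - 2 * l)" by simp
      have "pointed_colored_sum (c b) k b (Suc r) j (Suc N) = pointed_colored_sum (c b) k b (Suc r) 0 (N - 1 - 2 * l)"
        unfolding l by (subst N, subst t) (use lN in auto)
      moreover have "colored_sum (c b) k (Suc 0) j = F (\<not> b) $ l"
        unfolding l using s[of b "2 * l + 1"] by (simp add: F_def)
      ultimately show "F (\<not> b) $ (j div 2 - 1) * pointed_colored_sum (c b) k b (Suc r) 0 (N - 1 - 2 * (j div 2 - 1)) =
          colored_sum (c b) k (Suc 0) j * pointed_colored_sum (c b) k b (Suc r) j (Suc N)"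
        by (simp add: l)
    qed (auto simp: gr0_conv_Suc elim!: evenE)
    finally show ?thesis .
  qed
  have recU: "U b r = fps_const (k b (Suc r)) * (fps_X * F (\<not> b)) + fps_X * F (\<not> b) * U b (Suc r)" for b r
  proof (rule fps_ext)
    fix n
    show "U b r $ n = (fps_const (k b (Suc r)) * (fps_X * F (\<not> b)) + fps_X * F (\<not> b) * U b (Suc r)) $ n"
    proof (cases n)
      case (Suc N)
      have "U b r $ n = k b (Suc r) * F (\<not> b) $ N +
         (\<Sum>l<N. F (\<not> b) $ l * pointed_colored_sum (c b) k b (Suc r) 0 (2 * N - 2 * l))"
        using rec[of b r "2 * N + 1"] by (simp add: U_def F_def Suc)
      also have "(\<Sum>l<N. F (\<not> b) $ l * pointed_colored_sum (c b) k b (Suc r) 0 (2 * N - 2 * l)) =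
          (\<Sum>l<N. F (\<not> b) $ l * U b (Suc r) $ (N - l))"
        by (intro sum.cong) (auto simp: U_def right_diff_distrib')
      also have "\<dots> = (\<Sum>l=0..N. F (\<not> b) $ l * U b (Suc r) $ (N - l))"
        by (rule sum.mono_neutral_left) (auto simp: U_def)
      finally show ?thesis
        by (simp only: Suc fps_add_nth fps_mult_left_const_nth mult.assoc fps_X_mult_nth)
           (simp add: fps_mult_nth)
    qed (simp add: U_def)
  qed
  have recV: "V b r = fps_const (k b (Suc r)) * E (\<not> b) + fps_X * F (\<not> b) * V b (Suc r)" for b r
  proof (rule fps_ext)
    fix n
    have "V b r $ n = k b (Suc r) * E (\<not> b) $ n +
         (\<Sum>l<n. F (\<not> b) $ l * pointed_colored_sum (c b) k b (Suc r) 0 (2 * n - 1 - 2 * l))"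
      using rec[of b r "2 * n"] by (simp add: V_def E_def)
    also have "(\<Sum>l<n. F (\<not> b) $ l * pointed_colored_sum (c b) k b (Suc r) 0 (2 * n - 1 - 2 * l)) =
          (\<Sum>l<n. F (\<not> b) $ l * V b (Suc r) $ (n - 1 - l))"
    proof (intro sum.cong refl)
      fix l assume "l \<in> {..<n}"
      then have "2 * n - 1 - 2 * l = 2 * (n - 1 - l) + 1" by auto
      then show "F (\<not> b) $ l * pointed_colored_sum (c b) k b (Suc r) 0 (2 * n - 1 - 2 * l) =
          F (\<not> b) $ l * V b (Suc r) $ (n - 1 - l)" by (simp add: V_def)
    qed
    also have "\<dots> = (fps_X * (F (\<not> b) * V b (Suc r))) $ n"
    proof (cases n)
      case (Suc N)
      then show ?thesis
        by (simp only: fps_X_mult_nth) (simp add: fps_mult_nth atLeast0AtMost lessThan_Suc_atMost)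
    qed simp
    finally show "V b r $ n = (fps_const (k b (Suc r)) * E (\<not> b) + fps_X * F (\<not> b) * V b (Suc r)) $ n"
      by (simp add: mult.assoc)
  qed
  define u where "u b = fps_X * F (\<not> b)" for b
  define D where "D b = Abs_fps (\<lambda>r. k b (Suc r)) oo u b" for b
  have u0: "u b $ 0 = 0" for b by (simp add: u_def)
  have C: "u b * D b = Abs_fps (k b) oo u b" for b
    unfolding D_def by (rule fps_compose_shift[OF _ u0]) (simp add: k_def k0)
  have E: "E b = 1 + u b * D b" for b
  proof -
    have "U b 0 = u b * D b"
      unfolding D_def by (rule fps_solve_recursion[OF _ u0]) (rule recU[of b, folded u_def])
    moreover have "E b = 1 + U b 0"
    proof (rule fps_ext)
      fix n show "E b $ n = (1 + U b 0) $ n"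
        using colored_sum_eq_pointed[of 0 "2 * n" "c b" k] by (cases n) (auto simp: E_def U_def c_def)
    qed
    ultimately show ?thesis by simp
  qed
  have F: "F b = E (\<not> b) * D b" for b
  proof -
    have "V b 0 = E (\<not> b) * D b"
      unfolding D_def by (rule fps_solve_recursion[OF _ u0]) (rule recV[of b, folded u_def])
    moreover have "F b = V b 0"
    proof (rule fps_ext)
      fix n show "F b $ n = V b 0 $ n"
        using colored_sum_eq_pointed[of 0 "2 * n + 1" "c b" k] by (auto simp: F_def V_def c_def)
    qed
    ultimately show ?thesis by simp
  qed
  have uF: "u b * F b = (E b - 1) * E (\<not> b)" for b
    using E[of b] F[of b] by (simp add: algebra_simps)
  have EE: "E True = E False"
  proof -
    have "u True * F True = u False * F False" by (simp add: u_def)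
    then show ?thesis 
    proof -
      have "(E True - 1) * E False = (E False - 1) * E True"
        using \<open>u True * F True = u False * F False\<close> uF[of True] uF[of False] by simp
      then have "E False * E True - E False = E False * E True - E True" by (simp add: algebra_simps)
      then show ?thesis by simp
    qed
  qed
  have M: "M = E True"
  proof (rule fps_ext)
    fix n
    \<comment> \<open>Partitions with a mixed block have weight zero, so the sum over
      \<open>NC_alt n\<close> extends to all noncrossing partitions of the 2 n positions.\<close>
    have "alternating_sum \<kappa> \<kappa>' n = colored_sum (c True) k 0 (2 * n)"
      unfolding alternating_sum_def colored_sum_def nc_sum_def
    proof (rule sum.mono_neutral_cong_left)
      show "finite (NCP {0..<2 * n})" by (simp add: finite_NCP)
      show "NC_alt n \<subseteq> NCP {0..<2 * n}" by (auto simp: NC_alt_def NC_eq_NCP)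
      have w: "colored_weight (c True) k True 0 B + colored_weight (c True) k False 0 B =
           (if B \<subseteq> {i. even i} then \<kappa> (card B) else if B \<subseteq> {i. odd i} then \<kappa>' (card B) else 0)"
        if "B \<noteq> {}" for B
        using that by (auto simp: colored_weight_def c_def k_def)
      show "\<forall>P\<in>NCP {0..<2 * n} - NC_alt n.
        (\<Prod>B\<in>P. colored_weight (c True) k True 0 B + colored_weight (c True) k False 0 B) = 0"
      proof
        fix P assume P: "P \<in> NCP {0..<2 * n} - NC_alt n"
        then obtain B where B: "B \<in> P" "\<not> (B \<subseteq> {i. even i} \<or> B \<subseteq> {i. odd i})"
          by (auto simp: NC_alt_def NC_eq_NCP)
        have "B \<noteq> {}" "finite P" using P B finite_NCP_elem[of P] by auto
        moreover have "colored_weight (c True) k True 0 B + colored_weight (c True) k False 0 B = 0"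
          using w[OF \<open>B \<noteq> {}\<close>] B(2) by simp
        ultimately show "(\<Prod>B\<in>P. colored_weight (c True) k True 0 B + colored_weight (c True) k False 0 B) = 0"
          using B(1) by (intro prod_zero) blast+
      qed
      fix P assume P: "P \<in> NC_alt n"
      show "(\<Prod>B\<in>P. if B \<subseteq> {i. even i} then \<kappa> (card B) else \<kappa>' (card B)) =
         (\<Prod>B\<in>P. colored_weight (c True) k True 0 B + colored_weight (c True) k False 0 B)"
      proof (rule prod.cong[OF refl])
        fix B assume B: "B \<in> P"
        then have "B \<noteq> {}" using P by (auto simp: NC_alt_def NC_def partition_on_def)
        moreover have "B \<subseteq> {i. even i} \<or> B \<subseteq> {i. odd i}" using P B by (auto simp: NC_alt_def)
        ultimately show "(if B \<subseteq> {i. even i} then \<kappa> (card B) else \<kappa>' (card B)) =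
          colored_weight (c True) k True 0 B + colored_weight (c True) k False 0 B" by (subst w) auto
      qed
    qed
    then show "M $ n = E True $ n" by (simp add: M_def E_def)
  qed
  have E0: "E b $ 0 = 1" for b by (simp add: E_def)
  have D0: "D b $ 0 = k b 1" for b by (simp add: D_def)
  show ?thesis
  proof
    show "u True $ 0 = 0" "u False $ 0 = 0" by (simp_all add: u0)
    show "u True $ 1 = \<kappa>' 1" "u False $ 1 = \<kappa> 1"
      using F E0 D0 by (auto simp: u_def k_def)
    show "M = 1 + (Abs_fps \<kappa> oo u True)" using E[of True] C[of True] by (simp add: M k_def)
    show "M = 1 + (Abs_fps \<kappa>' oo u False)" using E[of False] C[of False] by (simp add: M EE k_def)
    have "u True * u False = fps_X * (u True * F True)" by (simp add: u_def)
    also have "u True * F True = (M - 1) * M" using uF[of True] M EE by simp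
    finally show "u True * u False = fps_X * M * (M - 1)" by (simp only: ac_simps)
  qed
qed

subsection \<open>Free cumulants and the free product with a Bernoulli law\<close>

lemma finite_NC: "finite (NC n)"
  by (simp add: NC_eq_NCP finite_NCP)

lemma trivial_partition_in_NC: "n \<ge> 1 \<Longrightarrow> {{0..<n}} \<in> NC n"
  by (auto simp: NC_def noncrossing_def intro: partition_on_space)

text \<open>Makes the moment-cumulant formula triangular: only the one-block partition involves the
  cumulant of order n, with coefficient 1. Existence and uniqueness of free cumulants both rest on
  this.\<close>

lemma block_card_less:
  assumes "P \<in> NC n - {{{0..<n}}}" "B \<in> P"
  shows "card B < n"
proof -
  have p: "partition_on {0..<n} P" using assms by (auto simp: NC_def)
  then have B: "B \<subseteq> {0..<n}" "B \<noteq> {}" using assms by (auto simp: partition_on_def)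
  have "B \<noteq> {0..<n}"
  proof
    assume "B = {0..<n}"
    have CB: "C = B" if "C \<in> P" for C
    proof -
      have "C \<subseteq> {0..<n}" "C \<noteq> {}" using p that by (auto simp: partition_on_def)
      then have "\<not> disjnt C B" using \<open>B = {0..<n}\<close> by (auto simp: disjnt_def)
      then show ?thesis using p that assms(2) by (auto simp: partition_on_def pairwise_def)
    qed
    have "P = {B}"
    proof
      show "P \<subseteq> {B}" using CB by (intro subsetI) simp
    qed (use assms(2) in simp)
    then show False using assms(1) \<open>B = {0..<n}\<close> by simp
  qed
  then have "B \<subset> {0..<n}" using B by auto
  then show ?thesis using psubset_card_mono[of "{0..<n}" B] by simp
qed

lemma NC_sum_split:
  fixes \<kappa> :: "nat \<Rightarrow> real"
  assumes "n \<ge> 1"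
  shows "(\<Sum>P\<in>NC n. \<Prod>B\<in>P. \<kappa> (card B)) = \<kappa> n + (\<Sum>P\<in>NC n - {{{0..<n}}}. \<Prod>B\<in>P. \<kappa> (card B))"
  by (subst sum.remove[OF finite_NC trivial_partition_in_NC[OF assms]]) simp

text \<open>Triangular inversion of the moment-cumulant formula. The guard \<open>card B < n\<close>
  yields termination; by \<open>block_card_less\<close> it holds for every block in the sum.\<close>

function cumulants_of :: "(nat \<Rightarrow> real) \<Rightarrow> nat \<Rightarrow> real" where
  "cumulants_of m n = (if n = 0 then 0 else
     m n - (\<Sum>P\<in>NC n - {{{0..<n}}}. \<Prod>B\<in>P. if card B < n then cumulants_of m (card B) else 0))"
  by auto
termination by (relation "Wellfounded.measure snd") auto

declare cumulants_of.simps [simp del]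

lemma is_free_cumulants_cumulants_of: "is_free_cumulants m (cumulants_of m)"
  unfolding is_free_cumulants_def
proof (intro conjI allI impI)
  show "cumulants_of m 0 = 0" by (simp add: cumulants_of.simps)
  fix n :: nat assume n: "n \<ge> 1"
  have "(\<Sum>P\<in>NC n - {{{0..<n}}}. \<Prod>B\<in>P. cumulants_of m (card B)) =
     (\<Sum>P\<in>NC n - {{{0..<n}}}. \<Prod>B\<in>P. if card B < n then cumulants_of m (card B) else 0)"
    by (intro sum.cong prod.cong refl) (simp add: block_card_less)
  then show "m n = (\<Sum>P\<in>NC n. \<Prod>B\<in>P. cumulants_of m (card B))"
    using n by (subst NC_sum_split[OF n]) (simp add: cumulants_of.simps[of m n])
qed

lemma is_free_cumulants_unique:
  assumes "is_free_cumulants m \<kappa>" "is_free_cumulants m \<kappa>'"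
  shows "\<kappa> = \<kappa>'"
proof
  fix n show "\<kappa> n = \<kappa>' n"
  proof (induction n rule: less_induct)
    case (less n)
    show ?case
    proof (cases "n = 0")
      case True then show ?thesis using assms by (simp add: is_free_cumulants_def)
    next
      case False
      then have n: "n \<ge> 1" by simp
      have "(\<Sum>P\<in>NC n - {{{0..<n}}}. \<Prod>B\<in>P. \<kappa> (card B)) = (\<Sum>P\<in>NC n - {{{0..<n}}}. \<Prod>B\<in>P. \<kappa>' (card B))"
        by (intro sum.cong prod.cong refl) (simp add: less block_card_less)
      moreover have "m n = (\<Sum>P\<in>NC n. \<Prod>B\<in>P. \<kappa> (card B))" "m n = (\<Sum>P\<in>NC n. \<Prod>B\<in>P. \<kappa>' (card B))"
        using assms n by (auto simp: is_free_cumulants_def)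
      ultimately show ?thesis unfolding NC_sum_split[OF n] by simp
    qed
  qed
qed

lemma is_free_cumulants_free_cumulant: "is_free_cumulants (moment \<rho>) (free_cumulant \<rho>)"
  unfolding free_cumulant_def
  by (rule theI[where P = "is_free_cumulants (moment \<rho>)", OF is_free_cumulants_cumulants_of]) (rule is_free_cumulants_unique[OF _ is_free_cumulants_cumulants_of])

lemma is_free_cumulants_1:
  assumes "is_free_cumulants m \<kappa>"
  shows "\<kappa> 1 = m 1"
proof -
  have "NC 1 - {{{0..<1}}} = {}"
  proof (rule equals0I)
    fix P assume P: "P \<in> NC 1 - {{{0..<1}}}"
    then have p: "partition_on {0..<1} P" by (auto simp: NC_def)
    have "P \<noteq> {}" using p by (auto simp: partition_on_def)
    then obtain B where "B \<in> P" by auto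
    with block_card_less[OF P this] have "B = {} \<or> infinite B" by auto
    moreover have "B \<noteq> {}" "B \<subseteq> {0..<1}" using p \<open>B \<in> P\<close> by (auto simp: partition_on_def)
    ultimately show False using finite_subset by blast
  qed
  moreover have "m 1 = (\<Sum>P\<in>NC 1. \<Prod>B\<in>P. \<kappa> (card B))"
    using assms by (simp add: is_free_cumulants_def)
  ultimately show ?thesis
    by (simp only: NC_sum_split[OF order_refl] sum.empty add_0_right)
qed

lemma fps_compositional_root:
  fixes A v :: "real fps"
  assumes "A $ 0 = 0" "A $ 1 \<noteq> 0" "v $ 0 = 0"
  obtains \<xi> where "\<xi> $ 0 = 0" "A oo \<xi> = v"
proof
  have i0: "fps_inv A $ 0 = 0" by (simp add: fps_inv_def)
  show "(fps_inv A oo v) $ 0 = 0" by (simp add: i0)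
  have "A oo (fps_inv A oo v) = (A oo fps_inv A) oo v"
    by (rule fps_compose_assoc[OF assms(3) i0])
  also have "\<dots> = v" using assms by (simp add: fps_inv_right)
  finally show "A oo (fps_inv A oo v) = v" .
qed

text \<open>The case of Voiculescu's \<open>S\<close>-transform identity in which one factor is a Bernoulli law.\<close>
lemma two_point_free_product_fps:
  fixes \<alpha> \<gamma> :: real
  assumes a: "is_free_cumulants a \<kappa>" "a 0 = 1" "\<And>n. n \<ge> 1 \<Longrightarrow> a n = \<alpha> * \<gamma> ^ n"
    and b: "is_free_cumulants b \<kappa>'" "b 0 = 1" "b 1 \<noteq> 0"
    and pos: "\<alpha> \<noteq> 0" "\<gamma> \<noteq> 0"
    and Z: "fps_const \<gamma> * Z * (Abs_fps b - 1 + fps_const \<alpha>) = fps_X * Abs_fps b"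
  shows "Abs_fps (alternating_sum \<kappa> \<kappa>') oo Z = Abs_fps b" "Z $ 0 = 0" "Z $ 1 \<noteq> 0"
proof -
  define M where "M = Abs_fps (alternating_sum \<kappa> \<kappa>')"
  have k0: "\<kappa> 0 = 0" "\<kappa>' 0 = 0" using a b by (auto simp: is_free_cumulants_def)
  obtain u v where u: "u $ 0 = 0" "u $ 1 = \<kappa>' 1" "M = 1 + (Abs_fps \<kappa> oo u)"
    and v: "v $ 0 = 0" "v $ 1 = \<kappa> 1" "M = 1 + (Abs_fps \<kappa>' oo v)" and uv: "u * v = fps_X * M * (M - 1)"
    using alternating_sum_fps[of \<kappa> \<kappa>', OF k0] unfolding M_def by metis
  have k1: "\<kappa> 1 \<noteq> 0" "\<kappa>' 1 \<noteq> 0"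
    using is_free_cumulants_1[OF a(1)] is_free_cumulants_1[OF b(1)] a(3)[of 1] b(3) pos by auto
  \<comment> \<open>The substitution w = \<xi> m(\<xi>) turns N = 1 + C(w) into N = m(\<xi>) by the
    functional equation of the cumulants. So \<xi> plays the role of the inverse moment series in
    the S-transform, evaluated at N - 1.\<close>
  have root: "\<exists>\<xi>. \<xi> $ 0 = 0 \<and> w = \<xi> * (Abs_fps m oo \<xi>) \<and> N = Abs_fps m oo \<xi>"
    if m: "is_free_cumulants m c" "m 0 = 1" and w: "w $ 0 = 0" and N: "N = 1 + (Abs_fps c oo w)" for m c w N
  proof -
    have A: "(fps_X * Abs_fps m) $ 0 = 0" "(fps_X * Abs_fps m) $ 1 \<noteq> 0" using m by auto
    obtain \<xi> where \<xi>: "\<xi> $ 0 = 0" "(fps_X * Abs_fps m) oo \<xi> = w"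
      using fps_compositional_root[OF A w] .
    have "w = \<xi> * (Abs_fps m oo \<xi>)"
      using \<xi> by (simp add: fps_compose_mult_distrib)
    moreover have "N = Abs_fps m oo \<xi>"
    proof -
      have "Abs_fps c oo w = (Abs_fps c oo (fps_X * Abs_fps m)) oo \<xi>"
        unfolding \<xi>(2)[symmetric] by (rule fps_compose_assoc[OF \<xi>(1) A(1)])
      then have "N = (1 + (Abs_fps c oo (fps_X * Abs_fps m))) oo \<xi>"
        by (simp add: N fps_compose_add_distrib)
      then show ?thesis using free_cumulants_fps[OF m] by simp
    qed
    ultimately show ?thesis using \<xi> by blast
  qed
  obtain \<xi> where \<xi>: "\<xi> $ 0 = 0" "v = \<xi> * M" "M = Abs_fps b oo \<xi>"
    using root[OF b(1,2) v(1,3)] by metis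
  obtain \<eta> where \<eta>: "\<eta> $ 0 = 0" "u = \<eta> * M" "M = Abs_fps a oo \<eta>"
    using root[OF a(1,2) u(1,3)] by metis
  \<comment> \<open>The moment series of a two-point law: a(x) - 1 = \<alpha> \<gamma> x / (1 -
    \<gamma> x), with the denominator cleared.\<close>
  have "(Abs_fps a - 1) * (1 - fps_const \<gamma> * fps_X) = fps_const (\<alpha> * \<gamma>) * fps_X"
  proof (rule fps_ext)
    fix n show "((Abs_fps a - 1) * (1 - fps_const \<gamma> * fps_X)) $ n = (fps_const (\<alpha> * \<gamma>) * fps_X) $ n"
    proof (cases n)
      case 0 then show ?thesis by (simp add: a(2))
    next
      case (Suc N)
      have "(Abs_fps a - 1) * (1 - fps_const \<gamma> * fps_X) = (Abs_fps a - 1) - fps_const \<gamma> * (fps_X * (Abs_fps a - 1))"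
        by (simp add: algebra_simps)
      also have "\<dots> $ Suc N = (fps_const (\<alpha> * \<gamma>) * fps_X) $ Suc N"
        by (simp only: fps_sub_nth fps_mult_left_const_nth fps_X_mult_nth) (cases N; simp add: a)
      finally show ?thesis by (simp add: Suc)
    qed
  qed
  then have "((Abs_fps a - 1) * (1 - fps_const \<gamma> * fps_X)) oo \<eta> = (fps_const (\<alpha> * \<gamma>) * fps_X) oo \<eta>" by simp
  then have \<eta>M: "(M - 1) * (1 - fps_const \<gamma> * \<eta>) = fps_const (\<alpha> * \<gamma>) * \<eta>"
    by (simp add: fps_compose_mult_distrib[OF \<eta>(1)] fps_compose_sub_distrib \<eta>(1) \<eta>(3)[symmetric])
  have uv0: "u * v \<noteq> 0" using u(2) v(2) k1 by (metis fps_zero_nth mult_eq_0_iff)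
  then have M0: "M \<noteq> 0" "M - 1 \<noteq> 0" using uv by auto
  \<comment> \<open>Multiplicativity of the S-transform without quotients: the inverse moment series
    \<xi> and \<eta> of the factors and X, that of the product, satisfy \<xi> \<eta> M = X (M -
    1).\<close>
  have "M * (\<xi> * \<eta> * M) = M * (fps_X * (M - 1))"
    using uv \<xi>(2) \<eta>(2) by (simp add: algebra_simps)
  then have 1: "\<xi> * \<eta> * M = fps_X * (M - 1)" using M0 by simp
  have 2: "M - 1 = fps_const \<gamma> * \<eta> * (fps_const \<alpha> + M - 1)"
    using \<eta>M by (simp add: algebra_simps flip: fps_const_mult)
  have "\<eta> * (\<xi> * M) = \<eta> * (fps_const \<gamma> * fps_X * (fps_const \<alpha> + M - 1))"
    using 1 by (subst (asm) 2) (simp add: ac_simps)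
  moreover have "\<eta> \<noteq> 0" using 2 M0 by auto
  ultimately have "\<xi> * M = fps_const \<gamma> * fps_X * (fps_const \<alpha> + M - 1)"
    using mult_left_cancel by blast
  also have "fps_const \<alpha> + M - 1 = M - 1 + fps_const \<alpha>" by simp
  finally have 3: "\<xi> * M = fps_const \<gamma> * fps_X * (M - 1 + fps_const \<alpha>)" .
  \<comment> \<open>Composed with \<xi>, the hypothesis on \<open>Z\<close> becomes a linear
    equation for \<open>Z oo \<xi>\<close>, which X satisfies too by the preceding identity. The
    factor M - 1 + \<alpha> can be cancelled, as its constant term is \<alpha>; hence
    \<open>Z\<close> is the compositional inverse of \<xi>.\<close>
  have "(fps_const \<gamma> * Z * (Abs_fps b - 1 + fps_const \<alpha>)) oo \<xi> = (fps_X * Abs_fps b) oo \<xi>" by (simp add: Z)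
  then have 4: "fps_const \<gamma> * (Z oo \<xi>) * (M - 1 + fps_const \<alpha>) = \<xi> * M"
    by (simp add: fps_compose_mult_distrib[OF \<xi>(1)] fps_compose_sub_distrib fps_compose_add_distrib \<xi>(1) \<xi>(3)[symmetric])
  have M0': "M $ 0 = 1" using \<xi> b by simp
  have "M - 1 + fps_const \<alpha> \<noteq> 0"
  proof
    assume "M - 1 + fps_const \<alpha> = 0"
    then have "(M - 1 + fps_const \<alpha>) $ 0 = 0" by (simp only: fps_zero_nth)
    then show False using M0' pos by simp
  qed
  moreover have "(M - 1 + fps_const \<alpha>) * (fps_const \<gamma> * (Z oo \<xi>)) = (M - 1 + fps_const \<alpha>) * (fps_const \<gamma> * fps_X)"
    using 3 4 by (simp add: ac_simps)
  ultimately have "fps_const \<gamma> * (Z oo \<xi>) = fps_const \<gamma> * fps_X" by simp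
  then have Z\<xi>: "Z oo \<xi> = fps_X" using pos by simp
  have "(\<xi> * M) $ 1 = (fps_const \<gamma> * fps_X * (M - 1 + fps_const \<alpha>)) $ 1" by (simp only: 3)
  then have \<xi>1: "\<xi> $ 1 \<noteq> 0" using pos M0' \<xi>(1) by (simp add: fps_mult_nth)
  have "fps_inv \<xi> oo \<xi> = fps_X" by (rule fps_inv[OF \<xi>(1) \<xi>1])
  then have Zi: "Z = fps_inv \<xi>"
    using Z\<xi> fps_compose_inj_right[OF \<xi>(1) \<xi>1, of Z "fps_inv \<xi>"] by simp
  show Z0: "Z $ 0 = 0" unfolding Zi by (simp add: fps_inv_def)
  show "Z $ 1 \<noteq> 0"
  proof -
    have "(Z oo \<xi>) $ 1 = 1" by (simp add: Z\<xi>)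
    then show ?thesis using Z0 by (auto simp: fps_compose_nth)
  qed
  have "M oo Z = Abs_fps b oo (\<xi> oo Z)"
    unfolding \<xi>(3) by (rule fps_compose_assoc[OF Z0 \<xi>(1), symmetric])
  also have "\<xi> oo Z = fps_X" unfolding Zi by (rule fps_inv_right[OF \<xi>(1) \<xi>1])
  finally show "Abs_fps (alternating_sum \<kappa> \<kappa>') oo Z = Abs_fps b" by (simp add: M_def)
qed

text \<open>Composition with \<open>Z\<close> is injective because its linear coefficient is
  nonzero. The noncrossing sums are thus identified by the single relation c(Z) = b, which can be
  checked analytically on Cauchy transforms.\<close>

lemma moments_eq_alternating_sum:
  fixes \<alpha> \<gamma> :: real
  assumes "is_free_cumulants a \<kappa>" "a 0 = 1" "\<And>n. n \<ge> 1 \<Longrightarrow> a n = \<alpha> * \<gamma> ^ n"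
    and "is_free_cumulants b \<kappa>'" "b 0 = 1" "b 1 \<noteq> 0" "\<alpha> \<noteq> 0" "\<gamma> \<noteq> 0"
    and "fps_const \<gamma> * Z * (Abs_fps b - 1 + fps_const \<alpha>) = fps_X * Abs_fps b"
    and "Abs_fps c oo Z = Abs_fps b"
  shows "c n = alternating_sum \<kappa> \<kappa>' n"
proof -
  note Z = two_point_free_product_fps[OF assms(1-9)]
  have "Abs_fps c oo Z = Abs_fps (alternating_sum \<kappa> \<kappa>') oo Z" using Z(1) assms(10) by simp
  then have "Abs_fps c = Abs_fps (alternating_sum \<kappa> \<kappa>')"
    using fps_compose_inj_right[OF Z(2,3)] by blast
  then show ?thesis by (metis fps_nth_Abs_fps)
qed

subsection \<open>Root distributions of higher derivatives\<close>

definition rpoly :: "'a::field multiset \<Rightarrow> 'a poly" where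
  "rpoly A = (\<Prod>x\<in>#A. [:-x, 1:])"

lemma rpoly_empty [simp]: "rpoly {#} = 1"
  by (simp add: rpoly_def)

lemma rpoly_add_mset [simp]: "rpoly (add_mset a A) = [:-a, 1:] * rpoly A"
  by (simp add: rpoly_def)

lemma pderiv_linear_mult:
  fixes p :: "'a::field poly"
  shows "pderiv ([:-a, 1:] * p) = p + [:-a, 1:] * pderiv p"
proof -
  have "pderiv [:-a, 1:] = 1" by (simp add: pderiv_pCons)
  then show ?thesis by (simp only: pderiv_mult mult_1_right add.commute)
qed

lemma poly_linear_mult: "poly ([:-a, 1:] * p) z = (z - a) * poly p (z :: 'a::field)"
  by (simp add: algebra_simps)

lemma rpoly_nonzero [simp]: "rpoly A \<noteq> 0"
  by (induction A) (auto simp del: mult_pCons_left)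

lemma degree_rpoly [simp]: "degree (rpoly A) = size A"
proof (induction A)
  case (add a A)
  have "degree ([:-a, 1:] * rpoly A) = degree [:-a, 1:] + degree (rpoly A)"
    by (rule degree_mult_eq) auto
  then show ?case using add by (simp del: mult_pCons_left)
qed simp

lemma poly_rpoly_eq_0_iff: "poly (rpoly A) z = 0 \<longleftrightarrow> z \<in># A"
  by (induction A) auto

lemma poly_pderiv_rpoly:
  assumes "z \<notin># A"
  shows "poly (pderiv (rpoly A)) z = poly (rpoly A) z * (\<Sum>x\<in>#A. 1 / (z - x))"
  using assms
proof (induction A)
  case (add a A)
  then have "z - a \<noteq> 0" by auto
  then show ?case using add
    by (simp only: rpoly_add_mset pderiv_linear_mult poly_add poly_linear_mult) (simp add: field_simps)
qed simp

lemma map_poly_of_real_mult: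
  "map_poly of_real (p * q) = (map_poly of_real p * map_poly of_real q :: complex poly)"
  by (rule poly_eqI) (simp add: coeff_map_poly coeff_mult)

lemma map_poly_of_real_pderiv:
  "map_poly of_real (pderiv p) = (pderiv (map_poly of_real p) :: complex poly)"
  by (rule poly_eqI) (simp add: coeff_map_poly coeff_pderiv)

lemma map_poly_of_real_inj:
  assumes "map_poly of_real p = (map_poly of_real q :: complex poly)"
  shows "p = q"
proof (rule poly_eqI)
  fix n show "coeff p n = coeff q n"
    using arg_cong[OF assms, of "\<lambda>r. coeff r n"] by (simp add: coeff_map_poly)
qed

lemma map_poly_of_real_rpoly: "map_poly of_real (rpoly A) = (rpoly (image_mset of_real A) :: complex poly)"
proof (induction A)
  case empty
  show ?case by simp
next
  case (add a A)
  have "map_poly of_real [:-a, 1:] = ([:-of_real a, 1:] :: complex poly)"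
    by (simp add: map_poly_pCons)
  then show ?case using add by (simp add: map_poly_of_real_mult del: mult_pCons_left)
qed

lemma sum_mset_pos:
  fixes f :: "'a \<Rightarrow> real"
  assumes "A \<noteq> {#}" "\<And>x. x \<in># A \<Longrightarrow> f x > 0"
  shows "(\<Sum>x\<in>#A. f x) > 0"
  using assms
proof (induction A)
  case (add a A)
  then show ?case by (cases "A = {#}") (auto intro: add_pos_pos)
qed simp

lemma Im_sum_mset: "Im (\<Sum>x\<in>#A. f x) = (\<Sum>x\<in>#A. Im (f x))"
  by (induction A) auto

text \<open>A critical point w that is no root satisfies \<Sum> 1 / (w - x) = 0. The imaginary part
  of the sum is - Im w times a positive number, so w is real; for real w outside the interval all
  terms have the same sign.\<close>

lemma critical_points_in_interval:
  fixes A :: "real multiset"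
  assumes A: "A \<noteq> {#}" "set_mset A \<subseteq> {l..u}"
    and w: "poly (pderiv (rpoly (image_mset complex_of_real A))) w = 0"
  shows "w = of_real (Re w) \<and> Re w \<in> {l..u}"
proof (cases "w \<in># image_mset complex_of_real A")
  case True
  then show ?thesis using A by auto
next
  case False
  let ?S = "\<Sum>x\<in>#A. 1 / (w - of_real x)"
  have S: "?S = 0"
    using w False by (auto simp: poly_pderiv_rpoly poly_rpoly_eq_0_iff multiset.map_comp comp_def)
  have nz: "w \<noteq> of_real x" if "x \<in># A" for x using False that by auto
  have "Im w = 0"
  proof -
    have "Im (1 / (w - of_real x)) = - Im w * (1 / (cmod (w - of_real x))\<^sup>2)" for x
      by (simp add: Im_divide cmod_power2)
    then have "Im ?S = - Im w * (\<Sum>x\<in>#A. 1 / (cmod (w - of_real x))\<^sup>2)"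
      by (simp only: Im_sum_mset sum_mset_distrib_left)
    moreover have "(\<Sum>x\<in>#A. 1 / (cmod (w - of_real x))\<^sup>2) > 0"
      by (rule sum_mset_pos[OF A(1)]) (use nz in auto)
    ultimately show ?thesis using S by simp
  qed
  then have wr: "w = of_real (Re w)" by (simp add: complex_eq_iff)
  have nz': "Re w \<noteq> x" if "x \<in># A" for x using nz[OF that] wr by auto
  have "?S = of_real (\<Sum>x\<in>#A. 1 / (Re w - x))"
    by (subst wr, induction A) auto
  then have S': "(\<Sum>x\<in>#A. 1 / (Re w - x)) = 0" using S by simp
  have "Re w \<le> u"
  proof (rule ccontr)
    assume "\<not> Re w \<le> u"
    then have "(\<Sum>x\<in>#A. 1 / (Re w - x)) > 0"
      using A(2) by (intro sum_mset_pos[OF A(1)]) fastforce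
    then show False using S' by simp
  qed
  moreover have "Re w \<ge> l"
  proof (rule ccontr)
    assume "\<not> Re w \<ge> l"
    then have "(\<Sum>x\<in>#A. 1 / (x - Re w)) > 0"
      using A(2) by (intro sum_mset_pos[OF A(1)]) fastforce
    moreover have "(\<Sum>x\<in>#A. 1 / (x - Re w)) = - (\<Sum>x\<in>#A. 1 / (Re w - x))"
      by (induction A) (auto simp: minus_divide_right)
    ultimately show False using S' by simp
  qed
  ultimately show ?thesis using wr by simp
qed

text \<open>The derivative splits into linear factors over the complex numbers;
  \<open>critical_points_in_interval\<close> makes all these roots real, and the factorisation
  descends because the embedding of coefficients is injective.\<close>

lemma pderiv_rpoly:
  fixes A :: "real multiset"
  assumes "size A = Suc n" "set_mset A \<subseteq> {l..u}"
  obtains B where "size B = n" "set_mset B \<subseteq> {l..u}" "pderiv (rpoly A) = smult (of_nat (Suc n)) (rpoly B)"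
proof -
  let ?A = "image_mset complex_of_real A"
  define D where "D = pderiv (rpoly ?A)"
  have D: "D \<noteq> 0" unfolding D_def by (simp add: pderiv_eq_0_iff assms)
  then obtain C where C: "size C = degree D" "D = smult (lead_coeff D) (rpoly C)"
    using alg_closed_imp_factorization[of D] unfolding rpoly_def by blast
  have A0: "A \<noteq> {#}" using assms by auto
  have "w = of_real (Re w) \<and> Re w \<in> {l..u}" if "w \<in># C" for w
  proof (rule critical_points_in_interval[OF A0 assms(2)])
    show "poly (pderiv (rpoly ?A)) w = 0"
      using that by (subst D_def[symmetric], subst C) (simp add: poly_rpoly_eq_0_iff)
  qed
  then have CB: "C = image_mset complex_of_real (image_mset Re C)" and sub: "set_mset (image_mset Re C) \<subseteq> {l..u}"
    by (auto simp: multiset.map_comp comp_def intro!: multiset.map_ident_strong[symmetric])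
  define B where "B = image_mset Re C"
  have deg: "degree D = n" unfolding D_def by (simp add: degree_pderiv assms)
  have lead: "lead_coeff (rpoly ?A) = 1"
    unfolding rpoly_def by (induction A) (auto simp: lead_coeff_mult simp del: mult_pCons_left)
  have "lead_coeff D = of_nat (Suc n)"
    unfolding D_def using lead assms deg[unfolded D_def] by (simp add: coeff_pderiv del: of_nat_Suc)
  moreover have "map_poly of_real (pderiv (rpoly A)) = D"
    unfolding D_def by (simp add: map_poly_of_real_pderiv map_poly_of_real_rpoly)
  moreover have "map_poly of_real (smult (of_nat (Suc n)) (rpoly B)) = smult (of_nat (Suc n)) (rpoly C)"
    unfolding B_def
    by (subst (2) CB) (simp only: smult_conv_map_poly flip: map_poly_of_real_rpoly; rule poly_eqI; simp add: coeff_map_poly)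
  ultimately have "pderiv (rpoly A) = smult (of_nat (Suc n)) (rpoly B)"
    using C(2) map_poly_of_real_inj by metis
  then show ?thesis using that[of B] sub C deg by (simp add: B_def)
qed

lemma higher_pderiv_rpoly:
  fixes A :: "real multiset"
  assumes "size A = n + k" "set_mset A \<subseteq> {l..u}"
  obtains B c where "size B = n" "set_mset B \<subseteq> {l..u}" "c > 0" "(pderiv ^^ k) (rpoly A) = smult c (rpoly B)"
proof -
  have "\<exists>B c. size B = n \<and> set_mset B \<subseteq> {l..u} \<and> c > 0 \<and> (pderiv ^^ k) (rpoly A) = smult c (rpoly B)"
    using assms
  proof (induction k arbitrary: n)
    case 0
    then show ?case by (intro exI[of _ A] exI[of _ 1]) auto
  next
    case (Suc k)
    then obtain B c where B: "size B = Suc n" "set_mset B \<subseteq> {l..u}" "c > 0" "(pderiv ^^ k) (rpoly A) = smult c (rpoly B)"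
      using Suc.IH[of "Suc n"] by auto
    obtain B' where B': "size B' = n" "set_mset B' \<subseteq> {l..u}" "pderiv (rpoly B) = smult (of_nat (Suc n)) (rpoly B')"
      using pderiv_rpoly[OF B(1,2)] .
    show ?case
      using B B' by (intro exI[of _ B'] exI[of _ "c * of_nat (Suc n)"]) (auto simp: pderiv_smult simp del: of_nat_Suc)
  qed
  then show ?thesis using that by blast
qed

section \<open>Log-concavity of Taylor coefficients beyond the largest root\<close>

lemma poly_rpoly_pos:
  fixes A :: "real multiset"
  assumes "\<And>x. x \<in># A \<Longrightarrow> x < z"
  shows "poly (rpoly A) z > 0"
  using assms by (induction A) (auto simp del: mult_pCons_left)

text \<open>Laguerre's inequality. If q has defect D = (q')^2 - q q'' at z, then (x - b) q(x) has
  defect q(z)^2 + (z - b)^2 D, so nonnegativity survives each added root, also when z is itself a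
  root.\<close>

lemma rpoly_log_concave:
  fixes B :: "real multiset"
  shows "poly (rpoly B) z * poly (pderiv (pderiv (rpoly B))) z \<le> (poly (pderiv (rpoly B)) z)\<^sup>2"
proof (induction B)
  case (add b B)
  let ?q = "poly (rpoly B) z" and ?q1 = "poly (pderiv (rpoly B)) z" and ?q2 = "poly (pderiv (pderiv (rpoly B))) z"
  have "(z - b)\<^sup>2 * (?q * ?q2) \<le> (z - b)\<^sup>2 * ?q1\<^sup>2"
    using add by (intro mult_left_mono) auto
  then have "(z - b) * ?q * (2 * ?q1 + (z - b) * ?q2) \<le> (?q + (z - b) * ?q1)\<^sup>2"
    by (simp add: power2_eq_square algebra_simps) (smt (verit) zero_le_square)
  then show ?case
    by (simp only: rpoly_add_mset pderiv_linear_mult pderiv_add poly_add poly_linear_mult)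
       (simp add: algebra_simps)
qed simp

text \<open>The weights \<open>c j * r ^ j\<close> are proportional to a distribution on \<open>{0..d}\<close> of some \<open>X\<close>. Since the
  ratios \<open>(j + 1) c (j + 1) / c j\<close> decrease, \<open>E (X (X - k)) \<le> (k + 1) E (X + 1 - k)\<close> for
  \<open>r = c k / c (k + 1)\<close>; this bounds \<open>E ((X - k)\<^sup>2)\<close> and hence \<open>(E X - k)\<^sup>2\<close>.\<close>
lemma log_concave_mean_bound:
  fixes c :: "nat \<Rightarrow> real"
  assumes k: "k < d" and pos: "\<And>j. j \<le> d \<Longrightarrow> c j > 0" and zero: "c (Suc d) = 0"
    and lc: "\<And>j. j < d \<Longrightarrow> real (Suc (Suc j)) * c (Suc (Suc j)) * c j \<le> real (Suc j) * (c (Suc j))\<^sup>2"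
  defines "r \<equiv> c k / c (Suc k)"
  defines "S0 \<equiv> \<Sum>j\<le>d. c j * r ^ j" and "S1 \<equiv> \<Sum>j\<le>d. real j * (c j * r ^ j)"
  shows "(S1 - real k * S0)\<^sup>2 \<le> real (Suc d) * S0\<^sup>2"
proof -
  define p where "p j = c j * r ^ j" for j
  define g where "g j = real (Suc j) * c (Suc j) / c j" for j
  have r: "r > 0" unfolding r_def using pos[of k] pos[of "Suc k"] k by auto
  have p0: "p j \<ge> 0" if "j \<le> d" for j using pos[OF that] r by (simp add: p_def)
  have gdec: "g (Suc j) \<le> g j" if "j < d" for j
    using lc[OF that] pos[of j] pos[of "Suc j"] that
    by (simp add: g_def divide_simps power2_eq_square mult_ac del: of_nat_Suc)
  have gmono: "i \<le> j \<Longrightarrow> j \<le> d \<Longrightarrow> g j \<le> g i" for i j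
  proof (induction j)
    case (Suc j)
    then show ?case using gdec[of j] by (cases "i = Suc j") auto
  qed simp
  have rg: "r * g k = real (Suc k)"
    using pos[of k] pos[of "Suc k"] k by (simp add: r_def g_def)
  \<comment> \<open>The choice of \<open>r\<close> makes \<open>r * g k\<close> equal to k + 1. As
    \<open>g\<close> decreases, \<open>r * g j - (k + 1)\<close> and \<open>j + 1 - k\<close> never
    have the same strict sign, whichever side of k the index lies on.\<close>
  have step: "real (Suc j) * (real (Suc j) - real k) * p (Suc j) \<le> real (Suc k) * ((real (Suc j) - real k) * p j)"
    if j: "j \<le> d" for j
  proof -
    have e: "real (Suc j) * p (Suc j) = r * g j * p j"
      using pos[OF j] by (simp add: p_def g_def field_simps)
    have "(r * g j) * (real (Suc j) - real k) \<le> real (Suc k) * (real (Suc j) - real k)"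
    proof (cases "k \<le> j")
      case True
      then have "r * g j \<le> real (Suc k)" unfolding rg[symmetric] using gmono[OF True j] r by simp
      then show ?thesis using True by (intro mult_right_mono) auto
    next
      case False
      then have "r * g j \<ge> real (Suc k)" unfolding rg[symmetric] using gmono[of j k] k r by simp
      then show ?thesis using False by (intro mult_right_mono_neg) auto
    qed
    then have "(r * g j) * (real (Suc j) - real k) * p j \<le> real (Suc k) * (real (Suc j) - real k) * p j"
      using p0[OF j] by (rule mult_right_mono)
    moreover have "real (Suc j) * (real (Suc j) - real k) * p (Suc j) = (r * g j) * (real (Suc j) - real k) * p j"
      using e by (simp only: mult_ac) (metis mult.commute mult.left_commute)
    ultimately show ?thesis by (simp only: mult.assoc)
  qed
  \<comment> \<open>The index shift loses nothing: the added top term vanishes by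
    \<open>c (Suc d) = 0\<close>, and the term j = 0 by its factor j.\<close>
  have "(\<Sum>j\<le>d. real j * (real j - real k) * p j) = (\<Sum>j\<le>Suc d. real j * (real j - real k) * p j)"
    using zero by (simp add: p_def)
  also have "\<dots> = (\<Sum>j\<le>d. real (Suc j) * (real (Suc j) - real k) * p (Suc j))"
    by (subst sum.atMost_Suc_shift) simp
  also have "\<dots> \<le> (\<Sum>j\<le>d. real (Suc k) * ((real (Suc j) - real k) * p j))"
    by (rule sum_mono) (use step in auto)
  also have "\<dots> = real (Suc k) * (S1 + S0 - real k * S0)"
    unfolding S0_def S1_def p_def[symmetric]
    by (simp add: sum_distrib_left sum.distrib[symmetric] sum_subtractf[symmetric] algebra_simps)
  finally have 1: "(\<Sum>j\<le>d. real j * (real j - real k) * p j) \<le> real (Suc k) * (S1 + S0 - real k * S0)" .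
  have "(\<Sum>j\<le>d. (real j - real k)\<^sup>2 * p j) =
      (\<Sum>j\<le>d. real j * (real j - real k) * p j) - real k * (S1 - real k * S0)"
    unfolding S0_def S1_def p_def[symmetric]
    by (simp add: sum_distrib_left sum_subtractf[symmetric] algebra_simps power2_eq_square)
  with 1 have 2: "(\<Sum>j\<le>d. (real j - real k)\<^sup>2 * p j) \<le> S1 + S0"
    by (simp add: algebra_simps)
  have S0: "S0 \<ge> 0" unfolding S0_def p_def[symmetric] using p0 by (intro sum_nonneg) auto
  have "S1 \<le> real d * S0"
    unfolding S0_def S1_def p_def[symmetric] sum_distrib_left
    using p0 by (intro sum_mono mult_right_mono) auto
  with 2 have 3: "(\<Sum>j\<le>d. (real j - real k)\<^sup>2 * p j) \<le> real (Suc d) * S0"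
    by (simp add: algebra_simps)
  \<comment> \<open>The weight is split into two square roots so that Cauchy-Schwarz separates the
    second moment about k from the total mass.\<close>
  have "(S1 - real k * S0) = (\<Sum>j\<le>d. (real j - real k) * sqrt (p j) * sqrt (p j))"
    unfolding S0_def S1_def p_def[symmetric] sum_distrib_left sum_subtractf[symmetric]
    using p0 by (intro sum.cong) (auto simp: algebra_simps simp flip: real_sqrt_mult)
  then have "(S1 - real k * S0)\<^sup>2 \<le> (\<Sum>j\<le>d. ((real j - real k) * sqrt (p j))\<^sup>2) * (\<Sum>j\<le>d. (sqrt (p j))\<^sup>2)"
    by (simp only: Cauchy_Schwarz_ineq_sum)
  also have "(\<Sum>j\<le>d. ((real j - real k) * sqrt (p j))\<^sup>2) = (\<Sum>j\<le>d. (real j - real k)\<^sup>2 * p j)"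
    using p0 by (intro sum.cong) (auto simp: power_mult_distrib)
  also have "(\<Sum>j\<le>d. (sqrt (p j))\<^sup>2) = S0"
    unfolding S0_def p_def[symmetric] using p0 by (intro sum.cong) auto
  also have "(\<Sum>j\<le>d. (real j - real k)\<^sup>2 * p j) * S0 \<le> real (Suc d) * S0 * S0"
    using 3 S0 by (rule mult_right_mono)
  finally show ?thesis by (simp add: power2_eq_square mult.assoc)
qed

lemma poly_altdef_le:
  fixes p :: "real poly"
  assumes "degree p \<le> n"
  shows "poly p x = (\<Sum>i\<le>n. coeff p i * x ^ i)"
proof -
  have "poly p x = poly (\<Sum>i\<le>n. monom (coeff p i) i) x"
    by (simp only: poly_as_sum_of_monoms'[OF assms])
  then show ?thesis by (simp add: poly_sum poly_monom)
qed

lemma taylor_coeff: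
  fixes p :: "real poly"
  shows "fact j * coeff (pcompose p [:z, 1:]) j = poly ((pderiv ^^ j) p) z"
proof -
  have "(pderiv ^^ j) (pcompose p [:z, 1:]) = pcompose ((pderiv ^^ j) p) [:z, 1:]" for j
    by (induction j) (simp_all add: pderiv_pcompose pderiv_pCons)
  then have "coeff ((pderiv ^^ j) (pcompose p [:z, 1:])) 0 = poly ((pderiv ^^ j) p) z"
    by (simp add: poly_0_coeff_0[symmetric] poly_pcompose)
  then show ?thesis by (simp add: coeff_higher_pderiv pochhammer_fact)
qed

text \<open>Applies \<open>log_concave_mean_bound\<close> to the Taylor coefficients
  \<open>c j\<close> of \<open>rpoly A\<close> at z. Higher derivatives keep their roots below z,
  which makes the \<open>c j\<close> positive, and Laguerre's inequality for them is the required
  log-concavity. The square root of the degree is negligible after division by the degree. Since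
  \<open>B\<close> is nonempty, k is smaller than the degree and c (k + 1) is positive.\<close>

lemma derivative_roots_estimate:
  fixes A B :: "real multiset"
  assumes sz: "size A = Suc n + k" "size B = Suc n" and A: "set_mset A \<subseteq> {l..u}" and B: "set_mset B \<subseteq> {l..u}"
    and D: "(pderiv ^^ k) (rpoly A) = smult b (rpoly B)" "b > 0" and z: "z > u"
  defines "r \<equiv> real (Suc k) / (\<Sum>y\<in>#B. 1 / (z - y))"
  shows "r > 0" "\<bar>(\<Sum>x\<in>#A. r / (z + r - x)) - real k\<bar> \<le> sqrt (real (Suc (size A)))"
proof -
  define Q where "Q = pcompose (rpoly A) [:z, 1:]"
  define c where "c = coeff Q"
  define d where "d = size A"
  have k: "k < d" using sz by (simp add: d_def)
  have degQ: "degree Q = d" by (simp add: Q_def d_def degree_pcompose)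
  have less: "\<And>C x. set_mset C \<subseteq> {l..u} \<Longrightarrow> x \<in># C \<Longrightarrow> x < z" using z by fastforce
  have cf: "fact j * c j = poly ((pderiv ^^ j) (rpoly A)) z" for j
    unfolding c_def Q_def by (rule taylor_coeff)
  have root: "\<exists>C a. set_mset C \<subseteq> {l..u} \<and> a > 0 \<and> (pderiv ^^ j) (rpoly A) = smult a (rpoly C)" if "j \<le> d" for j
    using higher_pderiv_rpoly[of A "d - j" j l u] A that unfolding d_def by (metis le_add_diff_inverse2)
  have pos: "c j > 0" if j: "j \<le> d" for j
  proof -
    obtain C a where "set_mset C \<subseteq> {l..u}" "a > 0" "(pderiv ^^ j) (rpoly A) = smult a (rpoly C)"
      using root[OF j] by auto
    then have "fact j * c j > 0" using poly_rpoly_pos[of C z] less[of C] by (simp add: cf)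
    then show ?thesis by (simp add: zero_less_mult_iff)
  qed
  have zero: "c (Suc d) = 0" unfolding c_def by (rule coeff_eq_0) (simp add: degQ)
  have lc: "real (Suc (Suc j)) * c (Suc (Suc j)) * c j \<le> real (Suc j) * (c (Suc j))\<^sup>2" if j: "j < d" for j
  proof -
    obtain C a where C: "set_mset C \<subseteq> {l..u}" "a > 0" "(pderiv ^^ j) (rpoly A) = smult a (rpoly C)"
      using root[of j] j by auto
    have "a\<^sup>2 * (poly (rpoly C) z * poly (pderiv (pderiv (rpoly C))) z) \<le> a\<^sup>2 * (poly (pderiv (rpoly C)) z)\<^sup>2"
      by (intro mult_left_mono rpoly_log_concave) auto
    then have "(fact j * c j) * (fact (Suc (Suc j)) * c (Suc (Suc j))) \<le> (fact (Suc j) * c (Suc j))\<^sup>2"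
      unfolding cf by (simp add: C(3) pderiv_smult power2_eq_square mult_ac)
    then have "((fact j)\<^sup>2 * real (Suc j)) * (real (Suc (Suc j)) * c (Suc (Suc j)) * c j) \<le>
        ((fact j)\<^sup>2 * real (Suc j)) * (real (Suc j) * (c (Suc j))\<^sup>2)"
      by (simp add: power2_eq_square mult_ac del: of_nat_Suc)
    then show ?thesis by (subst (asm) mult_le_cancel_left_pos) auto
  qed
  have Bz: "z \<notin># B" using less[OF B] by auto
  have "poly ((pderiv ^^ Suc k) (rpoly A)) z = poly ((pderiv ^^ k) (rpoly A)) z * (\<Sum>y\<in>#B. 1 / (z - y))"
    using poly_pderiv_rpoly[OF Bz] by (simp add: D pderiv_smult)
  then have "fact (Suc k) * c (Suc k) = fact k * c k * (\<Sum>y\<in>#B. 1 / (z - y))" by (simp only: cf)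
  \<comment> \<open>Differentiating the k-th derivative once more gives (k + 1) c (k + 1) / c k as
    its logarithmic derivative at z. This is the origin of \<open>Suc k\<close> in \<open>r\<close>,
    although the mean is compared with k.\<close>
  then have ck: "real (Suc k) * c (Suc k) = c k * (\<Sum>y\<in>#B. 1 / (z - y))"
    by (simp add: mult_ac del: of_nat_Suc)
  moreover have "c (Suc k) > 0" "c k > 0" using pos k by auto
  ultimately have sB: "(\<Sum>y\<in>#B. 1 / (z - y)) = real (Suc k) * c (Suc k) / c k" by (simp add: field_simps)
  have r: "r = c k / c (Suc k)" unfolding r_def sB by simp
  show r0: "r > 0" unfolding r using \<open>c (Suc k) > 0\<close> \<open>c k > 0\<close> by simp
  have S0: "(\<Sum>j\<le>d. c j * r ^ j) = poly (rpoly A) (z + r)"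
    using poly_altdef_le[of Q d r] degQ by (simp add: c_def Q_def poly_pcompose)
  have "degree (pCons 0 (pderiv Q)) \<le> d"
    using k degQ by (simp add: degree_pCons_eq_if degree_pderiv)
  moreover have "coeff (pCons 0 (pderiv Q)) j = real j * c j" for j
    by (cases j) (simp_all add: coeff_pderiv c_def)
  ultimately have S1: "(\<Sum>j\<le>d. real j * (c j * r ^ j)) = r * poly (pderiv (rpoly A)) (z + r)"
    using poly_altdef_le[of "pCons 0 (pderiv Q)" d r]
    by (simp add: Q_def poly_pcompose pderiv_pcompose pderiv_pCons mult.assoc)
  have "z + r \<notin># A" using less[OF A] r0 by fastforce
  then have S1': "(\<Sum>j\<le>d. real j * (c j * r ^ j)) = (\<Sum>x\<in>#A. r / (z + r - x)) * poly (rpoly A) (z + r)"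
  proof -
    have "r * (\<Sum>x\<in>#A. 1 / (z + r - x)) = (\<Sum>x\<in>#A. r / (z + r - x))"
      by (simp add: sum_mset_distrib_left)
    then show ?thesis unfolding S1 poly_pderiv_rpoly[OF \<open>z + r \<notin># A\<close>] by (simp add: mult_ac)
  qed
  have Apos: "poly (rpoly A) (z + r) > 0"
    by (rule poly_rpoly_pos) (use less[OF A] r0 in fastforce)
  let ?m = "\<Sum>x\<in>#A. r / (z + r - x)"
  have "((?m - real k) * poly (rpoly A) (z + r))\<^sup>2 \<le> real (Suc d) * (poly (rpoly A) (z + r))\<^sup>2"
    using log_concave_mean_bound[OF k pos zero lc] unfolding r[symmetric] S0 S1'
    by (simp add: algebra_simps)
  then have "(?m - real k)\<^sup>2 \<le> real (Suc d)"
    using Apos by (simp add: power_mult_distrib)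
  then show "\<bar>?m - real k\<bar> \<le> sqrt (real (Suc (size A)))"
    unfolding d_def by (simp add: real_le_rsqrt)
qed

subsection \<open>Cauchy transforms and free compression\<close>

definition prob_on :: "real \<Rightarrow> real measure \<Rightarrow> bool" where
  "prob_on m \<rho> \<longleftrightarrow> real_distribution \<rho> \<and> (AE x in \<rho>. x \<in> {0..m})"

definition cauchy_tr :: "real measure \<Rightarrow> real \<Rightarrow> real" where
  "cauchy_tr \<rho> z = (\<integral>x. 1 / (z - x) \<partial>\<rho>)"

definition emp :: "real multiset \<Rightarrow> real measure" where
  "emp A = distr (measure_pmf (pmf_of_multiset A)) borel (\<lambda>x. x)"

lemma prob_on_AE:
  assumes "prob_on m \<rho>" "\<And>x. x \<in> {0..m} \<Longrightarrow> P x"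
  shows "AE x in \<rho>. P x"
proof -
  have "AE x in \<rho>. x \<in> {0..m}" using assms(1) by (simp add: prob_on_def)
  then show ?thesis by (rule eventually_mono) (rule assms(2))
qed

lemma prob_on_integrable:
  fixes f :: "real \<Rightarrow> 'a::{banach, second_countable_topology}"
  assumes \<rho>: "prob_on m \<rho>" and f: "f \<in> borel_measurable borel" and B: "\<And>x. x \<in> {0..m} \<Longrightarrow> norm (f x) \<le> B"
  shows "integrable \<rho> f"
proof -
  interpret real_distribution \<rho> using \<rho> by (simp add: prob_on_def)
  show ?thesis
    using f B by (intro integrable_const_bound[where B = B] prob_on_AE[OF \<rho>]) auto
qed

lemma sum_mset_count:
  fixes f :: "'a \<Rightarrow> real"
  assumes "finite S" "set_mset A \<subseteq> S"
  shows "(\<Sum>x\<in>#A. f x) = (\<Sum>x\<in>S. real (count A x) * f x)"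
  using assms(2)
proof (induction A)
  case (add a A)
  have "(\<Sum>x\<in>S. real (count (add_mset a A) x) * f x) = (\<Sum>x\<in>S. (if x = a then f x else 0) + real (count A x) * f x)"
    by (intro sum.cong) (auto simp: algebra_simps)
  then show ?case using add assms(1) by (simp add: sum.distrib sum.delta)
qed simp

lemma integral_emp:
  fixes f :: "real \<Rightarrow> real"
  assumes "A \<noteq> {#}" "f \<in> borel_measurable borel"
  shows "integral\<^sup>L (emp A) f = (\<Sum>x\<in>#A. f x) / size A"
proof -
  have "integral\<^sup>L (emp A) f = (\<integral>x. f x \<partial>measure_pmf (pmf_of_multiset A))"
    unfolding emp_def using assms by (subst integral_distr) auto
  also have "\<dots> = (\<Sum>x\<in>set_mset A. f x * pmf (pmf_of_multiset A) x)"
    by (rule integral_measure_pmf_real) (use assms in auto)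
  also have "\<dots> = (\<Sum>x\<in>#A. f x) / size A"
    using assms by (simp add: sum_mset_count[of "set_mset A"] sum_divide_distrib mult.commute)
  finally show ?thesis .
qed

lemma cauchy_tr_emp: "A \<noteq> {#} \<Longrightarrow> cauchy_tr (emp A) z = (\<Sum>x\<in>#A. 1 / (z - x)) / size A"
  unfolding cauchy_tr_def by (rule integral_emp) auto

lemma prob_on_emp:
  assumes "A \<noteq> {#}" "set_mset A \<subseteq> {0..m}"
  shows "prob_on m (emp A)"
  unfolding prob_on_def
proof
  show "real_distribution (emp A)" unfolding emp_def
    by (rule prob_space.real_distribution_distr) (auto simp: measure_pmf.prob_space_axioms)
  show "AE x in emp A. x \<in> {0..m}"
    unfolding emp_def by (subst AE_distr_iff) (use assms in \<open>auto simp: AE_measure_pmf_iff\<close>)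
qed

lemma prob_on_integral_mono:
  fixes f g :: "real \<Rightarrow> real"
  assumes \<rho>: "prob_on m \<rho>" and "f \<in> borel_measurable borel" "g \<in> borel_measurable borel"
    and "\<And>x. x \<in> {0..m} \<Longrightarrow> norm (f x) \<le> B" "\<And>x. x \<in> {0..m} \<Longrightarrow> norm (g x) \<le> C"
    and le: "\<And>x. x \<in> {0..m} \<Longrightarrow> f x \<le> g x"
  shows "integral\<^sup>L \<rho> f \<le> integral\<^sup>L \<rho> g"
proof (rule integral_mono_AE)
  show "AE x in \<rho>. f x \<le> g x"
    by (rule prob_on_AE[OF \<rho> le])
  show "integrable \<rho> f" "integrable \<rho> g"
    by (rule prob_on_integrable[OF \<rho> assms(2,4)], assumption, rule prob_on_integrable[OF \<rho> assms(3,5)], assumption)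
qed

lemma prob_on_integral_const:
  fixes c :: real
  assumes "prob_on m \<rho>"
  shows "(\<integral>x. c \<partial>\<rho>) = c"
proof -
  interpret real_distribution \<rho> using assms by (simp add: prob_on_def)
  show ?thesis using prob_space by simp
qed

lemma kernel_bounded: "x \<in> {0..m} \<Longrightarrow> z > m \<Longrightarrow> norm (1 / (z - x)) \<le> 1 / (z - (m::real))"
  by (auto intro!: divide_left_mono)

lemma kernel_integrable:
  assumes "prob_on m \<rho>" "z > m"
  shows "integrable \<rho> (\<lambda>x. 1 / (z - x))"
  by (rule prob_on_integrable[OF assms(1)]) (use kernel_bounded assms in auto)

lemma cauchy_tr_upper:
  assumes "prob_on m \<rho>" "z > m"
  shows "cauchy_tr \<rho> z \<le> 1 / (z - m)"
proof -
  have "cauchy_tr \<rho> z \<le> (\<integral>x. 1 / (z - m) \<partial>\<rho>)"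
    unfolding cauchy_tr_def
    by (rule prob_on_integral_mono[OF assms(1), where B = "1 / (z - m)" and C = "1 / (z - m)"])
       (use assms in \<open>auto simp: kernel_bounded intro!: divide_left_mono\<close>)
  then show ?thesis unfolding prob_on_integral_const[OF assms(1)] .
qed

lemma cauchy_tr_lower:
  assumes "prob_on m \<rho>" "z > m" "m \<ge> 0"
  shows "1 / z \<le> cauchy_tr \<rho> z"
proof -
  have "(\<integral>x. 1 / z \<partial>\<rho>) \<le> cauchy_tr \<rho> z"
    unfolding cauchy_tr_def
    by (rule prob_on_integral_mono[OF assms(1), where B = "\<bar>1 / z\<bar>" and C = "1 / (z - m)"])
       (use assms in \<open>auto simp: kernel_bounded intro!: divide_left_mono\<close>)
  then show ?thesis unfolding prob_on_integral_const[OF assms(1)] .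
qed

lemma cauchy_tr_pos: "prob_on m \<rho> \<Longrightarrow> z > m \<Longrightarrow> m \<ge> 0 \<Longrightarrow> cauchy_tr \<rho> z > 0"
  using cauchy_tr_lower[of m \<rho> z] by (smt (verit) divide_pos_pos)

lemma cauchy_tr_diff:
  assumes \<rho>: "prob_on m \<rho>" and "z1 > m" "z2 \<ge> z1"
  shows "\<bar>cauchy_tr \<rho> z1 - cauchy_tr \<rho> z2\<bar> \<le> (z2 - z1) / (z1 - m)\<^sup>2"
proof -
  have eq: "1 / (z1 - x) - 1 / (z2 - x) = (z2 - z1) / ((z1 - x) * (z2 - x))" if "x \<in> {0..m}" for x
    using assms that by (simp add: field_simps)
  have b: "norm (1 / (z1 - x) - 1 / (z2 - x)) \<le> (z2 - z1) / (z1 - m)\<^sup>2" if x: "x \<in> {0..m}" for x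
  proof -
    have "(z1 - m) * (z1 - m) \<le> (z1 - x) * (z2 - x)" using x assms by (intro mult_mono) auto
    moreover have "(z1 - m) * (z1 - m) > 0" using assms by simp
    ultimately show ?thesis unfolding eq[OF x] power2_eq_square using assms x
      by (auto simp: abs_mult intro!: divide_left_mono mult_pos_pos)
  qed
  have "cauchy_tr \<rho> z1 - cauchy_tr \<rho> z2 = (\<integral>x. 1 / (z1 - x) - 1 / (z2 - x) \<partial>\<rho>)"
    unfolding cauchy_tr_def
    by (rule Bochner_Integration.integral_diff[symmetric]) (use kernel_integrable[OF \<rho>] assms in auto)
  also have "norm \<dots> \<le> (\<integral>x. norm (1 / (z1 - x) - 1 / (z2 - x)) \<partial>\<rho>)"
    by (rule integral_norm_bound)
  also have "\<dots> \<le> (\<integral>x. (z2 - z1) / (z1 - m)\<^sup>2 \<partial>\<rho>)"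
    by (rule prob_on_integral_mono[OF \<rho>, where B = "(z2 - z1) / (z1 - m)\<^sup>2" and C = "(z2 - z1) / (z1 - m)\<^sup>2"])
       (use b assms in auto)
  also have "\<dots> = (z2 - z1) / (z1 - m)\<^sup>2" by (rule prob_on_integral_const[OF \<rho>])
  finally show ?thesis by simp
qed

lemma isCont_cauchy_tr:
  assumes \<rho>: "prob_on m \<rho>" and z: "z > m"
  shows "isCont (cauchy_tr \<rho>) z"
proof -
  define d where "d = (z - m) / 2"
  have d: "d > 0" using z by (simp add: d_def)
  have bound: "\<bar>cauchy_tr \<rho> y - cauchy_tr \<rho> z\<bar> \<le> \<bar>y - z\<bar> / d\<^sup>2" if y: "y > m + d" for y
  proof -
    have zd: "z \<ge> m + d" using z by (simp add: d_def field_simps)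
    have 1: "\<bar>cauchy_tr \<rho> a - cauchy_tr \<rho> b\<bar> \<le> (b - a) / d\<^sup>2" if "a \<ge> m + d" "b \<ge> a" for a b
    proof -
      have "d\<^sup>2 \<le> (a - m)\<^sup>2" using that d by (intro power_mono) auto
      then have "(b - a) / (a - m)\<^sup>2 \<le> (b - a) / d\<^sup>2" using that d by (intro divide_left_mono) auto
      then show ?thesis using cauchy_tr_diff[OF \<rho>, of a b] that d by linarith
    qed
    show ?thesis
      using 1[of y z] 1[of z y] y zd by (cases "y \<le> z") (auto simp: abs_minus_commute)
  qed
  have "((\<lambda>y. \<bar>cauchy_tr \<rho> y - cauchy_tr \<rho> z\<bar>) \<longlongrightarrow> 0) (at z)"
  proof (rule tendsto_sandwich[where f = "\<lambda>_. 0" and h = "\<lambda>y. \<bar>y - z\<bar> / d\<^sup>2"])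
    have "eventually (\<lambda>y. y > m + d) (at z)"
      by (rule order_tendstoD) (use z in \<open>auto simp: d_def field_simps\<close>)
    then show "eventually (\<lambda>y. \<bar>cauchy_tr \<rho> y - cauchy_tr \<rho> z\<bar> \<le> \<bar>y - z\<bar> / d\<^sup>2) (at z)"
      by eventually_elim (rule bound)
    have "((\<lambda>y. \<bar>y - z\<bar> / d\<^sup>2) \<longlongrightarrow> \<bar>z - z\<bar> / d\<^sup>2) (at z)"
      by (intro tendsto_intros) (use d in auto)
    then show "((\<lambda>y. \<bar>y - z\<bar> / d\<^sup>2) \<longlongrightarrow> 0) (at z)" by simp
  qed auto
  then show ?thesis unfolding isCont_def tendsto_rabs_zero_iff by (simp add: LIM_zero_iff)
qed

lemma cauchy_tr_strict_mono:
  assumes \<rho>: "prob_on m \<rho>" and z: "z > m" and m: "m \<ge> 0" and r: "0 < r1" "r1 < r2"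
  shows "r1 * cauchy_tr \<rho> (z + r1) < r2 * cauchy_tr \<rho> (z + r2)"
proof -
  \<comment> \<open>A lower bound, uniform in x, for the growth of r / (z + r - x) between
    \<open>r1\<close> and \<open>r2\<close>; it keeps the inequality strict after
    integration.\<close>
  define \<delta> where "\<delta> = (z - m) * (r2 - r1) / ((z + r1) * (z + r2))"
  have \<delta>: "\<delta> > 0" using z m r by (simp add: \<delta>_def)
  have b: "norm (r / (z + r - x)) \<le> 1" if "x \<in> {0..m}" "r > 0" for x r
    using that z by (auto simp: divide_simps)
  have le: "\<delta> + r1 / (z + r1 - x) \<le> r2 / (z + r2 - x)" if x: "x \<in> {0..m}" for x
  proof -
    have "r2 / (z + r2 - x) - r1 / (z + r1 - x) = (z - x) * (r2 - r1) / ((z + r1 - x) * (z + r2 - x))"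
      using x z r by (simp add: field_simps)
    also have "\<dots> \<ge> \<delta>"
      unfolding \<delta>_def using x z r m by (intro frac_le mult_mono mult_nonneg_nonneg mult_pos_pos) auto
    finally show ?thesis by simp
  qed
  have int: "integrable \<rho> (\<lambda>x. r / (z + r - x))" if "r > 0" for r
    by (rule prob_on_integrable[OF \<rho>, where B = 1]) (use b that in auto)
  have eq: "r * cauchy_tr \<rho> (z + r) = (\<integral>x. r / (z + r - x) \<partial>\<rho>)" for r
    unfolding cauchy_tr_def by (subst integral_mult_right_zero[symmetric]) simp
  interpret real_distribution \<rho> using \<rho> by (simp add: prob_on_def)
  have "\<delta> + r1 * cauchy_tr \<rho> (z + r1) = (\<integral>x. \<delta> + r1 / (z + r1 - x) \<partial>\<rho>)"
    unfolding eq using int[of r1] r prob_space by simp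
  also have "\<dots> \<le> (\<integral>x. r2 / (z + r2 - x) \<partial>\<rho>)"
  proof (rule prob_on_integral_mono[OF \<rho>, where B = "\<delta> + 1" and C = 1])
    fix x assume x: "x \<in> {0..m}"
    show "norm (\<delta> + r1 / (z + r1 - x)) \<le> \<delta> + 1"
      using b[OF x r(1)] \<delta> norm_triangle_ineq[of \<delta> "r1 / (z + r1 - x)"] by simp
  qed (use b le r in auto)
  finally show ?thesis using \<delta> unfolding eq by simp
qed

lemma cauchy_tr_level:
  assumes \<rho>: "prob_on m \<rho>" and z: "z > m" and m: "m \<ge> 0" and \<kappa>: "0 < \<kappa>" "\<kappa> < 1"
  obtains r where "r > 0" "r * cauchy_tr \<rho> (z + r) = \<kappa>"
proof -
  \<comment> \<open>The endpoints come from 1 / y \<le> G(y) \<le> 1 / (y - m): the upper bound puts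
    the value at \<open>a\<close> below \<kappa>, and b / (z + b) \<ge> \<kappa> as soon as b \<ge>
    \<kappa> z / (1 - \<kappa>). The summand \<open>a\<close> in \<open>b\<close> secures a <
    b.\<close>
  define a where "a = \<kappa> * (z - m) / 2"
  define b where "b = \<kappa> * z / (1 - \<kappa>) + a"
  have a: "a > 0" using \<kappa> z by (simp add: a_def)
  have b: "b > a" unfolding b_def using \<kappa> z m by simp
  have "a * cauchy_tr \<rho> (z + a) \<le> a * (1 / (z + a - m))"
    using a z by (intro mult_left_mono cauchy_tr_upper[OF \<rho>]) auto
  also have "\<dots> \<le> a / (z - m)" using a z by (simp add: divide_left_mono)
  also have "\<dots> \<le> \<kappa>" using z \<kappa> by (simp add: a_def field_simps)
  finally have 1: "a * cauchy_tr \<rho> (z + a) \<le> \<kappa>" .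
  have "\<kappa> * z \<le> (1 - \<kappa>) * b" using \<kappa> a by (simp add: b_def distrib_left)
  then have "\<kappa> \<le> b * (1 / (z + b))" using a b z m by (simp add: field_simps)
  also have "\<dots> \<le> b * cauchy_tr \<rho> (z + b)"
    using a b z m by (intro mult_left_mono cauchy_tr_lower[OF \<rho>]) auto
  finally have 2: "\<kappa> \<le> b * cauchy_tr \<rho> (z + b)" .
  have "\<exists>r\<ge>a. r \<le> b \<and> r * cauchy_tr \<rho> (z + r) = \<kappa>"
  proof (rule IVT[where f = "\<lambda>r. r * cauchy_tr \<rho> (z + r)", OF 1 2])
    show "\<forall>x. a \<le> x \<and> x \<le> b \<longrightarrow> isCont (\<lambda>r. r * cauchy_tr \<rho> (z + r)) x"
    proof (intro allI impI)
      fix x assume "a \<le> x \<and> x \<le> b"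
      then have "isCont (cauchy_tr \<rho>) (z + x)" using a z by (intro isCont_cauchy_tr[OF \<rho>]) auto
      then have "isCont (\<lambda>r. cauchy_tr \<rho> (z + r)) x"
        by (intro isCont_o2[where g = "cauchy_tr \<rho>" and f = "\<lambda>r. z + r"]) auto
      then show "isCont (\<lambda>r. r * cauchy_tr \<rho> (z + r)) x"
        by (rule isCont_mult[OF continuous_ident])
    qed
  qed (use b in auto)
  then obtain r where "a \<le> r" "r * cauchy_tr \<rho> (z + r) = \<kappa>" by auto
  then show ?thesis using that[of r] a by auto
qed

text \<open>The invariant handed from layer to layer. The roots must lie in [0, m] itself and not
  merely converge to it, so that differentiation cannot move them past m; and convergence is
  required for every z > m, because the atom at m is read off near the edge.\<close>

definition root_approximable :: "real \<Rightarrow> real measure \<Rightarrow> bool" where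
  "root_approximable m \<rho> \<longleftrightarrow> prob_on m \<rho> \<and>
     (\<exists>A. (\<forall>n. size (A n) = Suc n \<and> set_mset (A n) \<subseteq> {0..m}) \<and>
       (\<forall>z>m. (\<lambda>n. cauchy_tr (emp (A n)) z) \<longlonglongrightarrow> cauchy_tr \<rho> z))"

lemma helly_prob_on:
  fixes \<mu> :: "nat \<Rightarrow> real measure"
  assumes \<mu>: "\<And>n. prob_on m (\<mu> n)" and m: "m \<ge> 0"
  obtains s \<rho> where "strict_mono s" "prob_on m \<rho>"
    "\<And>z. z > m \<Longrightarrow> (\<lambda>n. cauchy_tr (\<mu> (s n)) z) \<longlonglongrightarrow> cauchy_tr \<rho> z"
proof -
  have rd: "real_distribution (\<mu> n)" for n using \<mu> by (simp add: prob_on_def)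
  have "tight \<mu>"
    unfolding tight_def
  proof (intro conjI allI impI)
    fix e :: real assume "e > 0"
    \<comment> \<open>Tightness is stated with half-open intervals; starting at -1 keeps a possible
      atom at 0 inside.\<close>
    have "measure (\<mu> n) {-1<..m} = 1" for n
    proof -
      interpret real_distribution "\<mu> n" by (rule rd)
      have "AE x in \<mu> n. x \<in> {-1<..m}"
        by (rule prob_on_AE[OF \<mu>]) auto
      then show ?thesis by (subst prob_eq_1) auto
    qed
    then show "\<exists>a b. a < b \<and> (\<forall>n. 1 - e < measure (\<mu> n) {a<..b})"
      using m \<open>e > 0\<close> by (intro exI[of _ "-1"] exI[of _ m]) auto
  qed (rule rd)
  then obtain s \<rho> where s: "strict_mono s" and \<rho>: "real_distribution \<rho>" and w: "weak_conv_m (\<mu> \<circ> id \<circ> s) \<rho>"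
    using tight_imp_convergent_subsubsequence[of \<mu> id] by (auto simp: strict_mono_id)
  have conv: "(\<lambda>n. integral\<^sup>L (\<mu> (s n)) f) \<longlonglongrightarrow> integral\<^sup>L \<rho> f"
    if "\<And>x. isCont f x" "\<And>x. norm (f x) \<le> B" for f :: "real \<Rightarrow> real" and B
    using weak_conv_imp_integral_bdd_continuous_conv[of "\<mu> \<circ> id \<circ> s" \<rho> f B] rd \<rho> w that by simp
  interpret R: real_distribution \<rho> by (rule \<rho>)
  have ae: "AE x in \<rho>. x \<in> {0..m}"
  proof -
    \<comment> \<open>The distance to [0, m], cut off at 1: bounded and continuous, so its vanishing
      integrals pass to the limit and confine the limit measure to [0, m].\<close>
    define f where "f x = min 1 (max 0 (max (- x) (x - m)))" for x
    have fc: "isCont f x" for x unfolding f_def by (intro continuous_intros)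
    have fb: "norm (f x) \<le> 1" for x unfolding f_def by auto
    have f0: "f x \<ge> 0" for x unfolding f_def by auto
    have fm [measurable]: "f \<in> borel_measurable borel"
      unfolding f_def by measurable
    have "integral\<^sup>L (\<mu> (s n)) f = 0" for n
    proof -
      have "AE x in \<mu> (s n). f x = 0"
        by (rule prob_on_AE[OF \<mu>]) (auto simp: f_def)
      then show ?thesis by (rule integral_eq_zero_AE)
    qed
    then have "(\<lambda>n::nat. 0) \<longlonglongrightarrow> integral\<^sup>L \<rho> f" using conv[OF fc fb] by simp
    then have "integral\<^sup>L \<rho> f = 0" using LIMSEQ_unique tendsto_const by blast
    moreover have "integrable \<rho> f" using fb by (intro R.integrable_const_bound[where B = 1]) auto
    ultimately have "AE x in \<rho>. f x = 0" using f0 by (subst (asm) integral_nonneg_eq_0_iff_AE) auto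
    then show ?thesis
      by (rule AE_mp) (auto intro!: AE_I2 simp: f_def min_def max_def split: if_splits)
  qed
  have \<rho>': "prob_on m \<rho>" using \<rho> ae by (simp add: prob_on_def)
  have "(\<lambda>n. cauchy_tr (\<mu> (s n)) z) \<longlonglongrightarrow> cauchy_tr \<rho> z" if z: "z > m" for z
  proof -
    \<comment> \<open>Clamping x to [0, m] makes the Cauchy kernel bounded and continuous on the
      whole line without changing its integral against measures on [0, m].\<close>
    define g where "g x = 1 / (z - max 0 (min m x))" for x
    have nz: "z - max 0 (min m x) \<ge> z - m" for x using m z by auto
    have gc: "isCont g x" for x unfolding g_def
      using nz[of x] z by (intro continuous_intros) auto
    have gb: "norm (g x) \<le> 1 / (z - m)" for x
      unfolding g_def using nz[of x] z by (auto intro!: divide_left_mono)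
    have eq: "integral\<^sup>L \<tau> g = cauchy_tr \<tau> z" if \<tau>: "prob_on m \<tau>" for \<tau>
    proof -
      interpret T: real_distribution \<tau> using \<tau> by (simp add: prob_on_def)
      have [measurable]: "g \<in> borel_measurable borel" unfolding g_def by measurable
      have "AE x in \<tau>. g x = 1 / (z - x)"
        by (rule prob_on_AE[OF \<tau>]) (auto simp: g_def)
      then show ?thesis unfolding cauchy_tr_def by (intro integral_cong_AE) auto
    qed
    show ?thesis using conv[OF gc gb] by (simp add: eq[OF \<mu>] eq[OF \<rho>'])
  qed
  then show ?thesis using that[OF s \<rho>'] by blast
qed

section \<open>Free compression as a limit of repeated differentiation\<close>

lemma floor_ratio_tendsto:
  assumes "0 < \<kappa>"
  shows "(\<lambda>n. real (nat \<lfloor>\<kappa> * real (Suc n)\<rfloor>) / real (Suc n)) \<longlonglongrightarrow> \<kappa>"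
proof (rule tendsto_sandwich)
  have f: "real (nat \<lfloor>\<kappa> * real (Suc n)\<rfloor>) = of_int \<lfloor>\<kappa> * real (Suc n)\<rfloor>" for n
    using assms by (simp del: of_nat_Suc)
  show "\<forall>\<^sub>F n in sequentially. real (nat \<lfloor>\<kappa> * real (Suc n)\<rfloor>) / real (Suc n) \<le> \<kappa>"
    unfolding f by (intro always_eventually allI) (simp add: divide_simps del: of_nat_Suc)
  show "\<forall>\<^sub>F n in sequentially. \<kappa> - 1 / real (Suc n) \<le> real (nat \<lfloor>\<kappa> * real (Suc n)\<rfloor>) / real (Suc n)"
  proof (intro always_eventually allI)
    fix n
    have "\<kappa> * real (Suc n) - 1 \<le> of_int \<lfloor>\<kappa> * real (Suc n)\<rfloor>" by linarith
    then have "(\<kappa> * real (Suc n) - 1) / real (Suc n) \<le> of_int \<lfloor>\<kappa> * real (Suc n)\<rfloor> / real (Suc n)"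
      by (rule divide_right_mono) simp
    then show "\<kappa> - 1 / real (Suc n) \<le> real (nat \<lfloor>\<kappa> * real (Suc n)\<rfloor>) / real (Suc n)"
      unfolding f by (simp add: diff_divide_distrib del: of_nat_Suc)
  qed
  have "(\<lambda>n. \<kappa> - inverse (real (Suc n))) \<longlonglongrightarrow> \<kappa> - 0"
    by (intro tendsto_intros LIMSEQ_inverse_real_of_nat)
  then show "(\<lambda>n. \<kappa> - 1 / real (Suc n)) \<longlonglongrightarrow> \<kappa>" by (simp add: inverse_eq_divide)
qed auto

text \<open>Free compression by a projection of trace \<open>1 - \<kappa>\<close>, realised as the limit of taking the
  proportion \<open>\<kappa>\<close> of derivatives of polynomials whose root distributions approximate \<open>\<mu>\<close>.\<close>
lemma compression_exists:
  assumes \<mu>: "root_approximable m \<mu>" and m: "m \<ge> 0" and \<kappa>: "0 < \<kappa>" "\<kappa> < 1"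
  obtains \<rho> where "root_approximable m \<rho>"
    "\<And>z r. z > m \<Longrightarrow> r > 0 \<Longrightarrow> r * cauchy_tr \<mu> (z + r) = \<kappa> \<Longrightarrow> cauchy_tr \<rho> z = \<kappa> / z + \<kappa> / r"
proof -
  have pm: "prob_on m \<mu>" using \<mu> by (simp add: root_approximable_def)
  obtain A where A: "\<And>n. size (A n) = Suc n" "\<And>n. set_mset (A n) \<subseteq> {0..m}"
    and Aconv: "\<And>z. z > m \<Longrightarrow> (\<lambda>n. cauchy_tr (emp (A n)) z) \<longlonglongrightarrow> cauchy_tr \<mu> z"
    using \<mu> unfolding root_approximable_def by metis
  define k where "k n = nat \<lfloor>\<kappa> * real (Suc n)\<rfloor>" for n
  have kn: "k n \<le> n" for n
  proof -
    have "\<kappa> * real (Suc n) < real (Suc n)" using \<kappa> by simp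
    then have "\<lfloor>\<kappa> * real (Suc n)\<rfloor> < int (Suc n)" by linarith
    then show ?thesis unfolding k_def by linarith
  qed
  have klim: "(\<lambda>n. real (k n) / real (Suc n)) \<longlonglongrightarrow> \<kappa>"
    unfolding k_def by (rule floor_ratio_tendsto[OF \<kappa>(1)])
  have "\<exists>B b. size B = Suc (n - k n) \<and> set_mset B \<subseteq> {0..m} \<and> b > 0 \<and> (pderiv ^^ k n) (rpoly (A n)) = smult b (rpoly B)" for n
  proof -
    have "size (A n) = Suc (n - k n) + k n" using A kn[of n] by simp
    from higher_pderiv_rpoly[OF this A(2)] show ?thesis by metis
  qed
  then obtain B b where B: "\<And>n. size (B n) = Suc (n - k n)" "\<And>n. set_mset (B n) \<subseteq> {0..m}" "\<And>n. b n > 0"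
    "\<And>n. (pderiv ^^ k n) (rpoly (A n)) = smult (b n) (rpoly (B n))"
    by metis
  \<comment> \<open>The zeros restore the size \<open>Suc n\<close> lost by differentiation, so that
    \<open>C\<close> can serve again as an approximating sequence for the next layer.\<close>
  define C where "C n = B n + replicate_mset (k n) 0" for n
  have C: "size (C n) = Suc n" "set_mset (C n) \<subseteq> {0..m}" for n
    using B(1)[of n] B(2)[of n] kn[of n] m by (auto simp: C_def)
  have ne: "A n \<noteq> {#}" "C n \<noteq> {#}" for n using A(1)[of n] C(1)[of n] by auto
  have pA: "prob_on m (emp (A n))" and pC: "prob_on m (emp (C n))" for n
    using prob_on_emp ne A C by auto
  have lim: "(\<lambda>n. cauchy_tr (emp (C n)) z) \<longlonglongrightarrow> \<kappa> / z + \<kappa> / r"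
    if z: "z > m" and r: "r > 0" and level: "r * cauchy_tr \<mu> (z + r) = \<kappa>" for z r
  proof -
    define R where "R n = real (Suc (k n)) / (\<Sum>y\<in>#B n. 1 / (z - y))" for n
    have R0: "R n > 0" and est: "\<bar>(\<Sum>x\<in>#A n. R n / (z + R n - x)) - real (k n)\<bar> \<le> sqrt (real (Suc (size (A n))))" for n
    proof -
      have sz: "size (A n) = Suc (n - k n) + k n" using A kn[of n] by simp
      show "R n > 0" "\<bar>(\<Sum>x\<in>#A n. R n / (z + R n - x)) - real (k n)\<bar> \<le> sqrt (real (Suc (size (A n))))"
        using derivative_roots_estimate[OF sz B(1) A(2) B(2) B(4) B(3) z] unfolding R_def by auto
    qed
    have sumA: "(\<Sum>x\<in>#A n. R n / (z + R n - x)) = real (Suc n) * (R n * cauchy_tr (emp (A n)) (z + R n))" for n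
    proof -
      have "(\<Sum>x\<in>#A n. R n / (z + R n - x)) = R n * (\<Sum>x\<in>#A n. 1 / (z + R n - x))"
        by (simp add: sum_mset_distrib_left)
      then show ?thesis using ne[of n] A(1)[of n] by (simp add: cauchy_tr_emp del: of_nat_Suc)
    qed
    have est': "\<bar>R n * cauchy_tr (emp (A n)) (z + R n) - real (k n) / real (Suc n)\<bar> \<le> sqrt (real (Suc (Suc n))) / real (Suc n)" for n
    proof -
      have "\<bar>real (Suc n) * (R n * cauchy_tr (emp (A n)) (z + R n) - real (k n) / real (Suc n))\<bar> \<le> sqrt (real (Suc (Suc n)))"
        using est[of n] unfolding sumA A(1) by (simp add: right_diff_distrib del: of_nat_Suc)
      then have "real (Suc n) * \<bar>R n * cauchy_tr (emp (A n)) (z + R n) - real (k n) / real (Suc n)\<bar> \<le> sqrt (real (Suc (Suc n)))"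
        by (simp add: abs_mult del: of_nat_Suc)
      then show ?thesis by (simp add: field_simps del: of_nat_Suc)
    qed
    have "(\<lambda>n. sqrt (real (Suc (Suc n))) / real (Suc n)) \<longlonglongrightarrow> 0" by real_asymp
    then have "(\<lambda>n. R n * cauchy_tr (emp (A n)) (z + R n) - real (k n) / real (Suc n)) \<longlonglongrightarrow> 0"
      by (rule Lim_null_comparison[rotated]) (use est' in auto)
    from tendsto_add[OF this klim]
    have \<Phi>: "(\<lambda>n. R n * cauchy_tr (emp (A n)) (z + R n)) \<longlonglongrightarrow> \<kappa>" by simp
    \<comment> \<open>Convergence of the Cauchy transforms is only pointwise, whereas z + R n moves.
      Strict monotonicity of s G(z + s) in s circumvents this: the values at \<open>R n\<close> tend
      to \<kappa>, those at a fixed point \<open>a\<close> tend to something strictly below or above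
      \<kappa>, and this decides on which side of \<open>a\<close> the point \<open>R n\<close>
      lies.\<close>
    have Rlim: "R \<longlonglongrightarrow> r"
    proof (rule order_tendstoI)
      fix a assume a: "a < r"
      show "\<forall>\<^sub>F n in sequentially. a < R n"
      proof (cases "a > 0")
        case True
        have "a * cauchy_tr \<mu> (z + a) < \<kappa>"
          using cauchy_tr_strict_mono[OF pm z m True a] level by simp
        moreover have "(\<lambda>n. R n * cauchy_tr (emp (A n)) (z + R n) - a * cauchy_tr (emp (A n)) (z + a)) \<longlonglongrightarrow> \<kappa> - a * cauchy_tr \<mu> (z + a)"
          using True z by (intro tendsto_intros \<Phi> Aconv) auto
        ultimately have "\<forall>\<^sub>F n in sequentially. R n * cauchy_tr (emp (A n)) (z + R n) - a * cauchy_tr (emp (A n)) (z + a) > 0"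
          by (intro order_tendstoD) auto
        then show ?thesis
        proof eventually_elim
          case (elim n)
          show ?case
          proof (rule ccontr)
            assume "\<not> a < R n"
            then have "R n = a \<or> R n < a" by auto
            then show False using elim cauchy_tr_strict_mono[OF pA[of n] z m R0[of n], of a] by auto
          qed
        qed
      next
        case False
        then show ?thesis using R0 by (intro always_eventually) (auto simp: not_less intro: le_less_trans)
      qed
    next
      fix a assume a: "r < a"
      have "\<kappa> < a * cauchy_tr \<mu> (z + a)"
        using cauchy_tr_strict_mono[OF pm z m r a] level by simp
      moreover have "(\<lambda>n. a * cauchy_tr (emp (A n)) (z + a) - R n * cauchy_tr (emp (A n)) (z + R n)) \<longlonglongrightarrow> a * cauchy_tr \<mu> (z + a) - \<kappa>"
        using a r z by (intro tendsto_intros \<Phi> Aconv) auto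
      ultimately have "\<forall>\<^sub>F n in sequentially. a * cauchy_tr (emp (A n)) (z + a) - R n * cauchy_tr (emp (A n)) (z + R n) > 0"
        by (intro order_tendstoD) auto
      then show "\<forall>\<^sub>F n in sequentially. R n < a"
      proof eventually_elim
        case (elim n)
        show ?case
        proof (rule ccontr)
          assume "\<not> R n < a"
          then have "R n = a \<or> a < R n" by auto
          moreover have "0 < a" using a r by simp
          ultimately show False using elim cauchy_tr_strict_mono[OF pA[of n] z m, of a "R n"] by auto
        qed
      qed
    qed
    have eq: "cauchy_tr (emp (C n)) z = real (k n) / real (Suc n) / z + (real (k n) / real (Suc n) + inverse (real (Suc n))) / R n" for n
    proof -
      have sC: "(\<Sum>x\<in>#C n. 1 / (z - x)) = (\<Sum>y\<in>#B n. 1 / (z - y)) + real (k n) / z"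
        by (simp add: C_def)
      have "R n \<noteq> 0" using R0[of n] by simp
      then have sB: "(\<Sum>y\<in>#B n. 1 / (z - y)) = (real (k n) + 1) / R n"
        unfolding R_def by (auto simp: add.commute)
      have "((K + 1) / R + K / z) / N = K / N / z + (K / N + inverse N) / R" for K R N :: real
        by (simp add: add_divide_distrib inverse_eq_divide mult.commute)
      then show ?thesis
        unfolding cauchy_tr_emp[OF ne(2)] C(1) sC sB by blast
    qed
    have "(\<lambda>n. real (k n) / real (Suc n) / z + (real (k n) / real (Suc n) + inverse (real (Suc n))) / R n) \<longlonglongrightarrow> \<kappa> / z + (\<kappa> + 0) / r"
      using z m r by (intro tendsto_intros klim Rlim LIMSEQ_inverse_real_of_nat) auto
    then show ?thesis unfolding eq by simp
  qed
  obtain s \<rho> where s: "strict_mono s" and \<rho>: "prob_on m \<rho>"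
    and conv: "\<And>z. z > m \<Longrightarrow> (\<lambda>n. cauchy_tr (emp (C (s n))) z) \<longlonglongrightarrow> cauchy_tr \<rho> z"
    using helly_prob_on[of m "\<lambda>n. emp (C n)", OF pC m] by blast
  have val: "cauchy_tr \<rho> z = \<kappa> / z + \<kappa> / r" if "z > m" "r > 0" "r * cauchy_tr \<mu> (z + r) = \<kappa>" for z r
    using LIMSEQ_subseq_LIMSEQ[OF lim[OF that] s] conv[OF that(1)] LIMSEQ_unique unfolding comp_def by blast
  \<comment> \<open>Helly's theorem only gives a subsequence, but the limit in \<open>lim\<close>
    holds along the full sequence, and a level r exists for every z > m. Hence all of
    \<open>C\<close> approximates \<rho>.\<close>
  have "root_approximable m \<rho>"
    unfolding root_approximable_def
  proof (intro conjI \<rho> exI[of _ C] allI impI)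
    fix z assume z: "z > m"
    obtain r where r: "r > 0" "r * cauchy_tr \<mu> (z + r) = \<kappa>"
      using cauchy_tr_level[OF pm z m \<kappa>] .
    show "(\<lambda>n. cauchy_tr (emp (C n)) z) \<longlonglongrightarrow> cauchy_tr \<rho> z"
      using lim[OF z r] val[OF z r] by simp
  qed (use C in auto)
  then show ?thesis using that val by blast
qed

section \<open>The atom at the right end of the support\<close>

lemma cauchy_tr_atom_lower:
  assumes \<rho>: "prob_on m \<rho>" and z: "z > m"
  shows "measure \<rho> {m} \<le> (z - m) * cauchy_tr \<rho> z"
proof -
  interpret real_distribution \<rho> using \<rho> by (simp add: prob_on_def)
  have "measure \<rho> {m} = (\<integral>x. indicator {m} x \<partial>\<rho>)" by simp
  also have "\<dots> \<le> (\<integral>x. (z - m) / (z - x) \<partial>\<rho>)"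
    by (rule prob_on_integral_mono[OF \<rho>, where B = 1 and C = 1])
       (use z in \<open>auto simp: divide_simps split: split_indicator\<close>)
  also have "\<dots> = (z - m) * cauchy_tr \<rho> z"
    unfolding cauchy_tr_def by (subst integral_mult_right_zero[symmetric]) simp
  finally show ?thesis .
qed

text \<open>On [0, m] the integrand (z - m) / (z - x) is bounded by 1, and it tends to the indicator
  of {m} as z tends to m from the right.\<close>

lemma cauchy_tr_atom_limit:
  assumes \<rho>: "prob_on m \<rho>" and z: "\<And>n. z n > m" "z \<longlonglongrightarrow> m"
  shows "(\<lambda>n. (z n - m) * cauchy_tr \<rho> (z n)) \<longlonglongrightarrow> measure \<rho> {m}"
proof -
  interpret real_distribution \<rho> using \<rho> by (simp add: prob_on_def)
  have "(\<lambda>n. \<integral>x. (z n - m) / (z n - x) \<partial>\<rho>) \<longlonglongrightarrow> (\<integral>x. indicator {m} x \<partial>\<rho>)"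
  proof (rule integral_dominated_convergence[where w = "\<lambda>_. 1"])
    show "AE x in \<rho>. (\<lambda>n. (z n - m) / (z n - x)) \<longlonglongrightarrow> indicator {m} x"
    proof (rule AE_I2)
      fix x
      show "(\<lambda>n. (z n - m) / (z n - x)) \<longlonglongrightarrow> indicator {m} x"
      proof (cases "x = m")
        case True
        have "(\<lambda>n. (z n - m) / (z n - x)) = (\<lambda>n. 1)"
        proof
          fix n show "(z n - m) / (z n - x) = 1" using z(1)[of n] True by simp
        qed
        then show ?thesis using True by simp
      next
        case False
        then have "(\<lambda>n. (z n - m) / (z n - x)) \<longlonglongrightarrow> (m - m) / (m - x)"
          by (intro tendsto_intros z) auto
        then show ?thesis using False by simp
      qed
    qed
    show "AE x in \<rho>. norm ((z n - m) / (z n - x)) \<le> 1" for n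
    proof -
      have "norm ((z n - m) / (z n - x)) \<le> 1" if "x \<in> {0..m}" for x
        using that z(1)[of n] by (auto simp: divide_simps)
      then show ?thesis by (rule prob_on_AE[OF \<rho>])
    qed
  qed auto
  moreover have "(\<integral>x. (z' - m) / (z' - x) \<partial>\<rho>) = (z' - m) * cauchy_tr \<rho> z'" for z'
    unfolding cauchy_tr_def by (subst integral_mult_right_zero[symmetric]) simp
  ultimately show ?thesis by simp
qed

text \<open>With y = z + r, the product (z - m) G(z) for \<rho> is a vanishing term plus (y - m)
  G(y) - \<kappa>, where the latter G belongs to \<mu>. It remains to see that y also tends to m.
  This is where an atom heavier than \<kappa> enters: \<beta> - \<kappa> \<le> (z - m) G(y) \<le> (z
  - m) / (y - m) forces y - m to be of the order of z - m.\<close>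

lemma compression_atom:
  assumes \<mu>: "prob_on m \<mu>" and \<rho>: "prob_on m \<rho>" and m: "m > 0" and \<kappa>: "0 < \<kappa>" "\<kappa> < 1"
    and val: "\<And>z r. z > m \<Longrightarrow> r > 0 \<Longrightarrow> r * cauchy_tr \<mu> (z + r) = \<kappa> \<Longrightarrow> cauchy_tr \<rho> z = \<kappa> / z + \<kappa> / r"
    and \<beta>: "measure \<mu> {m} > \<kappa>"
  shows "measure \<rho> {m} = measure \<mu> {m} - \<kappa>"
proof -
  define \<beta> where "\<beta> = measure \<mu> {m}"
  define z where "z n = m + inverse (real (Suc n))" for n
  have z: "z n > m" for n by (simp add: z_def)
  have "z \<longlonglongrightarrow> m + 0" unfolding z_def by (intro tendsto_intros LIMSEQ_inverse_real_of_nat)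
  then have zlim: "z \<longlonglongrightarrow> m" by simp
  have "\<exists>r>0. r * cauchy_tr \<mu> (z n + r) = \<kappa>" for n
    using cauchy_tr_level[OF \<mu> z _ \<kappa>] m by (metis less_imp_le)
  then obtain r where r: "\<And>n. r n > 0" "\<And>n. r n * cauchy_tr \<mu> (z n + r n) = \<kappa>" by metis
  define y where "y n = z n + r n" for n
  have y: "y n > m" for n using z[of n] r(1)[of n] by (simp add: y_def)
  have key: "(z n - m) * cauchy_tr \<mu> (y n) = (y n - m) * cauchy_tr \<mu> (y n) - \<kappa>" for n
    using r(2)[of n] by (simp add: y_def algebra_simps)
  have bound: "y n - m \<le> (z n - m) / (\<beta> - \<kappa>)" for n
  proof -
    have "\<beta> - \<kappa> \<le> (z n - m) * cauchy_tr \<mu> (y n)"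
      unfolding key using cauchy_tr_atom_lower[OF \<mu> y] by (simp add: \<beta>_def)
    also have "\<dots> \<le> (z n - m) * (1 / (y n - m))"
      using z[of n] by (intro mult_left_mono cauchy_tr_upper[OF \<mu> y]) auto
    finally show ?thesis using y[of n] \<beta> by (simp add: field_simps \<beta>_def)
  qed
  have "(\<lambda>n. y n - m) \<longlonglongrightarrow> 0"
  proof (rule tendsto_sandwich[where f = "\<lambda>_. 0"])
    have "(\<lambda>n. (z n - m) / (\<beta> - \<kappa>)) \<longlonglongrightarrow> (m - m) / (\<beta> - \<kappa>)"
      using \<beta> by (intro tendsto_intros zlim) (auto simp: \<beta>_def)
    then show "(\<lambda>n. (z n - m) / (\<beta> - \<kappa>)) \<longlonglongrightarrow> 0" by simp
  qed (use y bound in \<open>auto intro!: always_eventually less_imp_le\<close>)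
  then have ylim: "y \<longlonglongrightarrow> m" by (simp add: LIM_zero_iff)
  have "(z n - m) * cauchy_tr \<rho> (z n) = (z n - m) * \<kappa> / z n + ((y n - m) * cauchy_tr \<mu> (y n) - \<kappa>)" for n
  proof -
    have "\<kappa> / r n = cauchy_tr \<mu> (y n)" using r(1)[of n] r(2)[of n] by (simp add: y_def field_simps)
    then show ?thesis using val[OF z r, of n] unfolding key[symmetric] by (simp add: distrib_left)
  qed
  moreover have "(\<lambda>n. (z n - m) * \<kappa> / z n + ((y n - m) * cauchy_tr \<mu> (y n) - \<kappa>)) \<longlonglongrightarrow>
      (m - m) * \<kappa> / m + (\<beta> - \<kappa>)"
    unfolding \<beta>_def using m by (intro tendsto_intros zlim cauchy_tr_atom_limit[OF \<mu> y ylim]) auto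
  ultimately have "(\<lambda>n. (z n - m) * cauchy_tr \<rho> (z n)) \<longlonglongrightarrow> \<beta> - \<kappa>" by simp
  then show ?thesis
    using cauchy_tr_atom_limit[OF \<rho> z zlim] LIMSEQ_unique unfolding \<beta>_def by blast
qed

subsection \<open>Moments and the multiplicative convolution\<close>

lemma prob_on_moment_0: "prob_on m \<rho> \<Longrightarrow> moment \<rho> 0 = 1"
  using prob_on_integral_const[of m \<rho> 1] by (simp add: moment_def)

lemma prob_on_cpm_Rplus:
  assumes "prob_on m \<rho>"
  shows "cpm_Rplus \<rho>"
proof -
  interpret real_distribution \<rho> using assms by (simp add: prob_on_def)
  have "AE x in \<rho>. x \<in> {0..m}" using assms by (simp add: prob_on_def)
  then have "measure \<rho> {0..m} = 1" by (subst prob_eq_1) auto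
  then show ?thesis using prob_space_axioms by (auto simp: cpm_Rplus_def)
qed

lemma cpm_Rplus_prob_on:
  assumes "cpm_Rplus \<rho>"
  obtains R where "R \<ge> 0" "prob_on R \<rho>"
proof -
  obtain R where R: "prob_space \<rho>" "sets \<rho> = sets borel" "measure \<rho> {0..R} = 1"
    using assms by (auto simp: cpm_Rplus_def)
  interpret prob_space \<rho> by (rule R)
  have "space \<rho> = UNIV" using R(2) sets_eq_imp_space_eq by fastforce
  then have "real_distribution \<rho>"
    using R by (intro real_distribution.intro) (auto simp: real_distribution_axioms_def prob_space_axioms)
  moreover have "AE x in \<rho>. x \<in> {0..R}" using R by (subst (asm) prob_eq_1) auto
  moreover have "R \<ge> 0"
  proof (rule ccontr)
    assume "\<not> R \<ge> 0"
    then have "{0..R} = {}" by simp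
    then show False using R(3) by simp
  qed
  ultimately show ?thesis using that by (simp add: prob_on_def)
qed

lemma prob_on_power_integrable:
  assumes "prob_on m \<rho>"
  shows "integrable \<rho> (\<lambda>x. x ^ n)" "integrable \<rho> (\<lambda>x. \<bar>x\<bar> ^ n)"
  by (rule prob_on_integrable[OF assms, where B = "m ^ n"]; auto intro: power_mono)+

lemma abs_moment_bound:
  assumes "prob_on m \<rho>"
  shows "(\<integral>x. \<bar>x\<bar> ^ n \<partial>\<rho>) \<le> m ^ n"
proof -
  have "(\<integral>x. \<bar>x\<bar> ^ n \<partial>\<rho>) \<le> (\<integral>x. m ^ n \<partial>\<rho>)"
    by (rule prob_on_integral_mono[OF assms, where B = "m ^ n" and C = "m ^ n"])
       (auto intro: power_mono)
  then show ?thesis unfolding prob_on_integral_const[OF assms] .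
qed

lemma char_eq_moment_series:
  assumes "prob_on m \<rho>" "m \<ge> 0"
  shows "(\<lambda>n. \<Sum>k\<le>n. (\<i> * of_real t) ^ k / fact k * of_real (moment \<rho> k)) \<longlonglongrightarrow> char \<rho> t"
proof -
  interpret real_distribution \<rho> using assms by (simp add: prob_on_def)
  have bound: "cmod ((\<Sum>k\<le>n. (\<i> * of_real t) ^ k / fact k * of_real (moment \<rho> k)) - char \<rho> t) \<le> 2 * ((\<bar>t\<bar> * m) ^ n / fact n)" for n
  proof -
    have "cmod (char \<rho> t - (\<Sum>k\<le>n. (\<i> * of_real t) ^ k / fact k * of_real (moment \<rho> k))) \<le>
        (2 * \<bar>t\<bar> ^ n / fact n) * (\<integral>x. \<bar>x\<bar> ^ n \<partial>\<rho>)"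
      unfolding moment_def using prob_on_power_integrable[OF assms(1)]
      by (intro char_approx1[of n t]) auto
    also have "\<dots> \<le> (2 * \<bar>t\<bar> ^ n / fact n) * m ^ n"
      by (intro mult_left_mono abs_moment_bound[OF assms(1)]) auto
    finally show ?thesis by (simp add: norm_minus_commute power_mult_distrib mult_ac)
  qed
  have "(\<lambda>n. 2 * ((\<bar>t\<bar> * m) ^ n / fact n)) \<longlonglongrightarrow> 2 * 0"
    using summable_LIMSEQ_zero[OF summable_exp[of "\<bar>t\<bar> * m"]]
    by (intro tendsto_mult tendsto_const) (simp add: divide_inverse mult.commute)
  then have lim: "(\<lambda>n. 2 * ((\<bar>t\<bar> * m) ^ n / fact n)) \<longlonglongrightarrow> 0" by simp
  show ?thesis
    by (rule LIM_zero_cancel, rule Lim_null_comparison[OF always_eventually lim]) (use bound in blast)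
qed

text \<open>Bounded support makes the characteristic function the sum of its moment series
  everywhere, so equal moments give equal characteristic functions.\<close>

lemma moments_determine_measure:
  assumes "cpm_Rplus \<rho>" "cpm_Rplus \<tau>" "\<And>n. n \<ge> 1 \<Longrightarrow> moment \<rho> n = moment \<tau> n"
  shows "\<rho> = \<tau>"
proof -
  obtain R where R: "R \<ge> 0" "prob_on R \<rho>" using cpm_Rplus_prob_on[OF assms(1)] .
  obtain T where T: "T \<ge> 0" "prob_on T \<tau>" using cpm_Rplus_prob_on[OF assms(2)] .
  have m: "moment \<rho> n = moment \<tau> n" for n
    using assms(3)[of n] prob_on_moment_0[OF R(2)] prob_on_moment_0[OF T(2)] by (cases "n = 0") auto
  have "char \<rho> t = char \<tau> t" for t
    using char_eq_moment_series[OF R(2,1), of t] char_eq_moment_series[OF T(2,1), of t] LIMSEQ_unique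
    unfolding m by blast
  then show ?thesis using R T by (intro Levy_uniqueness) (auto simp: prob_on_def)
qed

lemma free_mult_conv_eqI:
  assumes "cpm_Rplus \<rho>"
    and "\<And>n. n \<ge> 1 \<Longrightarrow> moment \<rho> n = alternating_sum (free_cumulant \<nu>) (free_cumulant \<mu>) n"
  shows "\<nu> \<boxtimes> \<mu> = \<rho>"
  unfolding free_mult_conv_def alternating_sum_def[symmetric]
proof (rule the_equality)
  fix \<tau> assume "cpm_Rplus \<tau> \<and> (\<forall>n\<ge>1. moment \<tau> n = alternating_sum (free_cumulant \<nu>) (free_cumulant \<mu>) n)"
  then show "\<tau> = \<rho>" using assms by (intro moments_determine_measure) auto
qed (use assms in auto)

text \<open>Taken at complex arguments so that it is an analytic germ at 0. Identities of Cauchy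
  transforms on a real interval then turn into identities of formal power series.\<close>

definition moment_gf :: "real measure \<Rightarrow> complex \<Rightarrow> complex" where
  "moment_gf \<rho> w = (\<integral>x. 1 / (1 - w * of_real x) \<partial>\<rho>)"

definition complex_fps :: "real fps \<Rightarrow> complex fps" where
  "complex_fps F = Abs_fps (\<lambda>n. of_real (F $ n))"

lemma complex_fps_nth [simp]: "complex_fps F $ n = of_real (F $ n)"
  by (simp add: complex_fps_def)

lemma complex_fps_simps:
  "complex_fps (F + G) = complex_fps F + complex_fps G"
  "complex_fps (F - G) = complex_fps F - complex_fps G"
  "complex_fps (F * G) = complex_fps F * complex_fps G"
  "complex_fps 1 = 1" "complex_fps fps_X = fps_X" "complex_fps (fps_const a) = fps_const (of_real a)"
  by (auto simp: fps_eq_iff fps_mult_nth fps_X_def)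

lemma complex_fps_power: "complex_fps (F ^ n) = complex_fps F ^ n"
  by (induction n) (simp_all add: complex_fps_simps)

lemma complex_fps_inverse:
  assumes "F $ 0 \<noteq> 0"
  shows "complex_fps (inverse F) = inverse (complex_fps F)"
proof -
  have "complex_fps F * complex_fps (inverse F) = 1"
    using assms by (simp add: complex_fps_simps(3,4) inverse_mult_eq_1' flip: complex_fps_simps(3))
  then show ?thesis by (rule fps_inverse_unique[symmetric])
qed

lemma complex_fps_compose: "complex_fps (F oo G) = complex_fps F oo complex_fps G"
  by (rule fps_ext) (simp add: fps_compose_nth flip: complex_fps_power)

lemma complex_fps_inj: "complex_fps F = complex_fps G \<Longrightarrow> F = G"
  by (auto simp: fps_eq_iff)

lemma moment_gf_expansion:
  assumes \<rho>: "prob_on m \<rho>" and m: "m \<ge> 0"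
  shows "moment_gf \<rho> has_fps_expansion complex_fps (Abs_fps (moment \<rho>))"
proof (rule has_fps_expansionI)
  interpret real_distribution \<rho> using \<rho> by (simp add: prob_on_def)
  \<comment> \<open>The radius gives |w x| \<le> 1 / 2 on the support, so the geometric series
    converges uniformly; m + 1 instead of m covers m = 0.\<close>
  have "(\<lambda>n. complex_fps (Abs_fps (moment \<rho>)) $ n * w ^ n) sums moment_gf \<rho> w" if w: "cmod w < 1 / (2 * (m + 1))" for w
  proof -
    have wx: "cmod (w * of_real x) \<le> 1 / 2" if "x \<in> {0..m}" for x
    proof -
      have "cmod (w * of_real x) = cmod w * x" using that by (simp add: norm_mult)
      also have "\<dots> \<le> 1 / (2 * (m + 1)) * (m + 1)"
        using that w m by (intro mult_mono) auto
      also have "\<dots> = 1 / 2" using m by (simp add: field_simps)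
      finally show ?thesis .
    qed
    have lb: "1 / 2 \<le> cmod (1 - w * of_real x)" if "x \<in> {0..m}" for x
      using wx[OF that] norm_triangle_ineq2[of 1 "w * of_real x"] by simp
    have nz: "1 - w * of_real x \<noteq> 0" if "x \<in> {0..m}" for x using lb[OF that] by auto
    have i1: "integrable \<rho> (\<lambda>x. 1 / (1 - w * of_real x))"
    proof (rule prob_on_integrable[OF \<rho>, where B = 2])
      fix x assume "x \<in> {0..m}"
      from lb[OF this] show "norm (1 / (1 - w * of_real x)) \<le> 2" by (simp add: norm_divide divide_simps)
    qed measurable
    have i2: "integrable \<rho> (\<lambda>x. (w * of_real x) ^ i)" for i
    proof (rule prob_on_integrable[OF \<rho>, where B = 1])
      fix x assume "x \<in> {0..m}"
      then show "norm ((w * of_real x) ^ i) \<le> 1"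
        unfolding norm_power using wx[of x] by (intro power_le_one) auto
    qed measurable
    have mom: "complex_fps (Abs_fps (moment \<rho>)) $ i * w ^ i = (\<integral>x. (w * of_real x) ^ i \<partial>\<rho>)" for i
    proof -
      have "(\<integral>x. (w * of_real x) ^ i \<partial>\<rho>) = (\<integral>x. w ^ i * of_real (x ^ i) \<partial>\<rho>)"
        by (simp add: power_mult_distrib)
      also have "\<dots> = w ^ i * (\<integral>x. of_real (x ^ i) \<partial>\<rho>)"
        by (rule integral_mult_right_zero)
      also have "(\<integral>x. of_real (x ^ i) \<partial>\<rho>) = complex_of_real (moment \<rho> i)"
        unfolding moment_def by (rule integral_complex_of_real)
      finally show ?thesis by simp
    qed
    have bound: "cmod ((\<Sum>i<n. complex_fps (Abs_fps (moment \<rho>)) $ i * w ^ i) - moment_gf \<rho> w) \<le> 2 * (1 / 2) ^ n" for n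
    proof -
      have "(\<Sum>i<n. complex_fps (Abs_fps (moment \<rho>)) $ i * w ^ i) = (\<integral>x. (\<Sum>i<n. (w * of_real x) ^ i) \<partial>\<rho>)"
        unfolding mom by (rule Bochner_Integration.integral_sum[symmetric]) (rule i2)
      then have "(\<Sum>i<n. complex_fps (Abs_fps (moment \<rho>)) $ i * w ^ i) - moment_gf \<rho> w =
          (\<integral>x. (\<Sum>i<n. (w * of_real x) ^ i) - 1 / (1 - w * of_real x) \<partial>\<rho>)"
        unfolding moment_gf_def
        by (simp add: Bochner_Integration.integral_diff[OF Bochner_Integration.integrable_sum[OF i2] i1])
      also have "cmod \<dots> \<le> (\<integral>x. cmod ((\<Sum>i<n. (w * of_real x) ^ i) - 1 / (1 - w * of_real x)) \<partial>\<rho>)"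
        by (rule integral_norm_bound)
      also have "\<dots> \<le> (\<integral>x. 2 * (1 / 2) ^ n \<partial>\<rho>)"
      proof -
        have gp: "(\<Sum>i<n. q ^ i) - 1 / (1 - q) = - (q ^ n / (1 - q))" if "q \<noteq> 1" for q :: complex
          using that by (simp add: sum_gp_strict diff_divide_distrib)
        have b: "cmod ((\<Sum>i<n. (w * of_real x) ^ i) - 1 / (1 - w * of_real x)) \<le> 2 * (1 / 2) ^ n" if x: "x \<in> {0..m}" for x
        proof -
          have "(\<Sum>i<n. (w * of_real x) ^ i) - 1 / (1 - w * of_real x) = - ((w * of_real x) ^ n / (1 - w * of_real x))"
            using gp[of "w * of_real x"] nz[OF x] by simp
          then have "cmod ((\<Sum>i<n. (w * of_real x) ^ i) - 1 / (1 - w * of_real x)) =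
              cmod (w * of_real x) ^ n / cmod (1 - w * of_real x)"
            by (simp only: norm_minus_cancel norm_divide norm_power)
          also have "\<dots> \<le> (1 / 2) ^ n / (1 / 2)"
            using wx[OF x] lb[OF x] by (intro frac_le power_mono) auto
          finally show ?thesis by simp
        qed
        show ?thesis
          by (rule prob_on_integral_mono[OF \<rho>, where B = "2 * (1 / 2) ^ n" and C = "2 * (1 / 2) ^ n"])
             (use b in auto)
      qed
      also have "\<dots> = 2 * (1 / 2) ^ n" by (rule prob_on_integral_const[OF \<rho>])
      finally show ?thesis .
    qed
    have lim: "(\<lambda>n. 2 * (1 / 2) ^ n :: real) \<longlonglongrightarrow> 0" by real_asymp
    show ?thesis
      unfolding sums_def
      by (rule LIM_zero_cancel, rule Lim_null_comparison[OF always_eventually lim]) (use bound in blast)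
  qed
  moreover have "eventually (\<lambda>w. w \<in> ball 0 (1 / (2 * (m + 1)))) (nhds (0::complex))"
    using m by (intro eventually_nhds_in_open) auto
  ultimately show "\<forall>\<^sub>F w in nhds 0. (\<lambda>n. complex_fps (Abs_fps (moment \<rho>)) $ n * w ^ n) sums moment_gf \<rho> w"
    by (auto elim!: eventually_mono)
qed

lemma moment_gf_real: "moment_gf \<rho> (of_real x) = of_real (\<integral>t. 1 / (1 - x * t) \<partial>\<rho>)"
proof -
  have "moment_gf \<rho> (of_real x) = (\<integral>t. of_real (1 / (1 - x * t)) \<partial>\<rho>)"
    unfolding moment_gf_def by simp
  also have "\<dots> = of_real (\<integral>t. 1 / (1 - x * t) \<partial>\<rho>)" by (rule integral_complex_of_real)
  finally show ?thesis .
qed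

lemma integral_kernel_cauchy_tr:
  assumes "z \<noteq> 0"
  shows "(\<integral>t. 1 / (1 - (1 / z) * t) \<partial>\<rho>) = z * cauchy_tr \<rho> z"
proof -
  have "1 / (1 - (1 / z) * t) = z * (1 / (z - t))" for t using assms by (simp add: field_simps)
  then show ?thesis unfolding cauchy_tr_def by (simp only: integral_mult_right_zero)
qed

text \<open>Zeros of a nonzero germ are isolated, but the difference of the two functions vanishes
  along positive reals tending to 0.\<close>

lemma fps_eq_of_real_sequence:
  assumes f: "f has_fps_expansion F" and g: "g has_fps_expansion G"
    and eq: "\<And>x. 0 < x \<Longrightarrow> x < \<delta> \<Longrightarrow> f (complex_of_real x) = g (of_real x)" and \<delta>: "\<delta> > 0"
  shows "F = G"
proof (rule ccontr)
  assume "F \<noteq> G"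
  then have nz: "fps_to_fls (F - G) \<noteq> 0" by simp
  have "(\<lambda>w. f w - g w) has_laurent_expansion fps_to_fls (F - G)"
    by (intro has_laurent_expansion_fps fps_expansion_intros f g)
  then have "eventually (\<lambda>w. f w - g w \<noteq> 0) (at 0)"
    using nz has_laurent_expansion_nonzero_imp_eventually_nonzero by blast
  moreover have "filterlim (\<lambda>n. complex_of_real (\<delta> / (real n + 2))) (at 0) sequentially"
  proof (rule filterlim_atI)
    have "(\<lambda>n. \<delta> / (real n + 2)) \<longlonglongrightarrow> 0" by real_asymp
    from tendsto_of_real[OF this, where ?'a = complex]
    show "(\<lambda>n. complex_of_real (\<delta> / (real n + 2))) \<longlonglongrightarrow> 0" by simp
    show "\<forall>\<^sub>F n in sequentially. complex_of_real (\<delta> / (real n + 2)) \<noteq> 0"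
    proof (intro always_eventually allI)
      fix n
      have "\<delta> / (real n + 2) > 0" using \<delta> by simp
      then show "complex_of_real (\<delta> / (real n + 2)) \<noteq> 0" by (simp only: of_real_eq_0_iff)
    qed
  qed
  ultimately have "\<forall>\<^sub>F n in sequentially. f (complex_of_real (\<delta> / (real n + 2))) - g (complex_of_real (\<delta> / (real n + 2))) \<noteq> 0"
    by (rule eventually_compose_filterlim)
  then obtain n where n: "f (complex_of_real (\<delta> / (real n + 2))) - g (complex_of_real (\<delta> / (real n + 2))) \<noteq> 0"
    using eventually_happens' sequentially_bot by blast
  have "0 < \<delta> / (real n + 2)" "\<delta> / (real n + 2) < \<delta>" using \<delta> by (auto simp: divide_simps)
  from eq[OF this] n show False by simp
qed

section \<open>One layer: multiplication by the two-point law and affine maps\<close>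

lemma moment_two_point:
  assumes "0 \<le> \<alpha>" "\<alpha> \<le> 1"
  shows "moment (two_point \<alpha> \<gamma>) 0 = 1" "n \<ge> 1 \<Longrightarrow> moment (two_point \<alpha> \<gamma>) n = \<alpha> * \<gamma> ^ n"
proof -
  have "moment (two_point \<alpha> \<gamma>) n = (\<integral>b. (if b then \<gamma> else 0) ^ n \<partial>measure_pmf (bernoulli_pmf \<alpha>))" for n
    unfolding moment_def two_point_def by (subst integral_distr) auto
  then have *: "moment (two_point \<alpha> \<gamma>) n = \<alpha> * \<gamma> ^ n + (1 - \<alpha>) * 0 ^ n" for n
    using assms by (simp add: algebra_simps)
  show "moment (two_point \<alpha> \<gamma>) 0 = 1" "n \<ge> 1 \<Longrightarrow> moment (two_point \<alpha> \<gamma>) n = \<alpha> * \<gamma> ^ n"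
    unfolding * by auto
qed

lemma moment_distr_scale:
  assumes "real_distribution \<rho>"
  shows "moment (distr \<rho> borel (\<lambda>x. c * x)) n = c ^ n * moment \<rho> n"
proof -
  interpret real_distribution \<rho> by (rule assms)
  show ?thesis unfolding moment_def by (subst integral_distr) (auto simp: power_mult_distrib)
qed

lemma prob_on_distr_affine:
  assumes \<rho>: "prob_on m \<rho>" and "a \<ge> 0" "b \<ge> 0"
  shows "prob_on (b + a * m) (distr \<rho> borel (\<lambda>x. b + a * x))"
proof -
  interpret real_distribution \<rho> using \<rho> by (simp add: prob_on_def)
  have "AE x in \<rho>. b + a * x \<in> {0..b + a * m}"
    by (rule prob_on_AE[OF \<rho>]) (use assms in \<open>auto intro: mult_left_mono\<close>)
  then show ?thesis unfolding prob_on_def by (subst AE_distr_iff) auto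
qed

lemma cauchy_tr_distr_affine:
  assumes \<rho>: "real_distribution \<rho>" and a: "a \<noteq> 0"
  shows "cauchy_tr (distr \<rho> borel (\<lambda>x. b + a * x)) z = cauchy_tr \<rho> ((z - b) / a) / a"
proof -
  interpret real_distribution \<rho> by (rule \<rho>)
  have eq: "1 / (z - (b + a * x)) = 1 / ((z - b) / a - x) / a" for x
    using a by (simp add: divide_simps) (auto simp: algebra_simps)
  have "cauchy_tr (distr \<rho> borel (\<lambda>x. b + a * x)) z = (\<integral>x. 1 / (z - (b + a * x)) \<partial>\<rho>)"
    unfolding cauchy_tr_def by (subst integral_distr) auto
  then show ?thesis unfolding cauchy_tr_def by (simp only: eq integral_divide_zero)
qed

lemma emp_image_affine:
  assumes "A \<noteq> {#}" "a \<noteq> 0"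
  shows "cauchy_tr (emp (image_mset (\<lambda>x. b + a * x) A)) z = cauchy_tr (emp A) ((z - b) / a) / a"
proof -
  have "1 / (z - (b + a * x)) = 1 / ((z - b) / a - x) / a" for x
    using assms by (simp add: divide_simps) (auto simp: algebra_simps)
  then have "(\<Sum>x\<in>#A. 1 / (z - (b + a * x))) = (\<Sum>x\<in>#A. 1 / ((z - b) / a - x)) / a"
    by (simp only: sum_mset_distrib_right divide_inverse)
  then show ?thesis using assms by (simp add: cauchy_tr_emp multiset.map_comp comp_def)
qed

lemma root_approximable_distr_affine:
  assumes \<rho>: "root_approximable m \<rho>" and a: "a > 0" and b: "b \<ge> 0"
  shows "root_approximable (b + a * m) (distr \<rho> borel (\<lambda>x. b + a * x))"
proof -
  obtain A where A: "\<And>n. size (A n) = Suc n" "\<And>n. set_mset (A n) \<subseteq> {0..m}"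
    and conv: "\<And>z. z > m \<Longrightarrow> (\<lambda>n. cauchy_tr (emp (A n)) z) \<longlonglongrightarrow> cauchy_tr \<rho> z"
    using \<rho> unfolding root_approximable_def by metis
  have p: "prob_on m \<rho>" using \<rho> by (simp add: root_approximable_def)
  have ne: "A n \<noteq> {#}" for n using A(1)[of n] by auto
  show ?thesis
    unfolding root_approximable_def
  proof (intro conjI prob_on_distr_affine[OF p] exI[of _ "\<lambda>n. image_mset (\<lambda>x. b + a * x) (A n)"] allI impI)
    fix n show "set_mset (image_mset (\<lambda>x. b + a * x) (A n)) \<subseteq> {0..b + a * m}"
      using A(2)[of n] a b by (auto intro!: mult_left_mono add_nonneg_nonneg)
  next
    fix z assume z: "z > b + a * m"
    then have "(z - b) / a > m" using a by (simp add: field_simps)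
    then show "(\<lambda>n. cauchy_tr (emp (image_mset (\<lambda>x. b + a * x) (A n))) z) \<longlonglongrightarrow>
        cauchy_tr (distr \<rho> borel (\<lambda>x. b + a * x)) z"
      using a p by (subst cauchy_tr_distr_affine)
        (auto simp: emp_image_affine[OF ne] prob_on_def intro!: tendsto_divide conv)
  qed (use a b A in auto)
qed

lemma measure_distr_affine_atom:
  assumes \<rho>: "real_distribution \<rho>" and a: "a \<noteq> 0"
  shows "measure (distr \<rho> borel (\<lambda>x. b + a * x)) {b + a * m} = measure \<rho> {m}"
proof -
  interpret real_distribution \<rho> by (rule \<rho>)
  have "(\<lambda>x. b + a * x) -` {b + a * m} \<inter> space \<rho> = {m}" using a by auto
  then show ?thesis by (subst measure_distr) auto
qed

lemma two_point_conv:
  assumes \<mu>: "root_approximable m \<mu>" and m: "m > 0" and \<alpha>: "0 < \<alpha>" "\<alpha> < 1" and \<gamma>: "\<gamma> > 0"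
    and \<beta>: "measure \<mu> {m} > 1 - \<alpha>"
  shows "root_approximable (\<gamma> * m) (two_point \<alpha> \<gamma> \<boxtimes> \<mu>)"
    "measure (two_point \<alpha> \<gamma> \<boxtimes> \<mu>) {\<gamma> * m} = measure \<mu> {m} - (1 - \<alpha>)"
proof -
  define \<kappa> where "\<kappa> = 1 - \<alpha>"
  have \<kappa>: "0 < \<kappa>" "\<kappa> < 1" using \<alpha> by (auto simp: \<kappa>_def)
  have m0: "m \<ge> 0" using m by simp
  have p\<mu>: "prob_on m \<mu>" using \<mu> by (simp add: root_approximable_def)
  obtain \<rho> where \<rho>: "root_approximable m \<rho>"
    and val: "\<And>z r. z > m \<Longrightarrow> r > 0 \<Longrightarrow> r * cauchy_tr \<mu> (z + r) = \<kappa> \<Longrightarrow> cauchy_tr \<rho> z = \<kappa> / z + \<kappa> / r"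
    using compression_exists[OF \<mu> m0 \<kappa>] by metis
  have p\<rho>: "prob_on m \<rho>" using \<rho> by (simp add: root_approximable_def)
  have r\<rho>: "real_distribution \<rho>" using p\<rho> by (simp add: prob_on_def)
  define \<tau> where "\<tau> = distr \<rho> borel (\<lambda>x. 0 + \<gamma> * x)"
  have \<tau>: "root_approximable (0 + \<gamma> * m) \<tau>"
    unfolding \<tau>_def by (rule root_approximable_distr_affine[OF \<rho>]) (use \<gamma> in auto)
  have p\<tau>: "prob_on (\<gamma> * m) \<tau>" using \<tau> by (simp add: root_approximable_def)
  have mom\<tau>: "moment \<tau> n = \<gamma> ^ n * moment \<rho> n" for n
    unfolding \<tau>_def using moment_distr_scale[OF r\<rho>, of \<gamma> n] by simp
  have gf\<tau>: "moment_gf \<tau> w = moment_gf \<rho> (of_real \<gamma> * w)" for w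
  proof -
    interpret real_distribution \<rho> by (rule r\<rho>)
    show ?thesis unfolding moment_gf_def \<tau>_def by (subst integral_distr) (auto simp: mult_ac)
  qed
  define M where "M = Abs_fps (moment \<mu>)"
  \<comment> \<open>Solved from the equation that \<open>moments_eq_alternating_sum\<close> demands;
    the denominator is invertible because its constant term is \<alpha>.\<close>
  define Z where "Z = fps_const (1 / \<gamma>) * (fps_X * M * inverse (M - 1 + fps_const \<alpha>))"
  have M0: "M $ 0 = 1" unfolding M_def using prob_on_moment_0[OF p\<mu>] by simp
  have D0: "(M - 1 + fps_const \<alpha>) $ 0 \<noteq> 0" using M0 \<alpha> by simp
  have Z: "fps_const \<gamma> * Z * (M - 1 + fps_const \<alpha>) = fps_X * M"
  proof -
    have "fps_const \<gamma> * Z * (M - 1 + fps_const \<alpha>) =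
        (fps_const \<gamma> * fps_const (1 / \<gamma>)) * (fps_X * M) * (inverse (M - 1 + fps_const \<alpha>) * (M - 1 + fps_const \<alpha>))"
      unfolding Z_def by (simp only: mult_ac)
    also have "\<dots> = fps_X * M" using \<gamma> inverse_mult_eq_1[OF D0] by simp
    finally show ?thesis .
  qed
  have E\<mu>: "moment_gf \<mu> has_fps_expansion complex_fps M"
    unfolding M_def by (rule moment_gf_expansion[OF p\<mu> m0])
  have E\<tau>: "moment_gf \<tau> has_fps_expansion complex_fps (Abs_fps (moment \<tau>))"
    by (rule moment_gf_expansion[OF p\<tau>]) (use \<gamma> m in auto)
  define Zf where "Zf w = of_real (1 / \<gamma>) * (w * moment_gf \<mu> w * inverse (moment_gf \<mu> w - 1 + of_real \<alpha>))" for w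
  have cZ: "complex_fps Z = fps_const (of_real (1 / \<gamma>)) * (fps_X * complex_fps M * inverse (complex_fps M - 1 + fps_const (of_real \<alpha>)))"
    unfolding Z_def by (simp only: complex_fps_simps complex_fps_inverse[OF D0])
  have EZ: "Zf has_fps_expansion complex_fps Z"
    unfolding cZ Zf_def
    by (intro fps_expansion_intros E\<mu>) (use M0 \<alpha> in auto)
  have Z0: "complex_fps Z $ 0 = 0" by (simp add: Z_def)
  have "(moment_gf \<tau> \<circ> Zf) has_fps_expansion (complex_fps (Abs_fps (moment \<tau>)) oo complex_fps Z)"
    by (rule has_fps_expansion_compose[OF E\<tau> EZ Z0])
  moreover have "(moment_gf \<tau> \<circ> Zf) (of_real x) = moment_gf \<mu> (of_real x)"
    if x: "0 < x" "x < \<alpha> / m" for x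
  proof -
    \<comment> \<open>The compression relation is parametrised by y = z + r, where r = \<kappa> /
      G(y) is explicit. Since y G(y) \<ge> 1, the point z = y - r is at least (1 - \<kappa>) y =
      \<alpha> / x, so x < \<alpha> / m places it beyond m. At this z, \<gamma> times
      \<open>Zf\<close> at x is 1 / z, and both generating functions take the value y G(y).\<close>
    define y where "y = 1 / x"
    define g where "g = cauchy_tr \<mu> y"
    define z where "z = y - \<kappa> / g"
    have xm: "x * m < \<alpha>" using x m by (simp add: field_simps)
    have y: "y > m" using x xm \<alpha> unfolding y_def by (simp add: field_simps)
    have yg: "y * g \<ge> 1"
      using cauchy_tr_lower[OF p\<mu> y m0] y m unfolding g_def by (simp add: field_simps)
    have g: "g > 0" unfolding g_def by (rule cauchy_tr_pos[OF p\<mu> y m0])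
    have "\<kappa> / g \<le> \<kappa> * y" using yg g \<kappa> by (simp add: field_simps)
    then have "z \<ge> \<alpha> * y" unfolding z_def \<kappa>_def by (simp add: algebra_simps)
    moreover have "\<alpha> * y > m" using xm x unfolding y_def by (simp add: field_simps)
    ultimately have z: "z > m" by simp
    have "cauchy_tr \<rho> z = \<kappa> / z + \<kappa> / (\<kappa> / g)"
      by (rule val[OF z]) (use g \<kappa> in \<open>auto simp: z_def g_def[symmetric]\<close>)
    then have "z * cauchy_tr \<rho> z = \<kappa> + z * g" using z m \<kappa> by (simp add: distrib_left)
    also have "\<dots> = y * g" using g by (simp add: z_def left_diff_distrib)
    finally have zc: "z * cauchy_tr \<rho> z = y * g" .
    have gf\<mu>: "moment_gf \<mu> (of_real x) = of_real (y * g)"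
      using integral_kernel_cauchy_tr[of y \<mu>] x unfolding moment_gf_real g_def y_def by simp
    have "x * y = 1" using x by (simp add: y_def)
    then have xyg: "x * (y * g) = g" by (metis mult.assoc mult_1)
    have "z * g = y * g - \<kappa>" using g by (simp add: z_def left_diff_distrib)
    then have zg: "y * g - 1 + \<alpha> = z * g" by (simp add: \<kappa>_def)
    have "\<gamma> * (1 / \<gamma> * (g * inverse (z * g))) = 1 / z"
      using \<gamma> g z m by (simp add: field_simps)
    then have Zx: "\<gamma> * (1 / \<gamma> * (x * (y * g) * inverse (y * g - 1 + \<alpha>))) = 1 / z"
      unfolding xyg zg .
    have "Zf (of_real x) = complex_of_real (1 / \<gamma> * (x * (y * g) * inverse (y * g - 1 + \<alpha>)))"
      unfolding Zf_def gf\<mu> by (simp only: of_real_mult of_real_inverse of_real_add of_real_diff of_real_1)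
    then have "of_real \<gamma> * Zf (of_real x) = complex_of_real (1 / z)"
      by (simp only: Zx flip: of_real_mult)
    then have "(moment_gf \<tau> \<circ> Zf) (of_real x) = of_real (\<integral>t. 1 / (1 - (1 / z) * t) \<partial>\<rho>)"
      unfolding comp_def gf\<tau> by (simp only: moment_gf_real)
    also have "\<dots> = of_real (z * cauchy_tr \<rho> z)"
      using z m by (subst integral_kernel_cauchy_tr) auto
    finally show ?thesis unfolding zc gf\<mu> .
  qed
  ultimately have "complex_fps (Abs_fps (moment \<tau>)) oo complex_fps Z = complex_fps M"
    by (rule fps_eq_of_real_sequence[OF _ E\<mu>, where \<delta> = "\<alpha> / m"]) (use \<alpha> m in auto)
  then have fps: "Abs_fps (moment \<tau>) oo Z = M"
    unfolding complex_fps_compose[symmetric] by (rule complex_fps_inj)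
  \<comment> \<open>The atom at m > 0 bounds the mean from below. A nonzero mean keeps
    \<open>u * v\<close> from vanishing in \<open>two_point_free_product_fps\<close>.\<close>
  have mean: "moment \<mu> 1 \<noteq> 0"
  proof -
    interpret real_distribution \<mu> using p\<mu> by (simp add: prob_on_def)
    have "(\<integral>x. m * indicator {m} x \<partial>\<mu>) \<le> (\<integral>x. x ^ 1 \<partial>\<mu>)"
      by (rule prob_on_integral_mono[OF p\<mu>, where B = m and C = m])
         (use m in \<open>auto split: split_indicator\<close>)
    then have "m * measure \<mu> {m} \<le> moment \<mu> 1" unfolding moment_def by simp
    moreover have "m * measure \<mu> {m} > 0" using m \<beta> \<alpha> by simp
    ultimately show ?thesis by simp
  qed
  have conv: "two_point \<alpha> \<gamma> \<boxtimes> \<mu> = \<tau>"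
  proof (rule free_mult_conv_eqI[OF prob_on_cpm_Rplus[OF p\<tau>]])
    fix n :: nat assume "n \<ge> 1"
    show "moment \<tau> n = alternating_sum (free_cumulant (two_point \<alpha> \<gamma>)) (free_cumulant \<mu>) n"
      by (rule moments_eq_alternating_sum[OF is_free_cumulants_free_cumulant _ _ is_free_cumulants_free_cumulant _ mean _ _ Z[unfolded M_def] fps[unfolded M_def]])
         (use \<alpha> \<gamma> moment_two_point prob_on_moment_0[OF p\<mu>] in auto)
  qed
  show "root_approximable (\<gamma> * m) (two_point \<alpha> \<gamma> \<boxtimes> \<mu>)" using \<tau> by (simp add: conv)
  have "measure \<tau> {0 + \<gamma> * m} = measure \<rho> {m}"
    unfolding \<tau>_def by (rule measure_distr_affine_atom[OF r\<rho>]) (use \<gamma> in auto)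
  also have "\<dots> = measure \<mu> {m} - \<kappa>"
    by (rule compression_atom[OF p\<mu> p\<rho> m \<kappa> val]) (use \<beta> in \<open>auto simp: \<kappa>_def\<close>)
  finally show "measure (two_point \<alpha> \<gamma> \<boxtimes> \<mu>) {\<gamma> * m} = measure \<mu> {m} - (1 - \<alpha>)"
    by (simp add: conv \<kappa>_def)
qed

subsection \<open>The top of the limit spectrum\<close>

lemma supp_max_atom:
  assumes \<rho>: "prob_on m \<rho>" and atom: "measure \<rho> {m} > 0"
  shows "supp_max \<rho> = m"
  unfolding supp_max_def
proof (rule cSup_eq_maximum)
  interpret real_distribution \<rho> using \<rho> by (simp add: prob_on_def)
  have "measure \<rho> {m} \<le> measure \<rho> (ball m e)" if "e > 0" for e
    by (rule finite_measure_mono) (use that in auto)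
  then show "m \<in> msupport \<rho>" using atom by (force simp: msupport_def)
  fix t assume t: "t \<in> msupport \<rho>"
  show "t \<le> m"
  proof (rule ccontr)
    assume "\<not> t \<le> m"
    then have "measure \<rho> (ball t (t - m)) > 0" using t by (auto simp: msupport_def)
    moreover have "AE x in \<rho>. x \<notin> ball t (t - m)"
      by (rule prob_on_AE[OF \<rho>]) (auto simp: dist_real_def)
    then have "measure \<rho> (ball t (t - m)) = 0"
      by (subst prob_eq_0) auto
    ultimately show False by simp
  qed
qed

lemma root_approximable_return:
  assumes "q \<ge> 0"
  shows "root_approximable q (return borel q)"
  unfolding root_approximable_def
proof (intro conjI exI[of _ "\<lambda>n. replicate_mset (Suc n) q"] allI impI)
  have "prob_space (return borel q)" by (rule prob_space_return) simp
  then show "prob_on q (return borel q)"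
    using assms unfolding prob_on_def
    by (auto simp: AE_return intro!: real_distribution.intro real_distribution_axioms.intro)
  fix z :: real
  have "cauchy_tr (emp (replicate_mset (Suc n) q)) z = 1 / (z - q)" for n
    by (subst cauchy_tr_emp) (auto simp del: of_nat_Suc replicate_mset_Suc)
  moreover have "cauchy_tr (return borel q) z = 1 / (z - q)"
    unfolding cauchy_tr_def by (rule integral_return) auto
  ultimately show "(\<lambda>n. cauchy_tr (emp (replicate_mset (Suc n) q)) z) \<longlonglongrightarrow> cauchy_tr (return borel q) z"
    by (simp del: replicate_mset_Suc)
qed (use assms in auto)

text \<open>The layer of index \<open>Suc n\<close> has undergone n compressions, each of which
  removes 1 - \<alpha> from the top atom, while the top itself moves by m n \<mapsto> q + \<sigma>^2
  \<gamma> m n.\<close>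

lemma lsd_top_atom:
  fixes q \<sigma> \<alpha> \<gamma> :: real
  assumes q: "q > 0" and \<sigma>: "\<sigma> > 0" and \<alpha>: "0 < \<alpha>" "\<alpha> < 1" and \<gamma>: "\<gamma> > 0"
    and n: "real n * (1 - \<alpha>) < 1"
  defines "m \<equiv> \<lambda>n. q * (\<Sum>k<Suc n. (\<sigma>\<^sup>2 * \<gamma>) ^ k)"
  shows "root_approximable (m n) (lsd q \<sigma> \<alpha> \<gamma> (Suc n)) \<and>
    measure (lsd q \<sigma> \<alpha> \<gamma> (Suc n)) {m n} = 1 - real n * (1 - \<alpha>)"
  using n
proof (induction n)
  case 0
  have "measure (return borel q) {q} = 1" by (subst measure_return) auto
  then show ?case using root_approximable_return[of q] q by (simp add: m_def)
next
  case (Suc n)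
  let ?\<mu> = "lsd q \<sigma> \<alpha> \<gamma> (Suc n)"
  have "real n * (1 - \<alpha>) < 1" using Suc.prems \<alpha> by (simp add: algebra_simps)
  from Suc.IH[OF this] have IH: "root_approximable (m n) ?\<mu>" "measure ?\<mu> {m n} = 1 - real n * (1 - \<alpha>)" by auto
  have s: "\<sigma>\<^sup>2 * \<gamma> > 0" using \<sigma> \<gamma> by simp
  have mn: "m n > 0" unfolding m_def using q s by (intro mult_pos_pos sum_pos) auto
  \<comment> \<open>The premise for \<open>Suc n\<close> says precisely that the current atom is
    heavier than 1 - \<alpha> and so survives one more compression.\<close>
  have "measure ?\<mu> {m n} > 1 - \<alpha>" using IH(2) Suc.prems by (simp add: algebra_simps)
  note conv = two_point_conv[OF IH(1) mn \<alpha> \<gamma> this]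
  have mS: "m (Suc n) = q + \<sigma>\<^sup>2 * (\<gamma> * m n)"
    unfolding m_def by (subst sum.lessThan_Suc_shift) (simp add: sum_distrib_left algebra_simps)
  have "root_approximable (m (Suc n)) (lsd q \<sigma> \<alpha> \<gamma> (Suc (Suc n)))"
    unfolding mS lsd.simps by (rule root_approximable_distr_affine[OF conv(1)]) (use \<sigma> q in auto)
  moreover have "measure (lsd q \<sigma> \<alpha> \<gamma> (Suc (Suc n))) {m (Suc n)} = 1 - real (Suc n) * (1 - \<alpha>)"
  proof -
    have "real_distribution (two_point \<alpha> \<gamma> \<boxtimes> ?\<mu>)"
      using conv(1) by (simp add: root_approximable_def prob_on_def)
    then show ?thesis
      unfolding mS lsd.simps(3) by (subst measure_distr_affine_atom) (use \<sigma> conv(2) IH(2) in \<open>auto simp: algebra_simps\<close>)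
  qed
  ultimately show ?case ..
qed

section \<open>Asymptotics of the geometric sum\<close>

lemma isCont_expfrac: "isCont expfrac x"
proof (cases "x = 0")
  case True
  have "((\<lambda>x::real. (1 - exp (- x)) / x) \<longlongrightarrow> 1) (at 0)" by real_asymp
  then have "(expfrac \<longlongrightarrow> 1) (at 0)"
    by (rule tendsto_cong[THEN iffD1, rotated]) (auto simp: expfrac_def eventually_at_filter)
  then show ?thesis using True by (simp add: isCont_def expfrac_def)
next
  case False
  have "isCont (\<lambda>x::real. (1 - exp (- x)) / x) x" using False by (intro continuous_intros) auto
  moreover have "eventually (\<lambda>y. (1 - exp (- y)) / y = expfrac y) (nhds x)"
    using False by (auto simp: expfrac_def elim!: eventually_mono[OF t1_space_nhds])
  ultimately show ?thesis by (simp only: isCont_cong)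
qed

text \<open>With s = exp (- \<theta> / L), both 1 - s^L and 1 - s have the form 1 - exp (- x). The
  identity is exact and includes s = 1 through the value of \<open>expfrac\<close> at 0, so the
  limit needs only the continuity of \<open>expfrac\<close>.\<close>

lemma geometric_mean_expfrac:
  assumes s: "s > 0" and L: "L > 0"
  defines "\<theta> \<equiv> - (real L * ln s)"
  shows "(\<Sum>k<L. s ^ k) / real L = expfrac \<theta> / expfrac (\<theta> / real L)"
proof (cases "s = 1")
  case True
  then show ?thesis using L by (simp add: \<theta>_def expfrac_def)
next
  case False
  then have ln: "ln s \<noteq> 0" using s by simp
  have "exp (- \<theta>) = s ^ L" unfolding \<theta>_def using s by (simp add: exp_of_nat_mult)
  moreover have "exp (- (\<theta> / real L)) = s" unfolding \<theta>_def using s L by simp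
  moreover have "(\<Sum>k<L. s ^ k) = (1 - s ^ L) / (1 - s)" using False by (simp add: sum_gp_strict)
  ultimately show ?thesis
    using L ln False by (simp add: expfrac_def) (simp add: \<theta>_def field_simps)
qed

lemma expfrac_bigo: "(\<lambda>e. c * expfrac e - c * (1 - e / 2)) \<in> O[at 0](\<lambda>e. e\<^sup>2)"
proof -
  have "(\<lambda>e::real. (1 - exp (- e)) / e - (1 - e / 2)) \<in> O[at 0](\<lambda>e. e\<^sup>2)" by real_asymp
  then have "(\<lambda>e. c * ((1 - exp (- e)) / e - (1 - e / 2))) \<in> O[at 0](\<lambda>e. e\<^sup>2)"
    by (cases "c = 0") simp_all
  then show ?thesis
    by (rule landau_o.big.in_cong[THEN iffD1, rotated])
       (auto simp: expfrac_def eventually_at_filter algebra_simps)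
qed

theorem theorem4p3:
  fixes q \<sigma> \<alpha> \<gamma> :: "nat \<Rightarrow> real"
    and qlim \<epsilon>1 \<epsilon>2 :: real
  assumes q_pos: "\<And>L. q L > 0"
    and sigma_pos: "\<And>L. \<sigma> L > 0"
    and alpha_range: "\<And>L. 0 < \<alpha> L \<and> \<alpha> L < 1"
    and gamma_pos: "\<And>L. \<gamma> L > 0"
    and q_lim: "q \<longlonglongrightarrow> qlim"
    and sigma_conv: "convergent \<sigma>"
    and alpha_conv: "convergent \<alpha>"
    and gamma_conv: "convergent \<gamma>"
    and eps1: "(\<lambda>L. real L * (1 - \<alpha> L)) \<longlonglongrightarrow> \<epsilon>1"
    and eps2: "(\<lambda>L. - (real L * ln ((\<sigma> L)\<^sup>2 * \<gamma> L))) \<longlonglongrightarrow> \<epsilon>2"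
    and eps1_small: "\<bar>\<epsilon>1\<bar> < 1"
    and eps2_small: "\<bar>\<epsilon>2\<bar> < 1"
  shows "(\<exists>L0. \<forall>L\<ge>L0.
            is_atom (lsd (q L) (\<sigma> L) (\<alpha> L) (\<gamma> L) L)
                    (supp_max (lsd (q L) (\<sigma> L) (\<alpha> L) (\<gamma> L) L))
          \<and> measure (lsd (q L) (\<sigma> L) (\<alpha> L) (\<gamma> L) L)
                    {supp_max (lsd (q L) (\<sigma> L) (\<alpha> L) (\<gamma> L) L)}
              = 1 - (real L - 1) * (1 - \<alpha> L))
       \<and> (\<lambda>L. supp_max (lsd (q L) (\<sigma> L) (\<alpha> L) (\<gamma> L) L) / real L)
            \<longlonglongrightarrow> qlim * expfrac \<epsilon>2
       \<and> (\<lambda>e. qlim * expfrac e - qlim * (1 - e / 2)) \<in> O[at 0](\<lambda>e. e\<^sup>2)"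
proof -
  define \<mu> where "\<mu> L = lsd (q L) (\<sigma> L) (\<alpha> L) (\<gamma> L) L" for L
  define s where "s L = (\<sigma> L)\<^sup>2 * \<gamma> L" for L
  define \<theta> where "\<theta> L = - (real L * ln (s L))" for L
  have s: "s L > 0" for L unfolding s_def using sigma_pos[of L] gamma_pos[of L] by simp
  have "\<forall>\<^sub>F L in sequentially. real L * (1 - \<alpha> L) < 1"
    by (rule order_tendstoD(2)[OF eps1]) (use eps1_small in auto)
  then have "\<forall>\<^sub>F L in sequentially. L \<ge> 1 \<and> real L * (1 - \<alpha> L) < 1"
    using eventually_ge_at_top[of 1] by eventually_elim auto
  then obtain L0 where L0: "\<And>L. L \<ge> L0 \<Longrightarrow> L \<ge> 1 \<and> real L * (1 - \<alpha> L) < 1"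
    unfolding eventually_sequentially by blast
  have top: "supp_max (\<mu> L) = q L * (\<Sum>k<L. s L ^ k)"
    "measure (\<mu> L) {supp_max (\<mu> L)} = 1 - (real L - 1) * (1 - \<alpha> L)"
    "is_atom (\<mu> L) (supp_max (\<mu> L))" if L: "L \<ge> L0" for L
  proof -
    obtain n where n: "L = Suc n" using L0[OF L] by (cases L) auto
    have \<alpha>: "0 < \<alpha> L" "\<alpha> L < 1" using alpha_range by auto
    have small: "real n * (1 - \<alpha> L) < 1" using L0[OF L] \<alpha> n by (simp add: algebra_simps)
    have *: "root_approximable (q L * (\<Sum>k<L. s L ^ k)) (\<mu> L)"
      "measure (\<mu> L) {q L * (\<Sum>k<L. s L ^ k)} = 1 - real n * (1 - \<alpha> L)"
      using lsd_top_atom[OF q_pos[of L] sigma_pos[of L] \<alpha> gamma_pos[of L] small]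
      unfolding \<mu>_def s_def by (simp_all only: n[symmetric])
    then show 1: "supp_max (\<mu> L) = q L * (\<Sum>k<L. s L ^ k)"
      using small by (intro supp_max_atom) (auto simp: root_approximable_def)
    show "measure (\<mu> L) {supp_max (\<mu> L)} = 1 - (real L - 1) * (1 - \<alpha> L)" 
      proof -
      have "real L - 1 = real n" using n by simp
      then show ?thesis using *(2) by (simp only: 1)
    qed
    show "is_atom (\<mu> L) (supp_max (\<mu> L))" unfolding is_atom_def 1 *(2) using small by simp
  qed
  have \<theta>: "\<theta> \<longlonglongrightarrow> \<epsilon>2" using eps2 by (simp add: \<theta>_def[abs_def] s_def)
  have "(\<lambda>L. \<theta> L * inverse (real L)) \<longlonglongrightarrow> \<epsilon>2 * 0"
    by (intro tendsto_mult \<theta> lim_inverse_n)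
  then have \<theta>0: "(\<lambda>L. \<theta> L / real L) \<longlonglongrightarrow> 0" by (simp add: divide_inverse)
  have "(\<lambda>L. expfrac (\<theta> L)) \<longlonglongrightarrow> expfrac \<epsilon>2" "(\<lambda>L. expfrac (\<theta> L / real L)) \<longlonglongrightarrow> expfrac 0"
    by (rule isCont_tendsto_compose[OF isCont_expfrac \<theta>], rule isCont_tendsto_compose[OF isCont_expfrac \<theta>0])
  then have "(\<lambda>L. q L * (expfrac (\<theta> L) / expfrac (\<theta> L / real L))) \<longlonglongrightarrow> qlim * (expfrac \<epsilon>2 / expfrac 0)"
    by (intro tendsto_mult tendsto_divide q_lim) (auto simp: expfrac_def)
  moreover have "\<forall>\<^sub>F L in sequentially. q L * (expfrac (\<theta> L) / expfrac (\<theta> L / real L)) = supp_max (\<mu> L) / real L"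
    unfolding eventually_sequentially
  proof (intro exI[of _ L0] allI impI)
    fix L assume L: "L0 \<le> L"
    have "L > 0" using L0[OF L] by simp
    have geo: "(\<Sum>k<L. s L ^ k) / real L = expfrac (\<theta> L) / expfrac (\<theta> L / real L)"
      unfolding \<theta>_def by (rule geometric_mean_expfrac[OF s \<open>L > 0\<close>])
    show "q L * (expfrac (\<theta> L) / expfrac (\<theta> L / real L)) = supp_max (\<mu> L) / real L"
      unfolding top(1)[OF L] geo[symmetric] by (rule times_divide_eq_right)
  qed
  ultimately have "(\<lambda>L. supp_max (\<mu> L) / real L) \<longlonglongrightarrow> qlim * (expfrac \<epsilon>2 / expfrac 0)"
    by (rule Lim_transform_eventually)
  then have lim: "(\<lambda>L. supp_max (\<mu> L) / real L) \<longlonglongrightarrow> qlim * expfrac \<epsilon>2" by (simp add: expfrac_def)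
  show ?thesis
    using top(2,3) lim expfrac_bigo[of qlim] unfolding \<mu>_def by blast
qed

end
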